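(* Let $M, N$ be nondegenerate Orlicz functions with upper Matuszewska-Orlicz indices $\beta_M,\beta_N\in[1,\infty]$. If $\beta_M<\beta_N$, or $\beta_N\leq\beta_M<2$, or $\beta_M=\beta_N=\infty$, then the Orlicz sequence space $h_M$ strongly uniformly embeds into the Orlicz sequence space $h_N$.
   Context: All Banach spaces are real. Orlicz functions and spaces. A function $M:[0,\infty)\to[0,\infty)$ is an Orlicz function if it is continuous, nondecreasing and convex, $M(0)=0$ and $\lim_{t\to\infty}M(t)=\infty$. It is nondegenerate if $M(t)>0$ for all $t>0$. $\ell_M$ is the Banach space of real sequences $x=(x_n)_{n=1}^\infty$ with $\sum_n M(|x_n|/\rho)<\infty$ for some $\rho>0$, with norm $\|x\|=\inf\{\rho>0:\sum_{n=1}^\infty M(|x_n|/\rho)\leq1\}$. $h_M$ is the closed subspace of $\ell_M$ of those $x$ with $\sum_n M(|x_n|/\rho)<\infty$ for every $\rho>0$, with the inherited norm. Upper Matuszewska-Orlicz index: $\beta_M=\inf\left\{q\in\mathbb{R}:\inf_{\lambda,t\in(0,1]}\frac{M(\lambda t)}{M(\lambda)t^q}>0\right\}$, with $\inf\emptyset=\infty$; one has $1\le\beta_M\le\infty$. Embeddings. Let $f:X\to Y$ be a map between metric spaces $(X,d_X),(Y,d_Y)$. $f$ is a coarse embedding if there are nondecreasing $\rho_1,\rho_2:[0,\infty)\to[0,\infty)$ with $\lim_{t\to\infty}\rho_1(t)=\infty$ and $\rho_1(d_X(x,y))\leq d_Y(f(x),f(y))\leq\rho_2(d_X(x,y))$ for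 all $x,y\in X$. $f$ is a uniform embedding if it is injective and both $f$ and $f^{-1}:f(X)\to X$ are uniformly continuous. $f$ is a strong uniform embedding if it is both a coarse and a uniform embedding. $X$ strongly uniformly embeds into $Y$ if there exists a strong uniform embedding $X\to Y$. *)

theory Defs
  imports "HOL-Analysis.Analysis"
begin

section \<open>Orlicz functions and Orlicz sequence spaces\<close>

text \<open>A function from the half-line \<open>[0,\<infinity>)\<close> to itself is represented by a total function on the
  reals of which only the values on \<open>{0..}\<close> matter.\<close>

definition orlicz_function :: "(real \<Rightarrow> real) \<Rightarrow> bool" where
  "orlicz_function M \<longleftrightarrow>
     (\<forall>t\<ge>0. 0 \<le> M t) \<and> continuous_on {0..} M \<and> mono_on {0..} M \<and> convex_on {0..} M \<and>
     M 0 = 0 \<and> filterlim M at_top at_top"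

definition nondegenerate :: "(real \<Rightarrow> real) \<Rightarrow> bool" where
  "nondegenerate M \<longleftrightarrow> (\<forall>t>0. M t > 0)"

text \<open>The sum \<open>\<Sum>n. M (\<bar>x n\<bar> / \<rho>)\<close>, taken in \<open>[0,\<infinity>]\<close>; sequences are indexed from \<open>0\<close>.\<close>

definition orlicz_modular :: "(real \<Rightarrow> real) \<Rightarrow> (nat \<Rightarrow> real) \<Rightarrow> real \<Rightarrow> ennreal" where
  "orlicz_modular M x \<rho> = (\<Sum>n. ennreal (M (\<bar>x n\<bar> / \<rho>)))"

definition orlicz_ell :: "(real \<Rightarrow> real) \<Rightarrow> (nat \<Rightarrow> real) set" where
  "orlicz_ell M = {x. \<exists>\<rho>>0. orlicz_modular M x \<rho> < \<infinity>}"

definition orlicz_norm :: "(real \<Rightarrow> real) \<Rightarrow> (nat \<Rightarrow> real) \<Rightarrow> real" where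
  "orlicz_norm M x = Inf {\<rho>. \<rho> > 0 \<and> orlicz_modular M x \<rho> \<le> 1}"

definition orlicz_h :: "(real \<Rightarrow> real) \<Rightarrow> (nat \<Rightarrow> real) set" where
  "orlicz_h M = {x \<in> orlicz_ell M. \<forall>\<rho>>0. orlicz_modular M x \<rho> < \<infinity>}"

text \<open>The type \<open>metric\<close> requires a nonnegative distance also outside the carrier, where
  \<open>orlicz_norm\<close> may be the infimum of the empty set; hence the guard. The lemmas
  \<open>mspace_orlicz_h_metric\<close> and \<open>mdist_orlicz_h_metric\<close> below identify the carrier and the
  distance.\<close>

definition orlicz_h_dist :: "(real \<Rightarrow> real) \<Rightarrow> (nat \<Rightarrow> real) \<Rightarrow> (nat \<Rightarrow> real) \<Rightarrow> real" where
  "orlicz_h_dist M x y =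
     (if x \<in> orlicz_h M \<and> y \<in> orlicz_h M then orlicz_norm M (\<lambda>n. x n - y n) else 0)"

definition orlicz_h_metric :: "(real \<Rightarrow> real) \<Rightarrow> (nat \<Rightarrow> real) metric" where
  "orlicz_h_metric M = metric (orlicz_h M, orlicz_h_dist M)"

text \<open>The upper Matuszewska-Orlicz index. The inner infimum is that of a nonempty set of
  nonnegative reals when \<open>M\<close> is a nondegenerate Orlicz function; the outer one is taken in the
  extended reals, so that it is \<open>\<infinity>\<close> for the empty set.\<close>

definition upper_MO_index :: "(real \<Rightarrow> real) \<Rightarrow> ereal" where
  "upper_MO_index M =
     Inf (ereal ` {q. (INF (l, t) \<in> {0<..1} \<times> {0<..1}. M (l * t) / (M l * t powr q)) > 0})"


section \<open>Embeddings of metric spaces\<close>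

definition coarse_embedding :: "'a metric \<Rightarrow> 'b metric \<Rightarrow> ('a \<Rightarrow> 'b) \<Rightarrow> bool" where
  "coarse_embedding X Y f \<longleftrightarrow>
     f \<in> mspace X \<rightarrow> mspace Y \<and>
     (\<exists>\<rho>1 \<rho>2 :: real \<Rightarrow> real.
        (\<forall>t\<ge>0. 0 \<le> \<rho>1 t) \<and> (\<forall>t\<ge>0. 0 \<le> \<rho>2 t) \<and>
        mono_on {0..} \<rho>1 \<and> mono_on {0..} \<rho>2 \<and> filterlim \<rho>1 at_top at_top \<and>
        (\<forall>x\<in>mspace X. \<forall>y\<in>mspace X.
           \<rho>1 (mdist X x y) \<le> mdist Y (f x) (f y) \<and> mdist Y (f x) (f y) \<le> \<rho>2 (mdist X x y)))"

definition uniform_embedding :: "'a metric \<Rightarrow> 'b metric \<Rightarrow> ('a \<Rightarrow> 'b) \<Rightarrow> bool" where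
  "uniform_embedding X Y f \<longleftrightarrow>
     inj_on f (mspace X) \<and>
     uniformly_continuous_map X Y f \<and>
     uniformly_continuous_map (submetric Y (f ` mspace X)) X (inv_into (mspace X) f)"

definition strong_uniform_embedding :: "'a metric \<Rightarrow> 'b metric \<Rightarrow> ('a \<Rightarrow> 'b) \<Rightarrow> bool" where
  "strong_uniform_embedding X Y f \<longleftrightarrow> coarse_embedding X Y f \<and> uniform_embedding X Y f"

definition strongly_uniformly_embeds :: "'a metric \<Rightarrow> 'b metric \<Rightarrow> bool" where
  "strongly_uniformly_embeds X Y \<longleftrightarrow> (\<exists>f. strong_uniform_embedding X Y f)"


section \<open>The space \<open>h\<^sub>M\<close> is a metric space\<close>

text \<open>\<open>metric\<close> is unspecified on pairs that are not metric spaces, so it has to be known that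
  \<open>orlicz_h_metric\<close> has the intended carrier and distance.\<close>

context
  fixes M :: "real \<Rightarrow> real"
  assumes M: "orlicz_function M"
begin

lemma orlicz_nonneg: "0 \<le> t \<Longrightarrow> 0 \<le> M t"
  using M by (auto simp: orlicz_function_def)

lemma orlicz_mono: "0 \<le> s \<Longrightarrow> s \<le> t \<Longrightarrow> M s \<le> M t"
  using M by (auto simp: orlicz_function_def monotone_on_def)

lemma orlicz_zero: "M 0 = 0"
  using M by (auto simp: orlicz_function_def)

lemma orlicz_convex:
  assumes "0 \<le> s" "0 \<le> t" "0 \<le> u" "0 \<le> v" "u + v = 1"
  shows "M (u * s + v * t) \<le> u * M s + v * M t"
  using M assms by (auto simp: orlicz_function_def convex_on_def)

lemma orlicz_modular_convex:
  assumes a: "a > 0" and b: "b > 0"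
  shows "orlicz_modular M (\<lambda>n. x n + y n) (a + b)
    \<le> ennreal (a / (a + b)) * orlicz_modular M x a + ennreal (b / (a + b)) * orlicz_modular M y b"
proof -
  let ?u = "a / (a + b)" and ?v = "b / (a + b)"
  have uv: "?u + ?v = 1" "0 \<le> ?u" "0 \<le> ?v"
    using a b by (auto simp: add_divide_distrib[symmetric])
  have le: "ennreal (M (\<bar>x n + y n\<bar> / (a + b)))
      \<le> ennreal ?u * ennreal (M (\<bar>x n\<bar> / a)) + ennreal ?v * ennreal (M (\<bar>y n\<bar> / b))" for n
  proof -
    have "\<bar>x n + y n\<bar> / (a + b) \<le> (\<bar>x n\<bar> + \<bar>y n\<bar>) / (a + b)"
      using a b by (intro divide_right_mono) auto
    also have "\<dots> = ?u * (\<bar>x n\<bar> / a) + ?v * (\<bar>y n\<bar> / b)"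
      using a b by (simp add: add_divide_distrib)
    finally have "M (\<bar>x n + y n\<bar> / (a + b)) \<le> M (?u * (\<bar>x n\<bar> / a) + ?v * (\<bar>y n\<bar> / b))"
      using a b by (intro orlicz_mono) auto
    also have "\<dots> \<le> ?u * M (\<bar>x n\<bar> / a) + ?v * M (\<bar>y n\<bar> / b)"
      using a b uv by (intro orlicz_convex) auto
    finally have "ennreal (M (\<bar>x n + y n\<bar> / (a + b)))
        \<le> ennreal (?u * M (\<bar>x n\<bar> / a) + ?v * M (\<bar>y n\<bar> / b))"
      by (rule ennreal_leI)
    also have "\<dots> = ennreal ?u * ennreal (M (\<bar>x n\<bar> / a)) + ennreal ?v * ennreal (M (\<bar>y n\<bar> / b))"
    proof -
      have p: "0 \<le> M (\<bar>x n\<bar> / a)" "0 \<le> M (\<bar>y n\<bar> / b)"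
        using a b by (auto intro!: orlicz_nonneg)
      then show ?thesis
        using uv(2,3) by (simp only: ennreal_plus mult_nonneg_nonneg ennreal_mult)
    qed
    finally show ?thesis .
  qed
  have "orlicz_modular M (\<lambda>n. x n + y n) (a + b)
      \<le> (\<Sum>n. ennreal ?u * ennreal (M (\<bar>x n\<bar> / a)) + ennreal ?v * ennreal (M (\<bar>y n\<bar> / b)))"
    unfolding orlicz_modular_def by (intro suminf_le le) auto
  also have "\<dots> = ennreal ?u * orlicz_modular M x a + ennreal ?v * orlicz_modular M y b"
    unfolding orlicz_modular_def by (simp add: suminf_add[symmetric])
  finally show ?thesis .
qed

lemma orlicz_modular_minus: "orlicz_modular M (\<lambda>n. x n - y n) r = orlicz_modular M (\<lambda>n. y n - x n) r"
  by (simp add: orlicz_modular_def abs_minus_commute)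

lemma orlicz_h_iff: "x \<in> orlicz_h M \<longleftrightarrow> (\<forall>\<rho>>0. orlicz_modular M x \<rho> < \<infinity>)"
  by (auto simp: orlicz_h_def orlicz_ell_def intro: exI[of _ 1])

lemma orlicz_h_diff:
  assumes x: "x \<in> orlicz_h M" and y: "y \<in> orlicz_h M"
  shows "(\<lambda>n. x n - y n) \<in> orlicz_h M"
  unfolding orlicz_h_iff
proof (intro allI impI)
  fix r :: real assume r: "r > 0"
  have my: "orlicz_modular M (\<lambda>n. - y n) (r/2) = orlicz_modular M y (r/2)"
    by (simp add: orlicz_modular_def)
  have "orlicz_modular M (\<lambda>n. x n + - y n) (r/2 + r/2) \<le>
     ennreal (r/2 / (r/2 + r/2)) * orlicz_modular M x (r/2)
     + ennreal (r/2 / (r/2 + r/2)) * orlicz_modular M (\<lambda>n. - y n) (r/2)"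
    using r by (intro orlicz_modular_convex) auto
  also have "\<dots> < \<infinity>"
    using x y r unfolding my orlicz_h_iff
    by (simp del: ennreal_half add: ennreal_mult_less_top)
  finally show "orlicz_modular M (\<lambda>n. x n - y n) r < \<infinity>"
    by simp
qed

lemma orlicz_norm_set_nonempty:
  assumes x: "x \<in> orlicz_h M"
  shows "{\<rho>. \<rho> > 0 \<and> orlicz_modular M x \<rho> \<le> 1} \<noteq> {}"
proof -
  obtain m where m: "m \<ge> 0" "orlicz_modular M x 1 = ennreal m"
    using x unfolding orlicz_h_iff
    by (metis ennreal_cases infinity_ennreal_def less_irrefl zero_less_one)
  have z: "orlicz_modular M (\<lambda>n. 0) (m + 1) = 0"
    by (simp add: orlicz_modular_def orlicz_zero)
  have "orlicz_modular M (\<lambda>n. x n + 0) (1 + (m + 1)) \<le>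
     ennreal (1 / (1 + (m + 1))) * orlicz_modular M x 1
     + ennreal ((m + 1) / (1 + (m + 1))) * orlicz_modular M (\<lambda>n. 0) (m + 1)"
    using m by (intro orlicz_modular_convex) auto
  also have "\<dots> = ennreal (m / (m + 2))"
    using m z by (simp add: ennreal_mult[symmetric] add.commute)
  also have "\<dots> \<le> 1"
    using m by simp
  finally show ?thesis
    using m by (auto intro!: exI[of _ "1 + (m + 1)"])
qed

lemma orlicz_norm_nonneg:
  assumes "x \<in> orlicz_h M" shows "0 \<le> orlicz_norm M x"
  unfolding orlicz_norm_def
  using orlicz_norm_set_nonempty[OF assms] by (intro cInf_greatest) auto

lemma orlicz_norm_le:
  assumes "r > 0" "orlicz_modular M x r \<le> 1" shows "orlicz_norm M x \<le> r"
  unfolding orlicz_norm_def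
  using assms by (intro cInf_lower bdd_belowI[of _ 0]) auto

lemma orlicz_norm_less:
  assumes "x \<in> orlicz_h M" "e > 0"
  obtains r where "r > 0" "orlicz_modular M x r \<le> 1" "r < orlicz_norm M x + e"
proof -
  have "Inf {\<rho>. \<rho> > 0 \<and> orlicz_modular M x \<rho> \<le> 1} < orlicz_norm M x + e"
    using assms(2) by (simp add: orlicz_norm_def)
  from cInf_lessD[OF orlicz_norm_set_nonempty[OF assms(1)] this] show thesis
    using that by auto
qed

lemma orlicz_norm_zero_iff:
  assumes x: "x \<in> orlicz_h M"
  shows "orlicz_norm M x = 0 \<longleftrightarrow> (\<forall>n. x n = 0)"
proof
  assume z: "\<forall>n. x n = 0"
  have "orlicz_norm M x \<le> 0 + e" if "e > 0" for e
    using that z by (intro order.trans[OF orlicz_norm_le[of e]])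
      (auto simp: orlicz_modular_def orlicz_zero)
  then have "orlicz_norm M x \<le> 0"
    by (rule field_le_epsilon)
  with orlicz_norm_nonneg[OF x] show "orlicz_norm M x = 0"
    by simp
next
  assume z: "orlicz_norm M x = 0"
  show "\<forall>n. x n = 0"
  proof (rule allI, rule ccontr)
    fix n assume n: "x n \<noteq> 0"
    have "eventually (\<lambda>t. M t > 1) at_top"
      using M by (auto simp: orlicz_function_def filterlim_at_top_dense)
    then obtain T where T: "\<And>t. t \<ge> T \<Longrightarrow> M t > 1"
      by (auto simp: eventually_at_top_linorder)
    define S where "S = max T 1"
    have S: "S > 0" "\<And>t. t \<ge> S \<Longrightarrow> M t > 1"
      using T by (auto simp: S_def)
    obtain r where r: "r > 0" "orlicz_modular M x r \<le> 1" "r < 0 + \<bar>x n\<bar> / S"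
      using orlicz_norm_less[OF x, of "\<bar>x n\<bar> / S"] n S z by auto
    have "S \<le> \<bar>x n\<bar> / r"
      using r S by (simp add: field_simps)
    then have "1 < M (\<bar>x n\<bar> / r)"
      by (rule S(2))
    then have "1 < ennreal (M (\<bar>x n\<bar> / r))"
      by simp
    also have "\<dots> \<le> orlicz_modular M x r"
      unfolding orlicz_modular_def
      using sum_le_suminf[of "\<lambda>n. ennreal (M (\<bar>x n\<bar> / r))" "{n}"] by auto
    finally show False
      using r(2) by simp
  qed
qed

lemma orlicz_norm_triangle:
  assumes x: "x \<in> orlicz_h M" and y: "y \<in> orlicz_h M"
  shows "orlicz_norm M (\<lambda>n. x n + y n) \<le> orlicz_norm M x + orlicz_norm M y"
proof (rule field_le_epsilon)
  fix e :: real assume e: "e > 0"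
  obtain a where a: "a > 0" "orlicz_modular M x a \<le> 1" "a < orlicz_norm M x + e/2"
    using orlicz_norm_less[OF x, of "e/2"] e by auto
  obtain b where b: "b > 0" "orlicz_modular M y b \<le> 1" "b < orlicz_norm M y + e/2"
    using orlicz_norm_less[OF y, of "e/2"] e by auto
  have "orlicz_modular M (\<lambda>n. x n + y n) (a + b)
      \<le> ennreal (a / (a + b)) * orlicz_modular M x a + ennreal (b / (a + b)) * orlicz_modular M y b"
    using a b by (intro orlicz_modular_convex) auto
  also have "\<dots> \<le> ennreal (a / (a + b)) * 1 + ennreal (b / (a + b)) * 1"
    using a b by (intro add_mono mult_left_mono) auto
  also have "\<dots> = ennreal (a / (a + b) + b / (a + b))"
    using a b by (simp add: ennreal_plus)
  also have "a / (a + b) + b / (a + b) = 1"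
    using a b by (simp add: add_divide_distrib[symmetric])
  finally have "orlicz_norm M (\<lambda>n. x n + y n) \<le> a + b"
    using a b by (intro orlicz_norm_le) auto
  with a b show "orlicz_norm M (\<lambda>n. x n + y n) \<le> orlicz_norm M x + orlicz_norm M y + e"
    by simp
qed

lemma Metric_space_orlicz_h: "Metric_space (orlicz_h M) (orlicz_h_dist M)"
proof
  fix x y :: "nat \<Rightarrow> real"
  show "0 \<le> orlicz_h_dist M x y"
    by (simp add: orlicz_h_dist_def orlicz_h_diff orlicz_norm_nonneg)
  show "orlicz_h_dist M x y = orlicz_h_dist M y x"
    using orlicz_modular_minus[of x y] by (auto simp: orlicz_h_dist_def orlicz_norm_def)
next
  fix x y assume "x \<in> orlicz_h M" "y \<in> orlicz_h M"
  then show "orlicz_h_dist M x y = 0 \<longleftrightarrow> x = y"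
    by (simp add: orlicz_h_dist_def orlicz_h_diff orlicz_norm_zero_iff fun_eq_iff)
next
  fix x y z assume "x \<in> orlicz_h M" "y \<in> orlicz_h M" "z \<in> orlicz_h M"
  then show "orlicz_h_dist M x z \<le> orlicz_h_dist M x y + orlicz_h_dist M y z"
    using orlicz_norm_triangle[OF orlicz_h_diff[of x y] orlicz_h_diff[of y z]]
    by (simp add: orlicz_h_dist_def)
qed

lemma mspace_orlicz_h_metric: "mspace (orlicz_h_metric M) = orlicz_h M"
  unfolding orlicz_h_metric_def
  by (rule Metric_space.mspace_metric[OF Metric_space_orlicz_h])

lemma mdist_orlicz_h_metric:
  assumes "x \<in> orlicz_h M" "y \<in> orlicz_h M"
  shows "mdist (orlicz_h_metric M) x y = orlicz_norm M (\<lambda>n. x n - y n)"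
  unfolding orlicz_h_metric_def Metric_space.mdist_metric[OF Metric_space_orlicz_h]
  using assms by (simp add: orlicz_h_dist_def)

end

end

theory Submission
  imports Defs
begin

text \<open>If \<open>N\<close> has infinite index, then for every \<open>q\<close> there are amplitudes \<open>\<mu>\<close> with
  \<open>N (\<mu> \<tau>) \<le> N \<mu> (\<tau>\<^sup>q + \<epsilon> \<tau>)\<close>, so suitable blocks in \<open>h\<^sub>N\<close> span a copy of \<open>c\<^sub>0\<close>, into which the
  separable space \<open>h\<^sub>M\<close> embeds by Aharoni's theorem.

  If \<open>\<beta>\<^sub>M < p < q < \<beta>\<^sub>N < \<infinity>\<close>, each coordinate \<open>x n\<close> is replaced by its waves
  \<open>cos (2\<^sup>j x n)\<close>, \<open>sin (2\<^sup>j x n)\<close> at all scales \<open>j\<close>, repeated until their \<open>N\<close>-modular is about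
  \<open>M (2\<^sup>-\<^sup>j)\<close>. Two such images of points at distance \<open>d\<close> then have \<open>N\<close>-modular distance about
  \<open>\<Sum>j. M (2\<^sup>-\<^sup>j) min(1, 2\<^sup>j d)\<^sup>q\<close>, which is comparable with \<open>M d\<close> because \<open>p < q\<close>.

  If \<open>\<beta>\<^sub>M < 2\<close>, the same waves with \<open>q = 2\<close> give a map into \<open>\<ell>\<^sub>2\<close> whose squared distance \<open>H\<close> is
  comparable with \<open>\<Sum>n. M \<bar>x n - y n\<bar>\<close>. The Poisson laws whose intensities are the squared
  coordinates times \<open>t\<close> have Hellinger affinity \<open>exp (- t H / 2)\<close>. Applying the inverse of \<open>N\<close> to
  the weights of these laws and joining the results for \<open>t = 4\<^sup>-\<^sup>k\<close> gives the embedding when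
  \<open>\<beta>\<^sub>N < \<infinity>\<close>.\<close>

subsection \<open>Unordered sums of nonnegative families\<close>

text \<open>The norm of an Orlicz space is not additive over coordinates, but its modular is.
  Outside the case of infinite target index all estimates are therefore made for modulars, and
  \<open>controls\<close> carries boundedness and smallness from one quantity to the next. Passing
  between modular and norm needs doubling of \<open>N\<close> on bounded arguments, which a finite
  index provides; hence those maps have coordinates with uniformly bounded differences. For an
  infinite index norms are estimated directly and the map is bi-Lipschitz.

  A power q below the index of \<open>N\<close> yields no power bound near 0, only isolated
  amplitudes with a linear error. The size of that error can be prescribed, so each block gets its
  own amplitude and the errors are made summable.

  In the case of index below 2, \<open>N\<close> need not resemble a square, so one leaves the
  Hilbert space for probability weights: on these the inverse of \<open>N\<close> turns total
  variation into \<open>N\<close>-modular, with control in both directions. Total variation never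
  exceeds 2, so a single t cannot see large distances; the number of t = 4^-k with t H at least 1
  grows like log H, while the upper bound of order sqrt (t H) is summable over k.\<close>

definition nsum :: "('i \<Rightarrow> ennreal) \<Rightarrow> ennreal" (binder "\<Sum>\<^sup>+" 10) where
  "nsum f = (\<integral>\<^sup>+ i. f i \<partial>count_space UNIV)"

lemma nsum_nat: "nsum f = (\<Sum>n::nat. f n)"
  by (simp add: nsum_def nn_integral_count_space_nat)

lemma nsum_mono: "(\<And>i. f i \<le> g i) \<Longrightarrow> nsum f \<le> nsum g"
  unfolding nsum_def by (intro nn_integral_mono)

lemma nsum_cmult: "(\<Sum>\<^sup>+ i. c * f i) = c * nsum f"
  unfolding nsum_def by (intro nn_integral_cmult) auto

lemma nsum_add: "(\<Sum>\<^sup>+ i. f i + g i) = nsum f + nsum g"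
  unfolding nsum_def by (intro nn_integral_add) auto

text \<open>Tonelli for counting measure. Sums are integrals over \<open>count_space\<close> because
  the index sets below are products, integers and finite words, which have no preferred order of
  summation.\<close>

lemma nsum_pair: "nsum f = (\<Sum>\<^sup>+ a. \<Sum>\<^sup>+ b. f (a, b))"
  unfolding nsum_def by (rule nn_integral_fst_count_space[symmetric])

lemma nsum_swap: "(\<Sum>\<^sup>+ a. \<Sum>\<^sup>+ b. f a b) = (\<Sum>\<^sup>+ b. \<Sum>\<^sup>+ a. f a b)"
  using nn_integral_fst_count_space[of "case_prod f"] nn_integral_snd_count_space[of "case_prod f"]
  unfolding nsum_def by simp

lemma nsum_reindex:
  assumes "inj h" "\<And>y. y \<notin> range h \<Longrightarrow> f y = 0"
  shows "nsum f = (\<Sum>\<^sup>+ i. f (h i))"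
proof -
  have "nsum f = (\<integral>\<^sup>+ y. f y \<partial>count_space (range h))"
    unfolding nsum_def using assms(2)
    by (subst nn_integral_count_space_indicator)
       (auto intro!: nn_integral_cong simp: indicator_def)
  also have "\<dots> = (\<integral>\<^sup>+ i. f (h i) \<partial>count_space UNIV)"
    using assms(1) by (intro nn_integral_bij_count_space[symmetric] inj_on_imp_bij_betw)
  finally show ?thesis
    by (simp add: nsum_def)
qed

lemma nsum_reindex_le:
  assumes "inj h"
  shows "(\<Sum>\<^sup>+ i. f (h i)) \<le> nsum f"
proof -
  have "(\<Sum>\<^sup>+ i. f (h i)) = (\<Sum>\<^sup>+ y. if y \<in> range h then f y else 0)"
    using assms by (subst nsum_reindex[of h]) auto
  also have "\<dots> \<le> nsum f"
    by (intro nsum_mono) auto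
  finally show ?thesis .
qed

lemma nsum_ge_point: "f i \<le> nsum f"
  unfolding nsum_def by (rule nn_integral_ge_point) simp

lemma nsum_finite_type: "nsum f = sum f (UNIV :: 'i::finite set)"
  unfolding nsum_def by (rule nn_integral_count_space_finite) simp

lemma nsum_bool_option_const: "(\<Sum>\<^sup>+ b::bool option. c) = 3 * c"
  unfolding nsum_finite_type by (simp add: UNIV_option_conv card_image)

lemma nsum_finite_support:
  assumes "finite A" "\<And>i. i \<notin> A \<Longrightarrow> f i = 0"
  shows "nsum f = sum f A"
  unfolding nsum_def using assms by (subst nn_integral_count_space'[of A]) auto

lemma nsum_replicate: "(\<Sum>\<^sup>+ k. if k < m then c else 0) = of_nat m * c"
  by (subst nsum_finite_support[of "{..<m}"]) auto

lemma sum_le_nsum: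
  assumes "finite A"
  shows "sum f A \<le> nsum f"
proof -
  have "sum f A = (\<Sum>\<^sup>+ i. if i \<in> A then f i else 0)"
    using assms by (subst nsum_finite_support[of A]) auto
  also have "\<dots> \<le> nsum f"
    by (intro nsum_mono) auto
  finally show ?thesis .
qed

lemma nsum_geometric:
  assumes "0 \<le> b" "b < 1" "0 \<le> c"
  shows "(\<Sum>\<^sup>+ n. ennreal (c * b ^ n)) = ennreal (c / (1 - b))"
proof -
  have "(\<lambda>n. c * b ^ n) sums (c * (1 / (1 - b)))"
    using assms by (intro sums_mult geometric_sums) auto
  then show ?thesis
    using assms unfolding nsum_nat
    by (intro suminf_ennreal_eq) auto
qed

lemma nsum_geometric_int:
  assumes "0 < b" "b < 1"
  shows "(\<Sum>\<^sup>+ i::int. ennreal (b ^ nat \<bar>i\<bar>)) \<le> ennreal (2 / (1 - b))"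
proof -
  let ?f = "\<lambda>i::int. ennreal (b ^ nat \<bar>i\<bar>)"
  have g: "(\<Sum>\<^sup>+ n. ennreal (b ^ n)) = ennreal (1 / (1 - b))"
    using nsum_geometric[of b 1] assms by simp
  have "nsum ?f \<le> (\<Sum>\<^sup>+ i. (if i \<in> range int then ?f i else 0) + (if i \<in> range (\<lambda>n. - int n) then ?f i else 0))"
  proof (intro nsum_mono)
    fix i :: int
    have "i = int (nat i) \<or> i = - int (nat (- i))"
      by linarith
    then have "i \<in> range int \<or> i \<in> range (\<lambda>n. - int n)"
      by blast
    then show "?f i \<le> (if i \<in> range int then ?f i else 0) + (if i \<in> range (\<lambda>n. - int n) then ?f i else 0)"
      by auto
  qed
  also have "\<dots> = (\<Sum>\<^sup>+ n. ennreal (b ^ n)) + (\<Sum>\<^sup>+ n. ennreal (b ^ n))"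
    unfolding nsum_add
    by (subst nsum_reindex[of int], simp, simp, subst nsum_reindex[of "\<lambda>n. - int n"])
       (auto simp: inj_def)
  also have "\<dots> = ennreal (2 / (1 - b))"
    using assms by (simp add: g ennreal_plus[symmetric] del: ennreal_plus)
  finally show ?thesis .
qed


subsection \<open>A criterion for strong uniform embeddings\<close>

text \<open>The first half is what a coarse embedding requires and the second what uniform
  continuity requires. The values lie in \<open>ennreal\<close> so that modulars can be compared
  before they are known to be finite.\<close>

definition controls :: "'p set \<Rightarrow> ('p \<Rightarrow> ennreal) \<Rightarrow> ('p \<Rightarrow> ennreal) \<Rightarrow> bool" where
  "controls P d e \<longleftrightarrow>
     (\<forall>R::real>0. \<exists>C::real>0. \<forall>p\<in>P. d p \<le> ennreal R \<longrightarrow> e p \<le> ennreal C) \<and>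
     (\<forall>\<epsilon>::real>0. \<exists>\<delta>::real>0. \<forall>p\<in>P. d p \<le> ennreal \<delta> \<longrightarrow> e p \<le> ennreal \<epsilon>)"

lemma controls_trans: "controls P d e \<Longrightarrow> controls P e g \<Longrightarrow> controls P d g"
proof -
  assume 1: "controls P d e" and 2: "controls P e g"
  show ?thesis
    unfolding controls_def
  proof (intro conjI allI impI)
    fix R :: real assume "R > 0"
    then obtain C where "C > 0" "\<forall>p\<in>P. d p \<le> ennreal R \<longrightarrow> e p \<le> ennreal C"
      using 1 unfolding controls_def by blast
    moreover from \<open>C > 0\<close> obtain B where "B > 0" "\<forall>p\<in>P. e p \<le> ennreal C \<longrightarrow> g p \<le> ennreal B"
      using 2 unfolding controls_def by blast
    ultimately show "\<exists>C>0. \<forall>p\<in>P. d p \<le> ennreal R \<longrightarrow> g p \<le> ennreal C"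
      by blast
  next
    fix \<epsilon> :: real assume "\<epsilon> > 0"
    then obtain \<delta> where "\<delta> > 0" "\<forall>p\<in>P. e p \<le> ennreal \<delta> \<longrightarrow> g p \<le> ennreal \<epsilon>"
      using 2 unfolding controls_def by blast
    moreover from \<open>\<delta> > 0\<close> obtain \<eta> where "\<eta> > 0" "\<forall>p\<in>P. d p \<le> ennreal \<eta> \<longrightarrow> e p \<le> ennreal \<delta>"
      using 1 unfolding controls_def by blast
    ultimately show "\<exists>\<delta>>0. \<forall>p\<in>P. d p \<le> ennreal \<delta> \<longrightarrow> g p \<le> ennreal \<epsilon>"
      by blast
  qed
qed

lemma controlsI_le:
  assumes "\<And>R. 0 < R \<Longrightarrow> 0 \<le> h R" "(h \<longlongrightarrow> 0) (at_right 0)"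
    and "\<And>p R. p \<in> P \<Longrightarrow> 0 < R \<Longrightarrow> d p \<le> ennreal R \<Longrightarrow> e p \<le> ennreal (h R)"
  shows "controls P d e"
  unfolding controls_def
proof (intro conjI allI impI)
  fix R :: real assume R: "R > 0"
  show "\<exists>C>0. \<forall>p\<in>P. d p \<le> ennreal R \<longrightarrow> e p \<le> ennreal C"
  proof (intro exI[of _ "h R + 1"] conjI ballI impI)
    show "0 < h R + 1" using assms(1)[OF R] by simp
    fix p assume "p \<in> P" "d p \<le> ennreal R"
    then have "e p \<le> ennreal (h R)" by (intro assms(3) R)
    also have "\<dots> \<le> ennreal (h R + 1)" by (intro ennreal_leI) simp
    finally show "e p \<le> ennreal (h R + 1)" .
  qed
next
  fix \<epsilon> :: real assume e: "\<epsilon> > 0"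
  have "eventually (\<lambda>R. h R < \<epsilon>) (at_right 0)"
    using order_tendstoD(2)[OF assms(2) e] .
  then obtain b where b: "b > 0" "\<And>R. 0 < R \<Longrightarrow> R < b \<Longrightarrow> h R < \<epsilon>"
    by (auto simp: eventually_at_right_field)
  have b2: "0 < b / 2" "h (b / 2) < \<epsilon>"
    using b by auto
  show "\<exists>\<delta>>0. \<forall>p\<in>P. d p \<le> ennreal \<delta> \<longrightarrow> e p \<le> ennreal \<epsilon>"
  proof (intro exI[of _ "b / 2"] conjI ballI impI b2(1))
    fix p assume "p \<in> P" "d p \<le> ennreal (b / 2)"
    then have "e p \<le> ennreal (h (b / 2))" by (intro assms(3) b2(1))
    also have "\<dots> \<le> ennreal \<epsilon>" using b2 by (intro ennreal_leI) simp
    finally show "e p \<le> ennreal \<epsilon>" .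
  qed
qed

lemma controlsI_linear:
  assumes "0 \<le> C" "\<And>p. p \<in> P \<Longrightarrow> e p \<le> ennreal C * d p"
  shows "controls P d e"
proof (rule controlsI_le[of "\<lambda>R. C * R"])
  show "((\<lambda>R. C * R) \<longlongrightarrow> 0) (at_right 0)"
    by (auto intro!: tendsto_eq_intros)
  fix p and R :: real assume "p \<in> P" "0 < R" "d p \<le> ennreal R"
  then have "e p \<le> ennreal C * ennreal R"
    by (intro order.trans[OF assms(2)] mult_left_mono) auto
  then show "e p \<le> ennreal (C * R)"
    using assms(1) \<open>0 < R\<close> by (simp add: ennreal_mult)
qed (use assms in auto)

lemma controls_add:
  assumes "controls P d e" "controls P d g"
  shows "controls P d (\<lambda>p. e p + g p)"
  unfolding controls_def
proof (intro conjI allI impI)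
  fix R :: real assume R: "0 < R"
  obtain A where A: "A > 0" "\<forall>p\<in>P. d p \<le> ennreal R \<longrightarrow> e p \<le> ennreal A"
    using assms(1) R unfolding controls_def by blast
  obtain B where B: "B > 0" "\<forall>p\<in>P. d p \<le> ennreal R \<longrightarrow> g p \<le> ennreal B"
    using assms(2) R unfolding controls_def by blast
  show "\<exists>C>0. \<forall>p\<in>P. d p \<le> ennreal R \<longrightarrow> e p + g p \<le> ennreal C"
    using A B by (intro exI[of _ "A + B"]) (auto simp: ennreal_plus intro!: add_mono)
next
  fix \<epsilon> :: real assume "0 < \<epsilon>"
  then have e2: "0 < \<epsilon> / 2" by simp
  obtain A where A: "A > 0" "\<forall>p\<in>P. d p \<le> ennreal A \<longrightarrow> e p \<le> ennreal (\<epsilon> / 2)"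
    using assms(1) e2 unfolding controls_def by blast
  obtain B where B: "B > 0" "\<forall>p\<in>P. d p \<le> ennreal B \<longrightarrow> g p \<le> ennreal (\<epsilon> / 2)"
    using assms(2) e2 unfolding controls_def by blast
  have "e p + g p \<le> ennreal \<epsilon>" if "p \<in> P" "d p \<le> ennreal (min A B)" for p
  proof -
    have "d p \<le> ennreal A" "d p \<le> ennreal B"
      by (rule order.trans[OF that(2)], rule ennreal_leI, simp)+
    then have "e p + g p \<le> ennreal (\<epsilon> / 2) + ennreal (\<epsilon> / 2)"
      using A B that(1) by (intro add_mono) auto
    also have "\<dots> = ennreal \<epsilon>"
      using e2 by (subst ennreal_plus[symmetric]) auto
    finally show ?thesis .
  qed
  then show "\<exists>\<delta>>0. \<forall>p\<in>P. d p \<le> ennreal \<delta> \<longrightarrow> e p + g p \<le> ennreal \<epsilon>"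
    using A(1) B(1) by (intro exI[of _ "min A B"]) auto
qed

lemma controls_mono:
  assumes "controls P d e" "\<And>p. p \<in> P \<Longrightarrow> g p \<le> e p"
  shows "controls P d g"
  using assms unfolding controls_def by (meson order.trans)

lemma controlsI_linear_ge:
  assumes "0 < C" "\<And>p. p \<in> P \<Longrightarrow> ennreal C * e p \<le> d p"
  shows "controls P d e"
proof (rule controlsI_linear[of "1 / C"])
  fix p assume "p \<in> P"
  then have "ennreal (1 / C) * (ennreal C * e p) \<le> ennreal (1 / C) * d p"
    by (intro mult_left_mono assms) auto
  then show "e p \<le> ennreal (1 / C) * d p"
    using assms(1) by (simp add: mult.assoc[symmetric] ennreal_mult[symmetric])
qed (use assms in auto)

lemma controls_realD:
  assumes "controls P (\<lambda>p. ennreal (d p)) (\<lambda>p. ennreal (e p))" "0 < r"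
  shows "\<exists>C>0. \<forall>p\<in>P. d p \<le> r \<longrightarrow> e p \<le> C" "\<exists>\<delta>>0. \<forall>p\<in>P. d p \<le> \<delta> \<longrightarrow> e p \<le> r"
proof -
  have *: "a \<le> b \<Longrightarrow> ennreal a \<le> ennreal b" "0 < b \<Longrightarrow> ennreal a \<le> ennreal b \<Longrightarrow> a \<le> b" for a b :: real
    by (auto simp: ennreal_leI)
  show "\<exists>C>0. \<forall>p\<in>P. d p \<le> r \<longrightarrow> e p \<le> C"
    using assms * unfolding controls_def by meson
  show "\<exists>\<delta>>0. \<forall>p\<in>P. d p \<le> \<delta> \<longrightarrow> e p \<le> r"
    using assms * unfolding controls_def by meson
qed

lemma strongly_uniformly_embedsI:
  fixes X :: "'a metric" and Y :: "'b metric"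
  defines "P \<equiv> mspace X \<times> mspace X"
  assumes f: "f \<in> mspace X \<rightarrow> mspace Y"
    and XY: "controls P (\<lambda>(x, y). ennreal (mdist X x y)) (\<lambda>(x, y). ennreal (mdist Y (f x) (f y)))"
    and YX: "controls P (\<lambda>(x, y). ennreal (mdist Y (f x) (f y))) (\<lambda>(x, y). ennreal (mdist X x y))"
  shows "strongly_uniformly_embeds X Y"
proof -
  define d where "d = mdist X"
  define e where "e = (\<lambda>x y. mdist Y (f x) (f y))"
  have e0: "0 \<le> e x y" for x y
    by (simp add: e_def)
  have d0: "0 \<le> d x y" for x y
    by (simp add: d_def)
  have XY': "controls P (\<lambda>p. ennreal (d (fst p) (snd p))) (\<lambda>p. ennreal (e (fst p) (snd p)))"
    using XY by (simp add: d_def e_def case_prod_unfold)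
  have YX': "controls P (\<lambda>p. ennreal (e (fst p) (snd p))) (\<lambda>p. ennreal (d (fst p) (snd p)))"
    using YX by (simp add: d_def e_def case_prod_unfold)
  have U: "\<exists>C>0. \<forall>x\<in>mspace X. \<forall>y\<in>mspace X. d x y \<le> R \<longrightarrow> e x y \<le> C" if "R > 0" for R
    using controls_realD(1)[OF XY' that] by (simp add: P_def)
  have u: "\<exists>\<delta>>0. \<forall>x\<in>mspace X. \<forall>y\<in>mspace X. d x y \<le> \<delta> \<longrightarrow> e x y \<le> \<epsilon>" if "\<epsilon> > 0" for \<epsilon>
    using controls_realD(2)[OF XY' that] by (simp add: P_def)
  have L: "\<exists>C>0. \<forall>x\<in>mspace X. \<forall>y\<in>mspace X. e x y \<le> R \<longrightarrow> d x y \<le> C" if "R > 0" for R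
    using controls_realD(1)[OF YX' that] by (simp add: P_def)
  have l: "\<exists>\<delta>>0. \<forall>x\<in>mspace X. \<forall>y\<in>mspace X. e x y \<le> \<delta> \<longrightarrow> d x y \<le> \<epsilon>" if "\<epsilon> > 0" for \<epsilon>
    using controls_realD(2)[OF YX' that] by (simp add: P_def)
  have "coarse_embedding X Y f"
  proof -
    define A where "A = (\<lambda>t::real. {e x y | x y. x \<in> mspace X \<and> y \<in> mspace X \<and> t \<le> d x y})"
    define B where "B = (\<lambda>t::real. {e x y | x y. x \<in> mspace X \<and> y \<in> mspace X \<and> d x y \<le> t})"
    \<comment> \<open>The moduli are the extremal ones. Inserting \<open>\<bar>t\<bar>\<close> keeps
      the infimum over a nonempty set when no pair is at distance at least t, as in a bounded space,
      and still tends to infinity.\<close>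
    define \<rho>1 where "\<rho>1 = (\<lambda>t. Inf (insert \<bar>t\<bar> (A t)))"
    define \<rho>2 where "\<rho>2 = (\<lambda>t. Sup (insert 0 (B t)))"
    have bddA: "bdd_below (insert \<bar>t\<bar> (A t))" for t
      by (rule bdd_belowI[of _ 0]) (auto simp: A_def e0)
    have bddB: "bdd_above (insert 0 (B t))" for t
    proof -
      obtain C where "C > 0" and C: "\<And>x y. x \<in> mspace X \<Longrightarrow> y \<in> mspace X \<Longrightarrow> d x y \<le> max t 1 \<Longrightarrow> e x y \<le> C"
        using U[of "max t 1"] by (metis less_max_iff_disj zero_less_one)
      have "\<forall>z \<in> insert 0 (B t). z \<le> C"
        using C \<open>C > 0\<close> unfolding B_def by (auto simp: le_max_iff_disj)
      then show ?thesis
        by (meson bdd_above.I)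
    qed
    show ?thesis
      unfolding coarse_embedding_def
    proof (intro conjI f, rule exI[of _ \<rho>1], rule exI[of _ \<rho>2], intro conjI ballI allI impI)
      fix t :: real assume "t \<ge> 0"
      show "0 \<le> \<rho>1 t"
        unfolding \<rho>1_def by (intro cInf_greatest) (auto simp: A_def e0)
      show "0 \<le> \<rho>2 t"
        unfolding \<rho>2_def by (intro cSup_upper bddB) auto
    next
      show "mono_on {0..} \<rho>1"
      proof (rule mono_onI)
        fix r s :: real assume rs: "r \<in> {0..}" "s \<in> {0..}" "r \<le> s"
        show "\<rho>1 r \<le> \<rho>1 s"
          unfolding \<rho>1_def
        proof (rule cInf_greatest)
          fix z assume "z \<in> insert \<bar>s\<bar> (A s)"
          then show "Inf (insert \<bar>r\<bar> (A r)) \<le> z"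
          proof
            assume z: "z = \<bar>s\<bar>"
            have "Inf (insert \<bar>r\<bar> (A r)) \<le> \<bar>r\<bar>"
              by (intro cInf_lower bddA) auto
            with rs z show ?thesis by simp
          next
            assume "z \<in> A s"
            then have "z \<in> A r"
              using rs unfolding A_def by (auto intro: order.trans)
            then show ?thesis
              by (intro cInf_lower bddA) auto
          qed
        qed auto
      qed
    next
      show "mono_on {0..} \<rho>2"
      proof (rule mono_onI)
        fix r s :: real assume rs: "r \<in> {0..}" "s \<in> {0..}" "r \<le> s"
        then have "B r \<subseteq> B s"
          unfolding B_def by (auto intro: order.trans)
        then show "\<rho>2 r \<le> \<rho>2 s"
          unfolding \<rho>2_def by (intro cSup_subset_mono bddB) auto
      qed
    next
      show "filterlim \<rho>1 at_top at_top"
        unfolding filterlim_at_top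
      proof (rule allI)
        fix Z :: real
        obtain C where "C > 0" and C: "\<And>x y. x \<in> mspace X \<Longrightarrow> y \<in> mspace X \<Longrightarrow> e x y \<le> max Z 1 \<Longrightarrow> d x y \<le> C"
          using L[of "max Z 1"] by (metis less_max_iff_disj zero_less_one)
        have "Z \<le> \<rho>1 t" if t: "t \<ge> max (C + 1) Z" for t
          unfolding \<rho>1_def
        proof (rule cInf_greatest)
          fix z assume "z \<in> insert \<bar>t\<bar> (A t)"
          then show "Z \<le> z"
          proof
            assume "z \<in> A t"
            then obtain x y where xy: "z = e x y" "x \<in> mspace X" "y \<in> mspace X" "t \<le> d x y"
              by (auto simp: A_def)
            then show ?thesis
              using C[of x y] t by (cases "e x y \<le> max Z 1") auto
          qed (use t in auto)
        qed auto
        then show "eventually (\<lambda>x. Z \<le> \<rho>1 x) at_top"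
          unfolding eventually_at_top_linorder by blast
      qed
    next
      fix x y assume xy: "x \<in> mspace X" "y \<in> mspace X"
      have "\<rho>1 (d x y) \<le> e x y"
        unfolding \<rho>1_def by (intro cInf_lower bddA) (use xy in \<open>auto simp: A_def\<close>)
      then show "\<rho>1 (mdist X x y) \<le> mdist Y (f x) (f y)"
        by (simp add: d_def e_def)
      have "e x y \<le> \<rho>2 (d x y)"
        unfolding \<rho>2_def by (intro cSup_upper bddB) (use xy in \<open>auto simp: B_def\<close>)
      then show "mdist Y (f x) (f y) \<le> \<rho>2 (mdist X x y)"
        by (simp add: d_def e_def)
    qed
  qed
  moreover have "uniform_embedding X Y f"
  proof -
    have inj: "inj_on f (mspace X)"
    proof (rule inj_onI)
      fix x y assume xy: "x \<in> mspace X" "y \<in> mspace X" "f x = f y"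
      then have z: "e x y = 0"
        using funcset_mem[OF f xy(1)] by (simp add: e_def mdist_zero)
      have "d x y \<le> 0 + \<epsilon>" if e: "\<epsilon> > 0" for \<epsilon>
      proof -
        obtain \<delta> where "\<delta> > 0" "\<And>x y. x \<in> mspace X \<Longrightarrow> y \<in> mspace X \<Longrightarrow> e x y \<le> \<delta> \<Longrightarrow> d x y \<le> \<epsilon>"
          using l[OF e] by blast
        then show ?thesis
          using z xy by simp
      qed
      then have "d x y \<le> 0"
        by (rule field_le_epsilon)
      then show "x = y"
        using xy(1,2) d0[of x y] antisym[of "d x y" 0] mdist_zero[of x X y] by (metis d_def)
    qed
    have "uniformly_continuous_map X Y f"
      unfolding uniformly_continuous_map_def
    proof (intro conjI allI impI f)
      fix \<epsilon> :: real assume "\<epsilon> > 0"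
      then obtain \<delta> where "\<delta> > 0" and \<delta>: "\<And>x y. x \<in> mspace X \<Longrightarrow> y \<in> mspace X \<Longrightarrow> d x y \<le> \<delta> \<Longrightarrow> e x y \<le> \<epsilon> / 2"
        using u[of "\<epsilon> / 2"] by (metis half_gt_zero)
      show "\<exists>\<delta>>0. \<forall>x\<in>mspace X. \<forall>y\<in>mspace X. mdist X y x < \<delta> \<longrightarrow> mdist Y (f y) (f x) < \<epsilon>"
        unfolding d_def[symmetric]
      proof (intro exI[of _ \<delta>] conjI ballI impI \<open>\<delta> > 0\<close>)
        fix x y assume "x \<in> mspace X" "y \<in> mspace X" "d y x < \<delta>"
        then show "mdist Y (f y) (f x) < \<epsilon>"
          using \<delta>[of y x] \<open>\<epsilon> > 0\<close> by (simp add: e_def)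
      qed
    qed
    moreover have "uniformly_continuous_map (submetric Y (f ` mspace X)) X (inv_into (mspace X) f)"
      unfolding uniformly_continuous_map_def
    proof (intro conjI allI impI)
      show "inv_into (mspace X) f \<in> mspace (submetric Y (f ` mspace X)) \<rightarrow> mspace X"
        by (auto intro: inv_into_into)
      fix \<epsilon> :: real assume "\<epsilon> > 0"
      then obtain \<delta> where "\<delta> > 0" and \<delta>: "\<And>x y. x \<in> mspace X \<Longrightarrow> y \<in> mspace X \<Longrightarrow> e x y \<le> \<delta> \<Longrightarrow> d x y \<le> \<epsilon> / 2"
        using l[of "\<epsilon> / 2"] by (metis half_gt_zero)
      show "\<exists>\<delta>>0. \<forall>x\<in>mspace (submetric Y (f ` mspace X)). \<forall>y\<in>mspace (submetric Y (f ` mspace X)).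
          mdist (submetric Y (f ` mspace X)) y x < \<delta> \<longrightarrow>
          mdist X (inv_into (mspace X) f y) (inv_into (mspace X) f x) < \<epsilon>"
      proof (intro exI[of _ \<delta>] conjI ballI impI \<open>\<delta> > 0\<close>)
        fix u v assume uv: "u \<in> mspace (submetric Y (f ` mspace X))" "v \<in> mspace (submetric Y (f ` mspace X))"
          "mdist (submetric Y (f ` mspace X)) v u < \<delta>"
        then obtain x y where "u = f x" "v = f y" "x \<in> mspace X" "y \<in> mspace X"
          by auto
        then show "mdist X (inv_into (mspace X) f v) (inv_into (mspace X) f u) < \<epsilon>"
          using uv(3) inj \<delta>[of y x] \<open>\<epsilon> > 0\<close> by (simp add: d_def e_def)
      qed
    qed
    ultimately show ?thesis
      using inj by (simp add: uniform_embedding_def)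
  qed
  ultimately show ?thesis
    by (auto simp: strongly_uniformly_embeds_def strong_uniform_embedding_def)
qed


subsection \<open>Orlicz functions, modulars and norms\<close>

lemma orlicz_scale:
  assumes "orlicz_function M" "0 \<le> t" "0 \<le> u" "u \<le> 1"
  shows "M (u * t) \<le> u * M t"
  using orlicz_convex[OF assms(1), of t 0 u "1 - u"] assms orlicz_zero[OF assms(1)] by simp

lemma orlicz_scale_ge:
  assumes "orlicz_function M" "0 \<le> t" "1 \<le> u"
  shows "u * M t \<le> M (u * t)"
  using orlicz_scale[OF assms(1), of "u * t" "1 / u"] assms by (simp add: field_simps)

lemma orlicz_continuous_on:
  assumes "orlicz_function M" "S \<subseteq> {0..}"
  shows "continuous_on S M"
  using assms by (auto simp: orlicz_function_def intro: continuous_on_subset)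

lemma orlicz_modular_nsum: "orlicz_modular M x r = (\<Sum>\<^sup>+ n. ennreal (M (\<bar>x n\<bar> / r)))"
  by (simp add: orlicz_modular_def nsum_nat)

lemma orlicz_modular_antimono:
  assumes "orlicz_function M" "0 < r" "r \<le> s"
  shows "orlicz_modular M x s \<le> orlicz_modular M x r"
  unfolding orlicz_modular_nsum using assms
  by (intro nsum_mono ennreal_leI orlicz_mono[OF assms(1)] divide_left_mono) auto

lemma orlicz_modular_le_1:
  assumes "orlicz_function M" "x \<in> orlicz_h M" "orlicz_norm M x < r"
  shows "orlicz_modular M x r \<le> 1"
proof -
  obtain s where s: "s > 0" "orlicz_modular M x s \<le> 1" "s < r"
    using orlicz_norm_less[OF assms(1,2), of "r - orlicz_norm M x"] assms(3) by auto
  then show ?thesis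
    using orlicz_modular_antimono[OF assms(1) s(1), of r x] by auto
qed

lemma orlicz_modular_gt_1_imp_norm_ge:
  assumes "orlicz_function M" "x \<in> orlicz_h M" "orlicz_modular M x r > 1"
  shows "r \<le> orlicz_norm M x"
  using orlicz_modular_le_1[OF assms(1,2), of r] assms(3) by (meson leD not_le)

lemma zero_in_orlicz_h: "orlicz_function M \<Longrightarrow> (\<lambda>n. 0) \<in> orlicz_h M"
  by (simp add: orlicz_h_iff orlicz_modular_def orlicz_zero)

text \<open>Carries families over other countable index types to the sequences on which Orlicz
  spaces are defined; the padding is invisible to the modular because
  \<open>M 0 = 0\<close>.\<close>

definition spread :: "('i::countable \<Rightarrow> real) \<Rightarrow> nat \<Rightarrow> real" where
  "spread z k = (if k \<in> range (to_nat :: 'i \<Rightarrow> nat) then z (from_nat k) else 0)"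

lemma spread_diff: "(\<lambda>k. spread u k - spread v k) = spread (\<lambda>i. u i - v i)"
  by (auto simp: spread_def)

lemma orlicz_modular_spread:
  fixes z :: "'i::countable \<Rightarrow> real"
  assumes "orlicz_function M"
  shows "orlicz_modular M (spread z) r = (\<Sum>\<^sup>+ i. ennreal (M (\<bar>z i\<bar> / r)))"
  unfolding orlicz_modular_nsum
  by (subst nsum_reindex[of "to_nat :: 'i \<Rightarrow> nat"]) (auto simp: spread_def orlicz_zero[OF assms])


subsection \<open>Power type estimates\<close>

text \<open>Positivity of the inner infimum of \<open>upper_MO_index\<close>, in a form free of
  division.\<close>

definition dominates_power :: "(real \<Rightarrow> real) \<Rightarrow> real \<Rightarrow> bool" where
  "dominates_power M q \<longleftrightarrow> (\<exists>c>0. \<forall>l\<in>{0<..1}. \<forall>t\<in>{0<..1}. c * (M l * t powr q) \<le> M (l * t))"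

lemma Inf_MO_quotient_pos_iff:
  assumes "orlicz_function M" "nondegenerate M"
  shows "(INF (l, t) \<in> {0<..1} \<times> {0<..1}. M (l * t) / (M l * t powr q)) > 0 \<longleftrightarrow> dominates_power M q"
    (is "?I > 0 \<longleftrightarrow> _")
proof -
  let ?Q = "\<lambda>(l, t). M (l * t) / (M l * t powr q)"
  have pos: "0 < M l * t powr q" if "l \<in> {0<..1}" "t \<in> {0<..1}" for l t
    using assms(2) that by (auto simp: nondegenerate_def)
  have nn: "0 \<le> M (l * t)" if "l \<in> {0<..1}" "t \<in> {0<..1}" for l t
    using orlicz_nonneg[OF assms(1)] that by auto
  have bdd: "bdd_below (?Q ` ({0<..1} \<times> {0<..1}))"
  proof (rule bdd_belowI[of _ 0])
    fix y assume "y \<in> ?Q ` ({0<..1} \<times> {0<..1})"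
    then obtain l t where "l \<in> {0<..1}" "t \<in> {0<..1}" "y = M (l * t) / (M l * t powr q)"
      by auto
    then show "0 \<le> y"
      using pos[of l t] nn[of l t] by simp
  qed
  show ?thesis
  proof
    assume I: "?I > 0"
    have "?I * (M l * t powr q) \<le> M (l * t)" if "l \<in> {0<..1}" "t \<in> {0<..1}" for l t
    proof -
      have "?I \<le> M (l * t) / (M l * t powr q)"
        using cINF_lower[OF bdd, of "(l, t)"] that by auto
      then show ?thesis
        using pos[OF that] by (simp add: pos_le_divide_eq)
    qed
    with I show "dominates_power M q"
      unfolding dominates_power_def by blast
  next
    assume "dominates_power M q"
    then obtain c where c: "c > 0" "\<And>l t. l \<in> {0<..1} \<Longrightarrow> t \<in> {0<..1} \<Longrightarrow> c * (M l * t powr q) \<le> M (l * t)"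
      by (auto simp: dominates_power_def)
    have "c \<le> ?I"
    proof (rule cINF_greatest)
      show "{0<..1::real} \<times> {0<..1::real} \<noteq> {}"
        by (auto intro!: exI[of _ 1])
      fix p :: "real \<times> real" assume "p \<in> {0<..1} \<times> {0<..1}"
      then show "c \<le> ?Q p"
        using c(2) pos by (auto simp: pos_le_divide_eq)
    qed
    with c(1) show "?I > 0"
      by simp
  qed
qed

lemma upper_MO_index_eq:
  assumes "orlicz_function M" "nondegenerate M"
  shows "upper_MO_index M = Inf (ereal ` {q. dominates_power M q})"
  unfolding upper_MO_index_def Inf_MO_quotient_pos_iff[OF assms] ..

lemma upper_MO_index_less:
  assumes "orlicz_function M" "nondegenerate M" "upper_MO_index M < b"
  obtains p where "ereal p < b" "dominates_power M p"
  using assms(3) unfolding upper_MO_index_eq[OF assms(1,2)] Inf_less_iff by auto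

lemma less_upper_MO_index:
  assumes "orlicz_function M" "nondegenerate M" "ereal q < upper_MO_index M"
  shows "\<not> dominates_power M q"
proof
  assume "dominates_power M q"
  then have "upper_MO_index M \<le> ereal q"
    unfolding upper_MO_index_eq[OF assms(1,2)] by (intro Inf_lower) auto
  with assms(3) show False
    by simp
qed

text \<open>Convexity gives M t at most t M 1, so c t^p is at most t on (0,1]; for p < 1 this fails
  as t tends to 0.\<close>

lemma dominates_power_ge_1:
  assumes "orlicz_function M" "nondegenerate M" "dominates_power M p"
  shows "1 \<le> p"
proof (rule ccontr)
  assume "\<not> 1 \<le> p"
  then have p: "p < 1" by simp
  obtain c where c: "c > 0" "\<And>l t. l \<in> {0<..1} \<Longrightarrow> t \<in> {0<..1} \<Longrightarrow> c * (M l * t powr p) \<le> M (l * t)"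
    using assms(3) by (auto simp: dominates_power_def)
  have M1: "M 1 > 0"
    using assms(2) by (simp add: nondegenerate_def)
  have le: "c \<le> t powr (1 - p)" if t: "t \<in> {0<..1}" for t
  proof -
    have "c * (M 1 * t powr p) \<le> M (1 * t)"
      using c(2)[of 1 t] t by simp
    also have "\<dots> \<le> t * M 1"
      using orlicz_scale[OF assms(1), of 1 t] t by simp
    finally have "c * t powr p \<le> t"
      using M1 by (simp add: mult.left_commute mult.commute[of "M 1"])
    then show ?thesis
      using t by (simp add: powr_diff field_simps)
  qed
  define t where "t = min 1 ((c / 2) powr (1 / (1 - p)))"
  have t: "t \<in> {0<..1}"
    using c(1) by (simp add: t_def)
  have "c \<le> t powr (1 - p)"
    by (rule le[OF t])
  also have "\<dots> \<le> ((c / 2) powr (1 / (1 - p))) powr (1 - p)"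
    using t p by (intro powr_mono2) (auto simp: t_def)
  also have "\<dots> = c / 2"
    using p c(1) by (simp add: powr_powr)
  finally show False
    using c(1) by simp
qed

text \<open>Doubling on bounded arguments. If L s is at most 1, the power estimate applies with l =
  L s and t = 1/L. Otherwise s is at least 1/L, and monotonicity compares the two fixed values N (L
  B) and N (1/L).\<close>

lemma dominates_power_delta2:
  assumes N: "orlicz_function N" "nondegenerate N" "dominates_power N q" and L: "1 \<le> L" and B: "0 < B"
  obtains K where "1 \<le> K" "\<And>s. 0 \<le> s \<Longrightarrow> s \<le> B \<Longrightarrow> N (L * s) \<le> K * N s"
proof -
  obtain c where c: "c > 0" "\<And>l t. l \<in> {0<..1} \<Longrightarrow> t \<in> {0<..1} \<Longrightarrow> c * (N l * t powr q) \<le> N (l * t)"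
    using N(3) by (auto simp: dominates_power_def)
  define K where "K = max 1 (max (L powr q / c) (N (L * B) / N (1 / L)))"
  have N1: "N (1 / L) > 0"
    using L N(2) by (simp add: nondegenerate_def)
  have "N (L * s) \<le> K * N s" if s: "0 \<le> s" "s \<le> B" for s
  proof (cases "s = 0")
    case True
    then show ?thesis by (simp add: orlicz_zero[OF N(1)])
  next
    case False
    have Ns: "0 \<le> N s"
      using s orlicz_nonneg[OF N(1)] by auto
    show ?thesis
    proof (cases "L * s \<le> 1")
      case True
      have "c * (N (L * s) * (1 / L) powr q) \<le> N (L * s * (1 / L))"
        using True False s L by (intro c(2)) auto
      then have "N (L * s) \<le> (L powr q / c) * N s"
        using L c(1) by (simp add: powr_divide field_simps)
      also have "\<dots> \<le> K * N s"
        by (intro mult_right_mono Ns) (simp add: K_def)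
      finally show ?thesis .
    next
      case False
      have "N (L * s) \<le> N (L * B)"
        using s L by (intro orlicz_mono[OF N(1)]) auto
      also have "\<dots> = (N (L * B) / N (1 / L)) * N (1 / L)"
        using N1 by simp
      also have "\<dots> \<le> K * N s"
      proof (intro mult_mono)
        show "N (1 / L) \<le> N s"
          using False L s by (intro orlicz_mono[OF N(1)]) (auto simp: field_simps)
      qed (use N1 in \<open>auto simp: K_def\<close>)
      finally show ?thesis .
    qed
  qed
  moreover have "1 \<le> K"
    by (simp add: K_def)
  ultimately show thesis
    using that by blast
qed

text \<open>The point \<open>\<mu>\<close> maximises \<open>N s / s powr q\<close> on an interval over which this quotient grows
  by the factor \<open>1 / \<epsilon>\<close>; below the interval, convexity gives the linear term.\<close>

lemma not_dominates_power_block: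
  assumes N: "orlicz_function N" "nondegenerate N" "\<not> dominates_power N q"
    and q: "1 \<le> q" and e: "0 < \<epsilon>" and d: "0 < \<delta>"
  obtains \<mu> where "0 < \<mu>" "\<mu> \<le> \<delta>" "\<mu> \<le> 1"
    "\<And>\<tau>. 0 \<le> \<tau> \<Longrightarrow> \<tau> \<le> 1 \<Longrightarrow> N (\<mu> * \<tau>) \<le> N \<mu> * (\<tau> powr q + \<epsilon> * \<tau>)"
proof -
  have Npos: "N s > 0" if "s > 0" for s
    using N(2) that by (simp add: nondegenerate_def)
  define D where "D = min \<delta> 1"
  have D: "0 < D" "D \<le> 1" "D \<le> \<delta>"
    using d by (auto simp: D_def)
  have "\<exists>l t. 0 < l \<and> l \<le> D \<and> 0 < t \<and> t \<le> 1 \<and> N (l * t) < \<epsilon> * (N l * t powr q)"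
  proof (rule ccontr)
    assume "\<not> ?thesis"
    then have ge: "\<epsilon> * (N l * t powr q) \<le> N (l * t)" if "0 < l" "l \<le> D" "0 < t" "t \<le> 1" for l t
      using that by (meson not_le)
    \<comment> \<open>A lower estimate valid for all l up to D would extend to all l up to 1 with
      this constant: for larger l, N (l t) is at least N (D t), while N l is at most N 1.\<close>
    let ?c = "\<epsilon> * (N D / N 1)"
    have "?c * (N l * t powr q) \<le> N (l * t)" if lt: "l \<in> {0<..1}" "t \<in> {0<..1}" for l t
    proof (cases "l \<le> D")
      case True
      have "N D \<le> N 1"
        using D by (intro orlicz_mono[OF N(1)]) auto
      then have "?c \<le> \<epsilon>"
        using e Npos[of 1] by (simp add: pos_divide_le_eq)
      then have "?c * (N l * t powr q) \<le> \<epsilon> * (N l * t powr q)"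
        using Npos[of l] lt by (intro mult_right_mono) auto
      also have "\<dots> \<le> N (l * t)"
        using True lt by (intro ge) auto
      finally show ?thesis .
    next
      case False
      have "N l \<le> N 1"
        using lt by (intro orlicz_mono[OF N(1)]) auto
      then have "?c * (N l * t powr q) \<le> ?c * (N 1 * t powr q)"
        using e Npos[of D] Npos[of 1] D by (intro mult_left_mono mult_right_mono) auto
      also have "\<dots> = \<epsilon> * (N D * t powr q)"
        using Npos[of 1] by simp
      also have "\<dots> \<le> N (D * t)"
        using D lt by (intro ge) auto
      also have "\<dots> \<le> N (l * t)"
        using False D lt by (intro orlicz_mono[OF N(1)]) auto
      finally show ?thesis .
    qed
    moreover have "?c > 0"
      using e Npos D by simp
    ultimately have "dominates_power N q"
      unfolding dominates_power_def by blast
    with N(3) show False ..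
  qed
  then obtain l t where lt: "0 < l" "l \<le> D" "0 < t" "t \<le> 1" "N (l * t) < \<epsilon> * (N l * t powr q)"
    by blast
  define F where "F = (\<lambda>s. N s / s powr q)"
  have ltl: "0 < l * t" "l * t \<le> l"
    using lt by (auto simp: mult_le_cancel_left1)
  have "continuous_on {l * t..l} F"
    unfolding F_def using ltl
    by (intro continuous_intros orlicz_continuous_on[OF N(1)]) auto
  then obtain \<mu> where \<mu>: "\<mu> \<in> {l * t..l}" and max: "\<And>s. s \<in> {l * t..l} \<Longrightarrow> F s \<le> F \<mu>"
    using continuous_attains_sup[of "{l * t..l}" F] ltl by auto
  have \<mu>0: "0 < \<mu>"
    using \<mu> ltl by auto
  have "N (\<mu> * \<tau>) \<le> N \<mu> * (\<tau> powr q + \<epsilon> * \<tau>)" if \<tau>: "0 \<le> \<tau>" "\<tau> \<le> 1" for \<tau>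
  proof (cases "\<tau> = 0")
    case True
    then show ?thesis by (simp add: orlicz_zero[OF N(1)])
  next
    case False
    with \<tau> have \<tau>0: "0 < \<tau>" by simp
    show ?thesis
    proof (cases "l * t \<le> \<mu> * \<tau>")
      case True
      have "\<mu> * \<tau> \<le> \<mu> * 1"
        using \<tau> \<mu>0 by (intro mult_left_mono) auto
      then have "F (\<mu> * \<tau>) \<le> F \<mu>"
        using True \<mu> by (intro max) auto
      then have "N (\<mu> * \<tau>) \<le> N \<mu> * \<tau> powr q"
        using \<mu>0 \<tau>0 by (simp add: F_def powr_mult field_simps)
      also have "\<dots> \<le> N \<mu> * (\<tau> powr q + \<epsilon> * \<tau>)"
        using e \<tau> Npos[OF \<mu>0] by simp
      finally show ?thesis .
    next
      case False
      \<comment> \<open>The left end of the interval in units of \<open>\<mu>\<close>. Below it,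
        convexity compares with the value at the left end, which is smaller than the power by the
        factor \<open>\<epsilon>\<close>.\<close>
      define \<sigma> where "\<sigma> = l * t / \<mu>"
      have \<sigma>: "0 < \<sigma>" "\<sigma> \<le> 1" "\<tau> \<le> \<sigma>" "l * t = \<mu> * \<sigma>"
        using False \<mu> \<mu>0 ltl by (auto simp: \<sigma>_def field_simps)
      have "N (\<mu> * \<tau>) = N ((\<tau> / \<sigma>) * (l * t))"
        using \<sigma> by (simp add: mult.commute)
      also have "\<dots> \<le> (\<tau> / \<sigma>) * N (l * t)"
        using \<tau> \<sigma> ltl by (intro orlicz_scale[OF N(1)]) auto
      also have "\<dots> \<le> (\<tau> / \<sigma>) * (\<epsilon> * (F l * (l * t) powr q))"
      proof (intro mult_left_mono)
        have "F l * (l * t) powr q = N l * t powr q"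
          using lt by (simp add: F_def powr_mult)
        then show "N (l * t) \<le> \<epsilon> * (F l * (l * t) powr q)"
          using lt by simp
      qed (use \<tau> \<sigma> in auto)
      also have "\<dots> \<le> (\<tau> / \<sigma>) * (\<epsilon> * (F \<mu> * (l * t) powr q))"
        using \<tau> \<sigma> e ltl by (intro mult_left_mono mult_right_mono max) auto
      also have "\<dots> = (\<tau> / \<sigma>) * (\<epsilon> * (N \<mu> * \<sigma> powr q))"
        using \<mu>0 \<sigma> by (simp add: F_def powr_mult)
      also have "\<dots> = N \<mu> * (\<epsilon> * \<tau>) * \<sigma> powr (q - 1)"
        using \<sigma> by (simp add: powr_diff)
      also have "\<dots> \<le> N \<mu> * (\<epsilon> * \<tau>) * 1"
      proof (intro mult_left_mono)
        show "\<sigma> powr (q - 1) \<le> 1"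
          using \<sigma> q by (intro powr_le1) auto
      qed (use Npos[OF \<mu>0] e \<tau> in auto)
      also have "\<dots> \<le> N \<mu> * (\<tau> powr q + \<epsilon> * \<tau>)"
        using Npos[OF \<mu>0] by simp
      finally show ?thesis .
    qed
  qed
  moreover have "\<mu> \<le> \<delta>" "\<mu> \<le> 1"
    using \<mu> lt D by auto
  ultimately show thesis
    using that \<mu>0 by blast
qed


subsection \<open>Modulars as gauges\<close>

text \<open>In each direction one half comes from convexity and the other from doubling: rescaling
  the argument changes the modular by a controlled factor. The common bound B on the coordinates
  makes the doubling constant uniform over P.\<close>

lemma modular_controls_norm:
  fixes z :: "'p \<Rightarrow> 'i::countable \<Rightarrow> real"
  assumes N: "orlicz_function N" "nondegenerate N" "dominates_power N q"
    and B: "0 < B" "\<And>p i. p \<in> P \<Longrightarrow> \<bar>z p i\<bar> \<le> B"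
  defines "S \<equiv> \<lambda>p. \<Sum>\<^sup>+ i. ennreal (N \<bar>z p i\<bar>)"
  assumes fin: "\<And>p. p \<in> P \<Longrightarrow> S p < \<infinity>"
  shows "p \<in> P \<Longrightarrow> spread (z p) \<in> orlicz_h N"
    and "controls P S (\<lambda>p. ennreal (orlicz_norm N (spread (z p))))"
    and "controls P (\<lambda>p. ennreal (orlicz_norm N (spread (z p)))) S"
proof -
  have mod1: "S p = orlicz_modular N (spread (z p)) 1" for p
    by (simp add: S_def orlicz_modular_spread[OF N(1)])
  have small: "\<exists>K::real. 0 < K \<and> (\<forall>p\<in>P. orlicz_modular N (spread (z p)) r \<le> ennreal K * S p)"
    if r: "0 < r" "r \<le> 1" for r
  proof -
    have "1 \<le> 1 / r" using r by simp
    from dominates_power_delta2[OF N this B(1)] obtain K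
      where K: "1 \<le> K" "\<And>s. 0 \<le> s \<Longrightarrow> s \<le> B \<Longrightarrow> N (1 / r * s) \<le> K * N s" by blast
    have "orlicz_modular N (spread (z p)) r \<le> ennreal K * S p" if "p \<in> P" for p
      unfolding orlicz_modular_spread[OF N(1)] S_def nsum_cmult[symmetric]
    proof (intro nsum_mono)
      fix i
      show "ennreal (N (\<bar>z p i\<bar> / r)) \<le> ennreal K * ennreal (N \<bar>z p i\<bar>)"
        using K(1) K(2)[of "\<bar>z p i\<bar>"] B(2)[OF that] orlicz_nonneg[OF N(1)]
        by (simp add: ennreal_mult[symmetric] ennreal_leI)
    qed
    with K(1) show ?thesis
      by (intro exI[of _ K]) auto
  qed
  show inh: "spread (z p) \<in> orlicz_h N" if p: "p \<in> P" for p
    unfolding orlicz_h_iff[OF N(1)]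
  proof (intro allI impI)
    fix r :: real assume r: "r > 0"
    define s where "s = min r 1"
    have s: "0 < s" "s \<le> 1" "s \<le> r" using r by (auto simp: s_def)
    have "orlicz_modular N (spread (z p)) r \<le> orlicz_modular N (spread (z p)) s"
      by (rule orlicz_modular_antimono[OF N(1) s(1,3)])
    also obtain K where "0 < K" "orlicz_modular N (spread (z p)) s \<le> ennreal K * S p"
      using small[OF s(1,2)] p by blast
    note this(2)
    also have "ennreal K * S p < \<infinity>"
      using fin[OF p] by (simp add: ennreal_mult_less_top)
    finally show "orlicz_modular N (spread (z p)) r < \<infinity>" .
  qed
  have normle: "ennreal (orlicz_norm N (spread (z p))) \<le> ennreal r"
    if "p \<in> P" "0 < r" "orlicz_modular N (spread (z p)) r \<le> 1" for p r
    using orlicz_norm_le[OF N(1) that(2,3)] by (rule ennreal_leI)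
  show "controls P S (\<lambda>p. ennreal (orlicz_norm N (spread (z p))))"
    unfolding controls_def
  proof (intro conjI allI impI)
    fix R :: real assume R: "R > 0"
    define C where "C = max R 1"
    have C: "1 \<le> C" "R \<le> C" by (auto simp: C_def)
    have "ennreal (orlicz_norm N (spread (z p))) \<le> ennreal C" if p: "p \<in> P" "S p \<le> ennreal R" for p
    proof (rule normle[OF p(1)])
      have "orlicz_modular N (spread (z p)) C \<le> ennreal (1 / C) * S p"
        unfolding orlicz_modular_spread[OF N(1)] S_def nsum_cmult[symmetric]
      proof (intro nsum_mono)
        fix i
        show "ennreal (N (\<bar>z p i\<bar> / C)) \<le> ennreal (1 / C) * ennreal (N \<bar>z p i\<bar>)"
          using C orlicz_scale[OF N(1), of "\<bar>z p i\<bar>" "1 / C"] orlicz_nonneg[OF N(1)]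
          by (simp add: ennreal_mult[symmetric] ennreal_leI)
      qed
      also have "\<dots> \<le> ennreal (1 / C) * ennreal C"
        using p(2) C by (intro mult_left_mono) (auto intro: order.trans ennreal_leI)
      also have "\<dots> = 1"
        using C by (simp add: ennreal_mult[symmetric])
      finally show "orlicz_modular N (spread (z p)) C \<le> 1" .
    qed (use C in auto)
    then show "\<exists>C>0. \<forall>p\<in>P. S p \<le> ennreal R \<longrightarrow> ennreal (orlicz_norm N (spread (z p))) \<le> ennreal C"
      using C by (intro exI[of _ C]) auto
  next
    fix \<epsilon> :: real assume e: "\<epsilon> > 0"
    define r where "r = min \<epsilon> 1"
    have r: "0 < r" "r \<le> 1" "r \<le> \<epsilon>" using e by (auto simp: r_def)
    obtain K where K: "0 < K" "\<And>p. p \<in> P \<Longrightarrow> orlicz_modular N (spread (z p)) r \<le> ennreal K * S p"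
      using small[OF r(1,2)] by blast
    have "ennreal (orlicz_norm N (spread (z p))) \<le> ennreal \<epsilon>" if p: "p \<in> P" "S p \<le> ennreal (1 / K)" for p
    proof -
      have "orlicz_modular N (spread (z p)) r \<le> ennreal K * ennreal (1 / K)"
        using K(2)[OF p(1)] p(2) by (meson mult_left_mono order.trans zero_le)
      also have "\<dots> = 1"
        using K(1) by (simp add: ennreal_mult[symmetric])
      finally have "ennreal (orlicz_norm N (spread (z p))) \<le> ennreal r"
        by (rule normle[OF p(1) r(1)])
      also have "\<dots> \<le> ennreal \<epsilon>"
        using r by (intro ennreal_leI)
      finally show ?thesis .
    qed
    then show "\<exists>\<delta>>0. \<forall>p\<in>P. S p \<le> ennreal \<delta> \<longrightarrow> ennreal (orlicz_norm N (spread (z p))) \<le> ennreal \<epsilon>"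
      using K(1) by (intro exI[of _ "1 / K"]) auto
  qed
  \<comment> \<open>The factor 2 supplies the strict inequality that
    \<open>orlicz_modular_le_1\<close> asks for.\<close>
  have modle: "orlicz_modular N (spread (z p)) (2 * R) \<le> 1"
    if "p \<in> P" "0 < R" "ennreal (orlicz_norm N (spread (z p))) \<le> ennreal R" for p R
    using that by (intro orlicz_modular_le_1[OF N(1) inh]) (auto simp: ennreal_le_iff)
  show "controls P (\<lambda>p. ennreal (orlicz_norm N (spread (z p)))) S"
    unfolding controls_def
  proof (intro conjI allI impI)
    fix R :: real assume R: "R > 0"
    define C where "C = max (2 * R) 1"
    have C: "1 \<le> C" "2 * R \<le> C" by (auto simp: C_def)
    from dominates_power_delta2[OF N C(1) B(1)] obtain K
      where K: "1 \<le> K" "\<And>s. 0 \<le> s \<Longrightarrow> s \<le> B \<Longrightarrow> N (C * s) \<le> K * N s" by blast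
    have "S p \<le> ennreal K" if p: "p \<in> P" "ennreal (orlicz_norm N (spread (z p))) \<le> ennreal R" for p
    proof -
      have "S p \<le> ennreal K * orlicz_modular N (spread (z p)) C"
        unfolding orlicz_modular_spread[OF N(1)] S_def nsum_cmult[symmetric]
      proof (intro nsum_mono)
        fix i
        have "\<bar>z p i\<bar> / C \<le> \<bar>z p i\<bar> / 1"
          using C by (intro divide_left_mono) auto
        then show "ennreal (N \<bar>z p i\<bar>) \<le> ennreal K * ennreal (N (\<bar>z p i\<bar> / C))"
          using C K(1) K(2)[of "\<bar>z p i\<bar> / C"] B(2)[OF p(1), of i] orlicz_nonneg[OF N(1)]
          by (simp add: ennreal_mult[symmetric] ennreal_leI)
      qed
      also have "\<dots> \<le> ennreal K * 1"
        using orlicz_modular_antimono[OF N(1) _ C(2), of "spread (z p)"] modle[OF p(1) R p(2)] R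
        by (intro mult_left_mono) auto
      finally show ?thesis by simp
    qed
    then show "\<exists>C>0. \<forall>p\<in>P. ennreal (orlicz_norm N (spread (z p))) \<le> ennreal R \<longrightarrow> S p \<le> ennreal C"
      using K(1) by (intro exI[of _ K]) auto
  next
    fix \<epsilon> :: real assume e: "\<epsilon> > 0"
    define r where "r = min \<epsilon> 1"
    have r: "0 < r" "r \<le> 1" "r \<le> \<epsilon>" using e by (auto simp: r_def)
    have "S p \<le> ennreal \<epsilon>" if p: "p \<in> P" "ennreal (orlicz_norm N (spread (z p))) \<le> ennreal (r / 2)" for p
    proof -
      have "S p \<le> ennreal r * orlicz_modular N (spread (z p)) r"
        unfolding orlicz_modular_spread[OF N(1)] S_def nsum_cmult[symmetric]
      proof (intro nsum_mono)
        fix i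
        show "ennreal (N \<bar>z p i\<bar>) \<le> ennreal r * ennreal (N (\<bar>z p i\<bar> / r))"
          using r orlicz_scale[OF N(1), of "\<bar>z p i\<bar> / r" r] orlicz_nonneg[OF N(1)]
          by (simp add: ennreal_mult[symmetric] ennreal_leI)
      qed
      also have "\<dots> \<le> ennreal r * 1"
        using modle[OF p(1) _ p(2)] r by (intro mult_left_mono) auto
      also have "\<dots> \<le> ennreal \<epsilon>"
        using r by (simp add: ennreal_leI)
      finally show ?thesis .
    qed
    then show "\<exists>\<delta>>0. \<forall>p\<in>P. ennreal (orlicz_norm N (spread (z p))) \<le> ennreal \<delta> \<longrightarrow> S p \<le> ennreal \<epsilon>"
      using r by (intro exI[of _ "r / 2"]) auto
  qed
qed

text \<open>The base point turns F x itself into a difference, so that its membership in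
  \<open>orlicz_h N\<close> follows from the bound on modulars of differences.\<close>

lemma strongly_uniformly_embeds_orlicz_hI:
  fixes F :: "'a \<Rightarrow> 'i::countable \<Rightarrow> real" and X :: "'a metric"
  assumes N: "orlicz_function N" "nondegenerate N" "dominates_power N q"
    and B: "0 < B" "\<And>x y i. x \<in> mspace X \<Longrightarrow> y \<in> mspace X \<Longrightarrow> \<bar>F x i - F y i\<bar> \<le> B"
    and base: "x0 \<in> mspace X" "\<And>i. F x0 i = 0"
  defines "P \<equiv> mspace X \<times> mspace X"
    and "S \<equiv> \<lambda>(x, y). \<Sum>\<^sup>+ i. ennreal (N \<bar>F x i - F y i\<bar>)"
  assumes c1: "controls P (\<lambda>(x, y). ennreal (mdist X x y)) S"
    and c2: "controls P S (\<lambda>(x, y). ennreal (mdist X x y))"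
  shows "strongly_uniformly_embeds X (orlicz_h_metric N)"
proof -
  define z where "z = (\<lambda>p i. F (fst p) i - F (snd p) i)"
  have S: "S = (\<lambda>p. \<Sum>\<^sup>+ i. ennreal (N \<bar>z p i\<bar>))"
    by (auto simp: S_def z_def)
  have fin: "(\<Sum>\<^sup>+ i. ennreal (N \<bar>z p i\<bar>)) < \<infinity>" if pP: "p \<in> P" for p
  proof -
    obtain x y where p: "p = (x, y)" "x \<in> mspace X" "y \<in> mspace X"
      using pP by (auto simp: P_def)
    have "mdist X x y + 1 > 0"
      by (intro add_nonneg_pos mdist_nonneg) simp
    then obtain C where "\<forall>p\<in>P. (\<lambda>(x, y). ennreal (mdist X x y)) p \<le> ennreal (mdist X x y + 1) \<longrightarrow> S p \<le> ennreal C"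
      using c1 unfolding controls_def by blast
    then have "S p \<le> ennreal C"
      using pP p(1) by (force simp: ennreal_leI)
    then show ?thesis
      unfolding S using le_less_trans ennreal_less_top by (metis infinity_ennreal_def)
  qed
  have zB: "\<bar>z p i\<bar> \<le> B" if "p \<in> P" for p i
    using that B(2) by (auto simp: z_def P_def)
  note m = modular_controls_norm[where z = z and P = P, OF N B(1) zB fin]
  have inh: "spread (F x) \<in> orlicz_h N" if "x \<in> mspace X" for x
    using m(1)[where p = "(x, x0)"] that base by (simp add: z_def P_def)
  have eq: "(\<lambda>(x, y). ennreal (mdist (orlicz_h_metric N) (spread (F x)) (spread (F y)))) p
      = ennreal (orlicz_norm N (spread (z p)))" if "p \<in> P" for p
    using that inh by (auto simp: P_def mdist_orlicz_h_metric[OF N(1)] spread_diff z_def)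
  have cong: "controls P a b = controls P a' b'" if "\<And>p. p \<in> P \<Longrightarrow> a p = a' p" "\<And>p. p \<in> P \<Longrightarrow> b p = b' p"
    for a b a' b' using that by (simp add: controls_def)
  have "controls P (\<lambda>(x, y). ennreal (mdist X x y)) (\<lambda>p. ennreal (orlicz_norm N (spread (z p))))"
    using controls_trans[OF c1[unfolded S] m(2)] .
  then have 1: "controls P (\<lambda>(x, y). ennreal (mdist X x y))
      (\<lambda>(x, y). ennreal (mdist (orlicz_h_metric N) (spread (F x)) (spread (F y))))"
    by (subst cong[OF refl eq])
  have "controls P (\<lambda>p. ennreal (orlicz_norm N (spread (z p)))) (\<lambda>(x, y). ennreal (mdist X x y))"
    using controls_trans[OF m(3) c2[unfolded S]] .
  then have 2: "controls P (\<lambda>(x, y). ennreal (mdist (orlicz_h_metric N) (spread (F x)) (spread (F y))))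
      (\<lambda>(x, y). ennreal (mdist X x y))"
    by (subst cong[OF eq refl])
  show ?thesis
    using 1 2 inh unfolding P_def
    by (intro strongly_uniformly_embedsI[of "\<lambda>x. spread (F x)"]) (auto simp: mspace_orlicz_h_metric[OF N(1)])
qed


section \<open>Dyadic scales and blocks of repeated coordinates\<close>

lemma dyadic_bracket:
  fixes d :: real
  assumes "0 < d"
  obtains j :: int where "2 powr j \<le> d" "d < 2 * 2 powr j"
proof
  let ?j = "\<lfloor>log 2 d\<rfloor>"
  have "2 powr ?j \<le> 2 powr (log 2 d)"
    by (intro powr_mono) auto
  then show "2 powr ?j \<le> d"
    using assms by simp
  have "2 powr (log 2 d) < 2 powr (?j + 1)"
    by (intro powr_less_mono) auto
  then show "d < 2 * 2 powr ?j"
    using assms by (simp add: powr_add)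
qed

text \<open>Rounding down a number that is at least 1 loses at most a factor 2. Used to choose how
  often a block of modular b is repeated to reach total modular w.\<close>

lemma floor_multiple_bounds:
  fixes w b :: real
  assumes "0 < b" "b \<le> w"
  shows "real (nat \<lfloor>w / b\<rfloor>) * b \<le> w" "w / 2 \<le> real (nat \<lfloor>w / b\<rfloor>) * b"
proof -
  have 1: "1 \<le> w / b"
    using assms by simp
  then have n: "real (nat \<lfloor>w / b\<rfloor>) = real_of_int \<lfloor>w / b\<rfloor>"
    by simp
  show "real (nat \<lfloor>w / b\<rfloor>) * b \<le> w"
    unfolding n by (rule floor_divide_lower[OF assms(1)])
  have "y / 2 \<le> real_of_int \<lfloor>y\<rfloor>" if "1 \<le> y" for y :: real
  proof -
    have "1 \<le> \<lfloor>y\<rfloor>" using that by simp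
    then show ?thesis by linarith
  qed
  from this[OF 1] have "w / b / 2 \<le> real_of_int \<lfloor>w / b\<rfloor>" .
  then show "w / 2 \<le> real (nat \<lfloor>w / b\<rfloor>) * b"
    using assms unfolding n by (simp add: field_simps)
qed

text \<open>The amplitude of a block is dictated by \<open>not_dominates_power_block\<close>;
  repetition is the remaining freedom, by which the block attains a prescribed modular.\<close>

definition repeated :: "('a \<Rightarrow> nat) \<Rightarrow> ('a \<Rightarrow> real) \<Rightarrow> 'a \<times> nat \<Rightarrow> real" where
  "repeated m u = (\<lambda>(a, k). if k < m a then u a else 0)"

lemma repeated_diff: "repeated m u i - repeated m v i = repeated m (\<lambda>a. u a - v a) i"
  by (auto simp: repeated_def split: prod.splits)

lemma nsum_repeated:
  assumes "orlicz_function N"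
  shows "(\<Sum>\<^sup>+ i. ennreal (N (\<bar>repeated m u i\<bar> / r))) = (\<Sum>\<^sup>+ a. ennreal (real (m a) * N (\<bar>u a\<bar> / r)))"
proof -
  have "(\<Sum>\<^sup>+ k. ennreal (N (\<bar>repeated m u (a, k)\<bar> / r))) = ennreal (real (m a) * N (\<bar>u a\<bar> / r))" for a
  proof -
    have "(\<Sum>\<^sup>+ k. ennreal (N (\<bar>repeated m u (a, k)\<bar> / r)))
        = (\<Sum>\<^sup>+ k. if k < m a then ennreal (N (\<bar>u a\<bar> / r)) else 0)"
      by (intro arg_cong[of _ _ nsum] ext) (simp add: repeated_def orlicz_zero[OF assms])
    also have "\<dots> = ennreal (real (m a) * N (\<bar>u a\<bar> / r))"
      unfolding nsum_replicate
      by (simp add: ennreal_mult' ennreal_of_nat_eq_real_of_nat)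
    finally show ?thesis .
  qed
  then show ?thesis
    by (subst nsum_pair) simp
qed


subsection \<open>Targets of infinite index\<close>

text \<open>Aharoni's coordinate functions: for a dense sequence \<open>xs\<close> and a scale \<open>r\<close>, only those
  indices matter for \<open>x\<close> that precede the first point of the sequence at distance at most \<open>r\<close>,
  so that the values at \<open>x\<close> form a null sequence.\<close>

definition bump :: "'a metric \<Rightarrow> (nat \<Rightarrow> 'a) \<Rightarrow> real \<Rightarrow> nat \<Rightarrow> 'a \<Rightarrow> real" where
  "bump X xs r i x =
     Min (insert (max 0 (2 * r - mdist X x (xs (Suc i)))) ((\<lambda>l. max 0 (mdist X x (xs l) - r)) ` {..i}))"

context
  fixes X :: "'a metric" and xs :: "nat \<Rightarrow> 'a"
  assumes xs: "\<And>i. xs i \<in> mspace X"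
begin

lemma bump_nonneg: "0 \<le> bump X xs r i x"
  unfolding bump_def by (subst Min_ge_iff) auto

lemma bump_le: "0 \<le> r \<Longrightarrow> bump X xs r i x \<le> 2 * r"
  unfolding bump_def by (rule order.trans[OF Min_le]) auto

lemma bump_eq_0:
  assumes "l \<le> i" "mdist X x (xs l) \<le> r"
  shows "bump X xs r i x = 0"
proof -
  have "bump X xs r i x \<le> max 0 (mdist X x (xs l) - r)"
    unfolding bump_def using assms by (intro Min_le insertI2 image_eqI[of _ _ l]) auto
  with assms bump_nonneg[of r i x] show ?thesis
    by simp
qed

lemma bump_eq_0':
  assumes "2 * r \<le> mdist X x (xs (Suc i))"
  shows "bump X xs r i x = 0"
proof -
  have "bump X xs r i x \<le> max 0 (2 * r - mdist X x (xs (Suc i)))"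
    unfolding bump_def by (intro Min_le) auto
  with assms bump_nonneg[of r i x] show ?thesis
    by simp
qed

text \<open>A bump is a minimum of functions that are 1-Lipschitz in the point; the one attaining
  the minimum at y bounds the minimum at x.\<close>

lemma bump_le_plus:
  assumes "x \<in> mspace X" "y \<in> mspace X"
  shows "bump X xs r i x \<le> bump X xs r i y + mdist X x y"
proof -
  have tri: "mdist X x (xs l) \<le> mdist X x y + mdist X y (xs l)"
    "mdist X y (xs l) \<le> mdist X x y + mdist X x (xs l)" for l
    using assms xs mdist_triangle[of x X y "xs l"] mdist_triangle[of y X x "xs l"]
    by (simp_all add: mdist_commute[of X y x])
  have "bump X xs r i y \<in> insert (max 0 (2 * r - mdist X y (xs (Suc i)))) ((\<lambda>l. max 0 (mdist X y (xs l) - r)) ` {..i})"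
    unfolding bump_def by (intro Min_in) auto
  then consider "bump X xs r i y = max 0 (2 * r - mdist X y (xs (Suc i)))"
    | l where "l \<le> i" "bump X xs r i y = max 0 (mdist X y (xs l) - r)"
    by auto
  then show ?thesis
  proof cases
    case 1
    have "bump X xs r i x \<le> max 0 (2 * r - mdist X x (xs (Suc i)))"
      unfolding bump_def by (intro Min_le) auto
    then show ?thesis
      using 1 tri(2)[of "Suc i"] mdist_nonneg[of X x y] by linarith
  next
    case 2
    have "bump X xs r i x \<le> max 0 (mdist X x (xs l) - r)"
      unfolding bump_def using 2 by (intro Min_le insertI2 image_eqI[of _ _ l]) auto
    then show ?thesis
      using 2 tri(1)[of l] mdist_nonneg[of X x y] by linarith
  qed
qed

lemma bump_lipschitz:
  assumes "x \<in> mspace X" "y \<in> mspace X"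
  shows "\<bar>bump X xs r i x - bump X xs r i y\<bar> \<le> mdist X x y"
  using bump_le_plus[OF assms, of r i] bump_le_plus[OF assms(2,1), of r i]
  by (simp add: mdist_commute[of X y x])

text \<open>Let l be the first index whose point is closer to x than 3/2 r. The earlier points are
  at least 3/2 r away, so the bump centred at \<open>xs l\<close> is at least r/2 at x; since y is
  at least 4 r from x, it is more than 2 r from \<open>xs l\<close>, where the bump vanishes. Bump i
  is centred at \<open>xs (Suc i)\<close>, so \<open>far\<close> is needed to exclude l = 0.\<close>

lemma bump_separates_aux:
  assumes dense: "\<And>x r. x \<in> mspace X \<Longrightarrow> 0 < r \<Longrightarrow> \<exists>i. mdist X x (xs i) < r"
    and xy: "x \<in> mspace X" "y \<in> mspace X" and r: "0 < r" "4 * r \<le> mdist X x y"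
    and far: "2 * r \<le> mdist X x (xs 0)"
  shows "\<exists>i. r / 2 \<le> bump X xs r i x \<and> bump X xs r i y = 0"
proof -
  define l where "l = (LEAST l. mdist X x (xs l) < 3 / 2 * r)"
  have l: "mdist X x (xs l) < 3 / 2 * r"
    unfolding l_def by (rule LeastI_ex, rule dense[OF xy(1)]) (use r in simp)
  have less: "3 / 2 * r \<le> mdist X x (xs k)" if "k < l" for k
    using not_less_Least[of k "\<lambda>l. mdist X x (xs l) < 3 / 2 * r"] that unfolding l_def by auto
  have "l \<noteq> 0"
  proof
    assume "l = 0"
    with l far r show False by simp
  qed
  then obtain i where i: "l = Suc i"
    by (cases l) auto
  have "r / 2 \<le> bump X xs r i x"
    unfolding bump_def
  proof (subst Min_ge_iff, simp, simp, rule ballI)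
    fix a assume "a \<in> insert (max 0 (2 * r - mdist X x (xs (Suc i)))) ((\<lambda>l. max 0 (mdist X x (xs l) - r)) ` {..i})"
    then consider "a = max 0 (2 * r - mdist X x (xs (Suc i)))" | k where "k \<le> i" "a = max 0 (mdist X x (xs k) - r)"
      by auto
    then show "r / 2 \<le> a"
    proof cases
      case 1
      then show ?thesis
        using l[unfolded i] by linarith
    next
      case 2
      then have "3 / 2 * r \<le> mdist X x (xs k)"
        using i by (intro less) auto
      with 2 show ?thesis
        by linarith
    qed
  qed
  moreover have "bump X xs r i y = 0"
  proof (rule bump_eq_0')
    have "mdist X x y \<le> mdist X x (xs l) + mdist X y (xs l)"
      using mdist_triangle[of x X "xs l" y] xy xs by (simp add: mdist_commute[of X "xs l" y])
    then show "2 * r \<le> mdist X y (xs (Suc i))"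
      using l i r by simp
  qed
  ultimately show ?thesis by blast
qed

text \<open>No bump is centred at \<open>xs 0\<close>, but two points at distance at least 4 r
  cannot both be closer than 2 r to it, so the one that is not takes the role of x in the previous
  lemma.\<close>

lemma bump_separates:
  assumes dense: "\<And>x r. x \<in> mspace X \<Longrightarrow> 0 < r \<Longrightarrow> \<exists>i. mdist X x (xs i) < r"
    and xy: "x \<in> mspace X" "y \<in> mspace X" and r: "0 < r" "4 * r \<le> mdist X x y"
  shows "\<exists>i. r / 2 \<le> \<bar>bump X xs r i x - bump X xs r i y\<bar>"
proof -
  have "mdist X x y \<le> mdist X x (xs 0) + mdist X y (xs 0)"
    using mdist_triangle[of x X "xs 0" y] xy xs by (simp add: mdist_commute[of X "xs 0" y])
  then consider "2 * r \<le> mdist X x (xs 0)" | "2 * r \<le> mdist X y (xs 0)"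
    using r by linarith
  then show ?thesis
  proof cases
    case 1
    from bump_separates_aux[OF dense xy r this] obtain i
      where "r / 2 \<le> bump X xs r i x" "bump X xs r i y = 0" by blast
    then have "r / 2 \<le> \<bar>bump X xs r i x - bump X xs r i y\<bar>"
      by linarith
    then show ?thesis ..
  next
    case 2
    have "4 * r \<le> mdist X y x"
      using r(2) by (simp add: mdist_commute)
    from bump_separates_aux[OF dense xy(2,1) r(1) this 2] obtain i
      where "r / 2 \<le> bump X xs r i y" "bump X xs r i x = 0" by blast
    then have "r / 2 \<le> \<bar>bump X xs r i x - bump X xs r i y\<bar>"
      by linarith
    then show ?thesis ..
  qed
qed

end

text \<open>The block norm is equivalent to the supremum norm: coordinates of size at most 1/2 have
  total modular at most 1, whereas one coordinate of size 4 already has modular at least 2. Bumps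
  are 1-Lipschitz and separate points, so the map is bi-Lipschitz.\<close>

lemma separable_embeds_of_infinite_index:
  fixes X :: "'a metric" and xs :: "nat \<Rightarrow> 'a"
  assumes N: "orlicz_function N" "nondegenerate N" "\<And>q. \<not> dominates_power N q"
    and xs: "\<And>i. xs i \<in> mspace X"
    and dense: "\<And>x r. x \<in> mspace X \<Longrightarrow> 0 < r \<Longrightarrow> \<exists>i. mdist X x (xs i) < r"
  shows "strongly_uniformly_embeds X (orlicz_h_metric N)"
proof -
  \<comment> \<open>The exponent of the block is also to_nat a + 2, so for arguments up to 1/2 the
    power term and the linear error are both at most e a, and twice e a sums to at most 1.\<close>
  define e where "e = (\<lambda>a::int \<times> nat. (1/2::real) ^ (to_nat a + 2))"
  have N1: "N 1 > 0"
    using N(2) by (simp add: nondegenerate_def)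
  have "\<exists>b. 0 < b \<and> b \<le> 1 / N 1 \<and> b \<le> 1 \<and>
     (\<forall>\<tau>. 0 \<le> \<tau> \<longrightarrow> \<tau> \<le> 1 \<longrightarrow> N (b * \<tau>) \<le> N b * (\<tau> powr real (to_nat a + 2) + e a * \<tau>))" for a
    using not_dominates_power_block[OF N, of "real (to_nat a + 2)" "e a" "1 / N 1"] N1
    by (simp add: e_def) metis
  then obtain b where b: "\<And>a. 0 < b a" "\<And>a. b a \<le> 1 / N 1" "\<And>a. b a \<le> 1"
    "\<And>a \<tau>. 0 \<le> \<tau> \<Longrightarrow> \<tau> \<le> 1 \<Longrightarrow> N (b a * \<tau>) \<le> N (b a) * (\<tau> powr real (to_nat a + 2) + e a * \<tau>)"
    by metis
  have Nb: "0 < N (b a)" "N (b a) \<le> 1" for a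
  proof -
    show "0 < N (b a)"
      using N(2) b(1) by (simp add: nondegenerate_def)
    have "N (b a * 1) \<le> b a * N 1"
      using b(1)[of a] b(3)[of a] by (intro orlicz_scale[OF N(1)]) auto
    also have "\<dots> \<le> 1"
      using b(2)[of a] N1 by (simp add: field_simps)
    finally show "N (b a) \<le> 1" by simp
  qed
  define m where "m = (\<lambda>a. nat \<lfloor>1 / N (b a)\<rfloor>)"
  have m: "real (m a) * N (b a) \<le> 1" "1 / 2 \<le> real (m a) * N (b a)" for a
    using floor_multiple_bounds[of "N (b a)" 1] Nb[of a] by (auto simp: m_def)
  have term_le: "real (m a) * N (b a * \<tau>) \<le> (1/2) ^ Suc (to_nat a)" if \<tau>: "0 \<le> \<tau>" "\<tau> \<le> 1/2" for a \<tau>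
  proof -
    have "\<tau> powr real (to_nat a + 2) \<le> (1/2) powr real (to_nat a + 2)"
      using \<tau> by (intro powr_mono2) auto
    also have "\<dots> = e a"
      unfolding e_def by (rule powr_realpow) simp
    finally have 1: "\<tau> powr real (to_nat a + 2) \<le> e a" .
    have e0: "0 \<le> e a" by (simp add: e_def)
    have 2: "e a * \<tau> \<le> e a * 1"
      using \<tau> e0 by (intro mult_left_mono) auto
    have "N (b a * \<tau>) \<le> N (b a) * (\<tau> powr real (to_nat a + 2) + e a * \<tau>)"
      using \<tau> by (intro b(4)) auto
    also have "\<dots> \<le> N (b a) * (2 * e a)"
      using 1 2 Nb(1)[of a] by (intro mult_left_mono) auto
    finally have "real (m a) * N (b a * \<tau>) \<le> (real (m a) * N (b a)) * (2 * e a)"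
      by (simp add: mult.assoc mult_left_mono)
    also have "\<dots> \<le> 1 * (2 * e a)"
      using m(1)[of a] e0 by (intro mult_right_mono) auto
    also have "\<dots> = (1/2) ^ Suc (to_nat a)"
      by (simp add: e_def)
    finally show ?thesis .
  qed
  have sum_le_1: "(\<Sum>\<^sup>+ a::int \<times> nat. ennreal ((1/2) ^ Suc (to_nat a))) \<le> 1"
  proof -
    have "(\<Sum>\<^sup>+ a::int \<times> nat. ennreal ((1/2) ^ Suc (to_nat a))) \<le> (\<Sum>\<^sup>+ n. ennreal ((1/2) ^ Suc n))"
      by (rule nsum_reindex_le[of to_nat "\<lambda>n. ennreal ((1/2) ^ Suc n)"]) simp
    also have "\<dots> = 1"
      using nsum_geometric[of "1/2" "1/2"] by simp
    finally show ?thesis .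
  qed
  define g where "g = (\<lambda>a::int \<times> nat. bump X xs (2 powr fst a) (snd a))"
  define F where "F = (\<lambda>x. repeated m (\<lambda>a. b a * g a x))"
  define z where "z = (\<lambda>x y. spread (\<lambda>i. F x i - F y i))"
  have Fx: "spread (F x) \<in> orlicz_h N" if x: "x \<in> mspace X" for x
    unfolding orlicz_h_iff[OF N(1)]
  proof (intro allI impI)
    fix r :: real assume r: "r > 0"
    define A where "A = {a. r / 2 < g a x}"
    have "\<exists>l. mdist X x (xs l) < 2 powr real_of_int j" for j
      using dense[OF x] by simp
    then obtain L where L: "\<And>j. mdist X x (xs (L j)) < 2 powr real_of_int j"
      by metis
    define D where "D = mdist X x (xs 0) + 1"
    have "mdist X x (xs 0) \<ge> 0"
      by (rule mdist_nonneg)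
    then have D: "D > 0" unfolding D_def by linarith
    \<comment> \<open>Three bounds: a bump of scale 2^j is at most 2 * 2^j, which excludes small j;
      it vanishes once x is within 2^j of \<open>xs 0\<close>, which excludes large j; and for each
      j it vanishes from index L j on. Hence the coordinates of x form a null family.\<close>
    have "A \<subseteq> Sigma {\<lfloor>log 2 (r / 4)\<rfloor>..\<lceil>log 2 D\<rceil>} (\<lambda>j. {..<L j})"
    proof
      fix a assume "a \<in> A"
      then obtain j i where a: "a = (j, i)" "r / 2 < bump X xs (2 powr j) i x"
        by (cases a) (auto simp: A_def g_def)
      have "r / 2 < 2 * 2 powr j"
        using a(2) bump_le[of xs X "2 powr j" i x] xs by fastforce
      then have "log 2 (r / 4) < j"
        using r by (subst log_less_iff) auto
      moreover have "2 powr j < D"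
        using bump_eq_0[of xs X 0 i x "2 powr j"] xs a(2) r by (force simp: D_def)
      then have "j < log 2 D"
        using D by (subst less_log_iff) auto
      moreover have "i < L j"
        using bump_eq_0[of xs X "L j" i x "2 powr j"] xs a(2) r L[of j] by force
      ultimately show "a \<in> Sigma {\<lfloor>log 2 (r / 4)\<rfloor>..\<lceil>log 2 D\<rceil>} (\<lambda>j. {..<L j})"
        using a(1) by auto linarith+
    qed
    then have finA: "finite A"
      by (rule finite_subset) auto
    let ?c = "\<lambda>a. ennreal (real (m a) * N (\<bar>b a * g a x\<bar> / r))"
    have "orlicz_modular N (spread (F x)) r = nsum ?c"
      by (simp add: F_def orlicz_modular_spread[OF N(1)] nsum_repeated[OF N(1)])
    also have "\<dots> \<le> (\<Sum>\<^sup>+ a. (if a \<in> A then ?c a else 0) + ennreal ((1/2) ^ Suc (to_nat a)))"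
    proof (intro nsum_mono)
      fix a
      show "?c a \<le> (if a \<in> A then ?c a else 0) + ennreal ((1/2) ^ Suc (to_nat a))"
      proof (cases "a \<in> A")
        case False
        then have "g a x / r \<le> 1 / 2" "0 \<le> g a x / r"
          using r bump_nonneg[of xs X] xs by (auto simp: A_def g_def field_simps)
        then have "?c a \<le> ennreal ((1/2) ^ Suc (to_nat a))"
          using term_le[of "g a x / r" a] r b(1)[of a] bump_nonneg[of xs X] xs
          by (intro ennreal_leI) (simp add: abs_mult g_def)
        then show ?thesis
          using False by simp
      qed simp
    qed
    also have "\<dots> = sum ?c A + (\<Sum>\<^sup>+ a::int \<times> nat. ennreal ((1/2) ^ Suc (to_nat a)))"
      unfolding nsum_add using finA by (subst nsum_finite_support[of A]) auto
    also have "\<dots> < \<infinity>"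
      using sum_le_1 finA by (auto simp: top.not_eq_extremum[symmetric] top_unique)
    finally show "orlicz_modular N (spread (F x)) r < \<infinity>" .
  qed
  have modular: "orlicz_modular N (z x y) r
      = (\<Sum>\<^sup>+ a. ennreal (real (m a) * N (b a * (\<bar>g a x - g a y\<bar> / r))))" for x y r
    unfolding z_def orlicz_modular_spread[OF N(1)] F_def repeated_diff nsum_repeated[OF N(1)]
    using b(1) by (simp add: right_diff_distrib[symmetric] abs_mult less_imp_le)
  have zh: "z x y \<in> orlicz_h N" if "x \<in> mspace X" "y \<in> mspace X" for x y
    using orlicz_h_diff[OF N(1) Fx[OF that(1)] Fx[OF that(2)]] by (simp add: z_def spread_diff)
  have dist: "mdist (orlicz_h_metric N) (spread (F x)) (spread (F y)) = orlicz_norm N (z x y)"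
    if "x \<in> mspace X" "y \<in> mspace X" for x y
    using mdist_orlicz_h_metric[OF N(1) Fx[OF that(1)] Fx[OF that(2)]] by (simp add: z_def spread_diff)
  have upper: "orlicz_norm N (z x y) \<le> 2 * mdist X x y" if xy: "x \<in> mspace X" "y \<in> mspace X" for x y
  proof (cases "x = y")
    case True
    have "mdist (orlicz_h_metric N) (spread (F y)) (spread (F y)) = 0"
      using Fx[OF xy(2)] by (subst mdist_zero) (auto simp: mspace_orlicz_h_metric[OF N(1)])
    then have "orlicz_norm N (z x y) = 0"
      using True dist[OF xy(2,2)] by simp
    then show ?thesis
      using mdist_nonneg[of X x y] by simp
  next
    case False
    then have d: "0 < mdist X x y"
      using xy mdist_zero[of x X y] mdist_nonneg[of X x y] by (metis less_eq_real_def)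
    have "orlicz_modular N (z x y) (2 * mdist X x y) \<le> (\<Sum>\<^sup>+ a::int \<times> nat. ennreal ((1/2) ^ Suc (to_nat a)))"
      unfolding modular
    proof (intro nsum_mono ennreal_leI term_le)
      fix a
      have "\<bar>g a x - g a y\<bar> \<le> mdist X x y"
        unfolding g_def using bump_lipschitz[of xs X x y] xs xy by blast
      then show "\<bar>g a x - g a y\<bar> / (2 * mdist X x y) \<le> 1 / 2"
        using d by (simp add: field_simps)
    qed (use d in auto)
    also note sum_le_1
    finally show ?thesis
      using d by (intro orlicz_norm_le[OF N(1)]) auto
  qed
  have lower: "mdist X x y \<le> 64 * orlicz_norm N (z x y)" if xy: "x \<in> mspace X" "y \<in> mspace X" for x y
  proof (cases "x = y")
    case True
    then have "mdist X x y = 0"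
      using xy mdist_zero by metis
    then show ?thesis
      using orlicz_norm_nonneg[OF N(1) zh[OF xy]] by simp
  next
    case False
    then have d: "0 < mdist X x y"
      using xy mdist_zero[of x X y] mdist_nonneg[of X x y] by (metis less_eq_real_def)
    have "0 < mdist X x y / 4" using d by simp
    from dyadic_bracket[OF this] obtain j :: int
      where j: "2 powr j \<le> mdist X x y / 4" "mdist X x y / 4 < 2 * 2 powr j" .
    have "\<exists>i. 2 powr j / 2 \<le> \<bar>bump X xs (2 powr j) i x - bump X xs (2 powr j) i y\<bar>"
      using j(1) by (intro bump_separates[OF xs dense xy]) auto
    then obtain i where "2 powr j / 2 \<le> \<bar>bump X xs (2 powr j) i x - bump X xs (2 powr j) i y\<bar>" ..
    then have i: "2 powr j / 2 \<le> \<bar>g (j, i) x - g (j, i) y\<bar>"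
      by (simp add: g_def)
    define a where "a = (j, i)"
    \<comment> \<open>The coordinates differ by at least 2^j / 2, hence by at least 4 r. Since the
      distance is below 8 * 2^j = 64 r, this gives the constant 64.\<close>
    define r where "r = 2 powr j / 8"
    have r: "r > 0" by (simp add: r_def)
    have "2 \<le> 4 * (real (m a) * N (b a))"
      using m(2)[of a] by linarith
    also have "\<dots> = real (m a) * (4 * N (b a))"
      by simp
    also have "\<dots> \<le> real (m a) * N (4 * b a)"
      using b(1)[of a] by (intro mult_left_mono orlicz_scale_ge[OF N(1)]) auto
    also have "\<dots> \<le> real (m a) * N (b a * (\<bar>g a x - g a y\<bar> / r))"
    proof (intro mult_left_mono orlicz_mono[OF N(1)])
      have "4 \<le> \<bar>g a x - g a y\<bar> / r"
        using i r by (simp add: a_def r_def field_simps)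
      then have "b a * 4 \<le> b a * (\<bar>g a x - g a y\<bar> / r)"
        by (rule mult_left_mono) (rule less_imp_le[OF b(1)])
      then show "4 * b a \<le> b a * (\<bar>g a x - g a y\<bar> / r)"
        by (metis mult.commute)
    qed (use b(1)[of a] in auto)
    finally have "1 < ennreal (real (m a) * N (b a * (\<bar>g a x - g a y\<bar> / r)))"
      by (subst ennreal_1[symmetric], subst ennreal_less_iff) auto
    also have "\<dots> \<le> orlicz_modular N (z x y) r"
      unfolding modular by (rule nsum_ge_point)
    finally have "r \<le> orlicz_norm N (z x y)"
      by (rule orlicz_modular_gt_1_imp_norm_ge[OF N(1) zh[OF xy]])
    then show ?thesis
      using j by (simp add: r_def)
  qed
  show ?thesis
  proof (rule strongly_uniformly_embedsI[of "\<lambda>x. spread (F x)"])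
    show "(\<lambda>x. spread (F x)) \<in> mspace X \<rightarrow> mspace (orlicz_h_metric N)"
      using Fx by (simp add: mspace_orlicz_h_metric[OF N(1)])
    show "controls (mspace X \<times> mspace X) (\<lambda>(x, y). ennreal (mdist X x y))
        (\<lambda>(x, y). ennreal (mdist (orlicz_h_metric N) (spread (F x)) (spread (F y))))"
      by (rule controlsI_linear[of 2])
         (auto simp: dist ennreal_mult'[symmetric] intro!: ennreal_leI upper simp del: ennreal_numeral)
    show "controls (mspace X \<times> mspace X)
        (\<lambda>(x, y). ennreal (mdist (orlicz_h_metric N) (spread (F x)) (spread (F y))))
        (\<lambda>(x, y). ennreal (mdist X x y))"
      by (rule controlsI_linear[of 64])
         (auto simp: dist ennreal_mult'[symmetric] intro!: ennreal_leI lower simp del: ennreal_numeral)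
  qed
qed


text \<open>Finitely supported rational sequences are dense: the modular at each fixed scale is
  finite, so its tail is small, and finitely many coordinates remain to be approximated.\<close>

lemma orlicz_h_dense_sequence:
  assumes M: "orlicz_function M"
  shows "\<exists>xs :: nat \<Rightarrow> nat \<Rightarrow> real. range xs \<subseteq> orlicz_h M \<and>
    (\<forall>x\<in>orlicz_h M. \<forall>r>0. \<exists>i. orlicz_norm M (\<lambda>n. x n - xs i n) < r)"
proof -
  define emb where "emb = (\<lambda>l::rat list. \<lambda>n. if n < length l then real_of_rat (l ! n) else 0)"
  have emb: "emb l \<in> orlicz_h M" for l
    unfolding orlicz_h_iff[OF M]
  proof (intro allI impI)
    fix r :: real assume "r > 0"
    have "orlicz_modular M (emb l) r = (\<Sum>n<length l. ennreal (M (\<bar>emb l n\<bar> / r)))"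
      unfolding orlicz_modular_nsum
      by (rule nsum_finite_support) (auto simp: emb_def orlicz_zero[OF M])
    also have "\<dots> < \<infinity>"
      by simp
    finally show "orlicz_modular M (emb l) r < \<infinity>" .
  qed
  have "\<exists>l. orlicz_norm M (\<lambda>n. x n - emb l n) < r" if x: "x \<in> orlicz_h M" and r: "0 < r" for x r
  proof -
    define s where "s = r / 2"
    have s: "0 < s" using r by (simp add: s_def)
    define f where "f = (\<lambda>n. M (\<bar>x n\<bar> / s))"
    have f0: "0 \<le> f n" for n
      using s by (simp add: f_def orlicz_nonneg[OF M])
    have "(\<Sum>n. ennreal (f n)) < \<infinity>"
      using x s unfolding orlicz_h_iff[OF M] orlicz_modular_def f_def by blast
    then have "summable f"
      using f0 by (intro summable_suminf_not_top) auto
    then obtain k where k: "norm (\<Sum>n. f (n + k)) < 1 / 2"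
      using suminf_exist_split[of "1/2" f] by auto
    have tail: "(\<Sum>\<^sup>+ n. if k \<le> n then ennreal (f n) else 0) \<le> ennreal (1 / 2)"
    proof -
      have "n \<in> range (\<lambda>n. n + k)" if "k \<le> n" for n
        using that by (intro image_eqI[of _ _ "n - k"]) auto
      then have "(\<Sum>\<^sup>+ n. if k \<le> n then ennreal (f n) else 0) = (\<Sum>n. ennreal (f (n + k)))"
        by (subst nsum_reindex[of "\<lambda>n. n + k"]) (auto simp: nsum_nat)
      also have "\<dots> = ennreal (\<Sum>n. f (n + k))"
        using \<open>summable f\<close> f0 by (intro suminf_ennreal2 summable_ignore_initial_segment) auto
      also have "\<dots> \<le> ennreal (1 / 2)"
        using k by (intro ennreal_leI) auto
      finally show ?thesis .
    qed
    have "\<exists>q. M (\<bar>x n - real_of_rat q\<bar> / s) \<le> 1/4 * (1/2) ^ n" for n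
    proof -
      define e where "e = (1/4 * (1/2) ^ n :: real)"
      define d where "d = min 1 (e / (M 1 + 1))"
      have M1: "0 \<le> M 1" by (simp add: orlicz_nonneg[OF M])
      have e: "0 < e" by (simp add: e_def)
      have d: "0 < d" "d \<le> 1" using e M1 by (auto simp: d_def)
      obtain q where q: "x n < real_of_rat q" "real_of_rat q < x n + s * d"
        using of_rat_dense[of "x n" "x n + s * d"] s d by auto
      have "M (\<bar>x n - real_of_rat q\<bar> / s) \<le> M (d * 1)"
        using q s by (intro orlicz_mono[OF M]) (auto simp: field_simps)
      also have "\<dots> \<le> d * M 1"
        using d by (intro orlicz_scale[OF M]) auto
      also have "\<dots> \<le> e / (M 1 + 1) * M 1"
        using M1 by (intro mult_right_mono) (auto simp: d_def)
      also have "\<dots> \<le> e"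
        using M1 e by (simp add: field_simps)
      finally show ?thesis by (auto simp: e_def)
    qed
    then obtain q where q: "\<And>n. M (\<bar>x n - real_of_rat (q n)\<bar> / s) \<le> 1/4 * (1/2) ^ n"
      by metis
    define l where "l = map q [0..<k]"
    \<comment> \<open>The modular budget of 1 is split evenly: the errors 2^-n / 4 of the rational
      approximations sum to 1/2, and the tail takes the other half.\<close>
    have "orlicz_modular M (\<lambda>n. x n - emb l n) s
        \<le> (\<Sum>\<^sup>+ n. ennreal (1/4 * (1/2) ^ n) + (if k \<le> n then ennreal (f n) else 0))"
      unfolding orlicz_modular_nsum
    proof (intro nsum_mono)
      fix n
      show "ennreal (M (\<bar>x n - emb l n\<bar> / s)) \<le> ennreal (1/4 * (1/2) ^ n) + (if k \<le> n then ennreal (f n) else 0)"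
        using q[of n] by (auto simp: emb_def l_def f_def intro: ennreal_leI)
    qed
    also have "\<dots> \<le> ennreal (1 / 2) + ennreal (1 / 2)"
      using nsum_geometric[of "1/2" "1/4"] tail unfolding nsum_add by (intro add_mono) auto
    also have "\<dots> = 1"
      by (subst ennreal_plus[symmetric]) auto
    finally have "orlicz_norm M (\<lambda>n. x n - emb l n) \<le> s"
      using s by (intro orlicz_norm_le[OF M]) auto
    then show ?thesis
      using r by (intro exI[of _ l]) (simp add: s_def)
  qed
  then have "\<exists>i. orlicz_norm M (\<lambda>n. x n - emb (from_nat i) n) < r" if "x \<in> orlicz_h M" "0 < r" for x r
    using that by (metis from_nat_to_nat)
  then show ?thesis
    using emb by (intro exI[of _ "\<lambda>i. emb (from_nat i)"]) auto
qed

lemma embeds_of_infinite_index: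
  assumes M: "orlicz_function M" and N: "orlicz_function N" "nondegenerate N" "upper_MO_index N = \<infinity>"
  shows "strongly_uniformly_embeds (orlicz_h_metric M) (orlicz_h_metric N)"
proof -
  obtain xs :: "nat \<Rightarrow> nat \<Rightarrow> real" where xs0: "range xs \<subseteq> orlicz_h M"
    and dense: "\<forall>x\<in>orlicz_h M. \<forall>r>0. \<exists>i. orlicz_norm M (\<lambda>n. x n - xs i n) < r"
    using orlicz_h_dense_sequence[OF M] by blast
  have xs: "xs i \<in> orlicz_h M" for i
    using xs0 by auto
  have "\<not> dominates_power N q" for q
    using less_upper_MO_index[OF N(1,2)] N(3) by simp
  then show ?thesis
  proof (rule separable_embeds_of_infinite_index[OF N(1,2), of xs])
    show "xs i \<in> mspace (orlicz_h_metric M)" for i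
      using xs by (simp add: mspace_orlicz_h_metric[OF M])
    fix x and r :: real assume "x \<in> mspace (orlicz_h_metric M)" "0 < r"
    then have x: "x \<in> orlicz_h M" "0 < r"
      by (simp_all add: mspace_orlicz_h_metric[OF M])
    then obtain i where "orlicz_norm M (\<lambda>n. x n - xs i n) < r"
      using dense by blast
    then have "mdist (orlicz_h_metric M) x (xs i) < r"
      using mdist_orlicz_h_metric[OF M x(1) xs] by simp
    then show "\<exists>i. mdist (orlicz_h_metric M) x (xs i) < r" ..
  qed
qed


subsection \<open>Wave functions and dyadic sums\<close>

text \<open>Cosine and sine, normalised to be nonnegative, at most 1 and zero at 0. Nonnegativity is
  needed for the Poisson amplitudes, and vanishing at 0 makes the zero sequence a base
  point.\<close>

fun wave :: "bool option \<Rightarrow> real \<Rightarrow> real" where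
  "wave None u = (1 - cos u) / 2"
| "wave (Some True) u = max 0 (sin u)"
| "wave (Some False) u = max 0 (- sin u)"

lemma wave_0 [simp]: "wave b 0 = 0"
  by (cases "(b, 0::real)" rule: wave.cases) auto

lemma wave_bounds: "0 \<le> wave b u" "wave b u \<le> 1"
proof -
  have "- 1 \<le> cos u" "cos u \<le> 1" "- 1 \<le> sin u" "sin u \<le> 1" by auto
  then show "0 \<le> wave b u" "wave b u \<le> 1"
    by (cases "(b, u)" rule: wave.cases; simp)+
qed

lemma wave_diff_le: "\<bar>wave b u - wave b v\<bar> \<le> min 1 \<bar>u - v\<bar>"
proof -
  have half: "2 * \<bar>sin (w / 2)\<bar> \<le> \<bar>w\<bar>" for w :: real
    using abs_sin_x_le_abs_x[of "w / 2"] by simp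
  have mult_le: "\<bar>2 * (a * b)\<bar> \<le> c" if "\<bar>a\<bar> \<le> 1" "2 * \<bar>b\<bar> \<le> c" for a b c :: real
    using mult_right_mono[of "\<bar>a\<bar>" 1 "2 * \<bar>b\<bar>"] that by (simp add: abs_mult)
  have c: "\<bar>cos u - cos v\<bar> \<le> \<bar>u - v\<bar>"
    unfolding cos_diff_cos using half[of "v - u"]
    by (simp only: mult.assoc) (intro mult_le, auto)
  have "sin u - sin v = 2 * (cos ((u + v) / 2) * sin ((u - v) / 2))"
    by (simp add: sin_diff_sin)
  then have s: "\<bar>sin u - sin v\<bar> \<le> \<bar>u - v\<bar>"
    using half[of "u - v"] by (simp only:) (intro mult_le, auto)
  have "\<bar>wave b u - wave b v\<bar> \<le> \<bar>u - v\<bar>"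
  proof (cases "(b, u)" rule: wave.cases)
    case (1 w)
    have "wave None u - wave None v = - ((cos u - cos v) / 2)"
      by (simp add: field_simps)
    then have "\<bar>wave None u - wave None v\<bar> \<le> \<bar>cos u - cos v\<bar>"
      by (simp only: abs_minus_cancel) simp
    then show ?thesis
      using c 1 by simp
  qed (use s in \<open>simp; linarith\<close>)+
  moreover have "\<bar>wave b u - wave b v\<bar> \<le> 1"
    using wave_bounds[of b u] wave_bounds[of b v] by linarith
  ultimately show ?thesis by simp
qed

text \<open>Points of the circle whose angles differ by between pi/2 and pi have squared chord at
  least 2, so the cosines or the sines differ by at least 1; halving the cosine or splitting the
  sine by sign loses at most a factor 2.\<close>

lemma wave_separates:
  assumes "pi / 2 \<le> \<bar>u - v\<bar>" "\<bar>u - v\<bar> \<le> pi"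
  shows "\<exists>b. 1 / 2 \<le> \<bar>wave b u - wave b v\<bar>"
proof -
  have "cos \<bar>u - v\<bar> \<le> cos (pi / 2)"
    using assms by (intro cos_monotone_0_pi_le) auto
  then have "cos (u - v) \<le> 0"
    by simp
  moreover have "(cos u - cos v)\<^sup>2 + (sin u - sin v)\<^sup>2
      = ((cos u)\<^sup>2 + (sin u)\<^sup>2) + ((cos v)\<^sup>2 + (sin v)\<^sup>2) - 2 * cos (u - v)"
    unfolding cos_diff by (simp add: power2_eq_square algebra_simps)
  ultimately have "2 \<le> (cos u - cos v)\<^sup>2 + (sin u - sin v)\<^sup>2"
    by simp
  then consider "1 \<le> (cos u - cos v)\<^sup>2" | "1 \<le> (sin u - sin v)\<^sup>2"
    by linarith
  then show ?thesis
  proof cases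
    case 1
    then have "1 \<le> \<bar>cos u - cos v\<bar>"
      by (metis abs_1 abs_le_square_iff one_power2)
    moreover have "wave None u - wave None v = - ((cos u - cos v) / 2)"
      by (simp add: field_simps)
    ultimately have "1 / 2 \<le> \<bar>wave None u - wave None v\<bar>"
      by (simp only: abs_minus_cancel) simp
    then show ?thesis ..
  next
    case 2
    then have "1 \<le> \<bar>sin u - sin v\<bar>"
      by (metis abs_1 abs_le_square_iff one_power2)
    moreover have "\<bar>sin u - sin v\<bar> \<le>
        \<bar>wave (Some True) u - wave (Some True) v\<bar> + \<bar>wave (Some False) u - wave (Some False) v\<bar>"
      unfolding wave.simps by linarith
    ultimately have "\<not> \<bar>wave (Some True) u - wave (Some True) v\<bar> < 1 / 2 \<or>
        \<not> \<bar>wave (Some False) u - wave (Some False) v\<bar> < 1 / 2"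
      by linarith
    then show ?thesis
      using not_less by blast
  qed
qed

text \<open>Only the germ of \<open>M\<close> at \<open>0\<close> matters for the space; extending it by a power makes the
  lower power estimate global.\<close>

definition power_tail :: "(real \<Rightarrow> real) \<Rightarrow> real \<Rightarrow> real \<Rightarrow> real" where
  "power_tail M p t = (if t \<le> 1 then M t else M 1 * t powr p)"

locale power_dominating =
  fixes M :: "real \<Rightarrow> real" and p c :: real
  assumes M: "orlicz_function M" "nondegenerate M"
    and p: "1 \<le> p" and c: "0 < c"
    and dom: "\<And>l t. 0 < l \<Longrightarrow> l \<le> 1 \<Longrightarrow> 0 < t \<Longrightarrow> t \<le> 1 \<Longrightarrow> c * (M l * t powr p) \<le> M (l * t)"
begin

abbreviation "Mt \<equiv> power_tail M p"

lemma M1: "0 < M 1"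
  using M(2) by (simp add: nondegenerate_def)

lemma c_le_1: "c \<le> 1"
  using dom[of 1 1] M1 by simp

lemma Mt_0: "Mt 0 = 0"
  by (simp add: power_tail_def orlicz_zero[OF M(1)])

lemma Mt_pos: "0 < t \<Longrightarrow> 0 < Mt t"
  using M(2) M1 by (simp add: power_tail_def nondegenerate_def)

lemma Mt_nonneg: "0 \<le> t \<Longrightarrow> 0 \<le> Mt t"
  using Mt_pos[of t] Mt_0 by (cases "t = 0") auto

lemma Mt_mono:
  assumes "0 \<le> s" "s \<le> t"
  shows "Mt s \<le> Mt t"
proof -
  consider "t \<le> 1" | "s \<le> 1" "1 < t" | "1 < s" by linarith
  then show ?thesis
  proof cases
    case 1
    then show ?thesis
      using assms orlicz_mono[OF M(1), of s t] by (simp add: power_tail_def)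
  next
    case 2
    have "M s \<le> M 1 * 1"
      using 2 assms orlicz_mono[OF M(1), of s 1] by simp
    also have "\<dots> \<le> M 1 * t powr p"
      using 2 p M1 by (intro mult_left_mono ge_one_powr_ge_zero) auto
    finally show ?thesis
      using 2 by (simp add: power_tail_def)
  next
    case 3
    then show ?thesis
      using assms p M1 by (auto simp: power_tail_def intro!: mult_left_mono powr_mono2)
  qed
qed

text \<open>Gluing at 1 may destroy convexity of \<open>Mt\<close>, but this consequence of
  convexity survives because t is at most t^p beyond 1.\<close>

lemma Mt_scale:
  assumes "0 \<le> t" "0 \<le> u" "u \<le> 1"
  shows "Mt (u * t) \<le> u * Mt t"
proof (cases "u = 0")
  case True
  then show ?thesis by (simp add: Mt_0)
next
  case False
  have ut: "u * t \<le> t"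
    using assms by (simp add: mult_left_le_one_le)
  have tp: "t \<le> t powr p" if "1 \<le> t"
    using powr_mono[OF p that] that by simp
  consider "t \<le> 1" | "u * t \<le> 1" "1 < t" | "1 < u * t" "1 < t"
    using ut by linarith
  then show ?thesis
  proof cases
    case 1
    then show ?thesis
      using ut orlicz_scale[OF M(1) assms] by (simp add: power_tail_def)
  next
    case 2
    have "M ((u * t) * 1) \<le> (u * t) * M 1"
      using 2 assms by (intro orlicz_scale[OF M(1)]) auto
    also have "\<dots> = u * (M 1 * t)"
      by simp
    also have "\<dots> \<le> u * (M 1 * t powr p)"
      using 2 assms M1 tp by (intro mult_left_mono) auto
    finally show ?thesis
      using 2 by (simp add: power_tail_def)
  next
    case 3
    have "u powr p \<le> u powr 1"
      using False assms p by (intro powr_mono') auto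
    then have "M 1 * (u powr p * t powr p) \<le> M 1 * (u * t powr p)"
      using assms M1 by (intro mult_left_mono mult_right_mono) auto
    then show ?thesis
      using 3 assms by (simp add: power_tail_def powr_mult mult.left_commute)
  qed
qed

text \<open>Beyond 1 the function is an exact power, so the constant c is paid only on the part of
  the way that lies below 1.\<close>

lemma Mt_lower:
  assumes r: "0 < r" and t: "0 < t" "t \<le> 1"
  shows "c * (Mt r * t powr p) \<le> Mt (r * t)"
proof -
  have rt: "r * t \<le> r"
    using assms by simp
  consider "r \<le> 1" "r * t \<le> 1" | "r * t \<le> 1" "1 < r" | "1 < r * t" "1 < r"
    using rt by linarith
  then show ?thesis
  proof cases
    case 1
    then have "Mt r = M r" "Mt (r * t) = M (r * t)"
      by (simp_all add: power_tail_def)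
    then show ?thesis
      using 1 dom[of r t] assms by simp
  next
    case 2
    have "c * (M 1 * (r * t) powr p) \<le> M (1 * (r * t))"
      using 2 assms by (intro dom) auto
    then show ?thesis
      using 2 assms by (simp add: power_tail_def powr_mult mult.assoc)
  next
    case 3
    have "c * (M 1 * (r * t) powr p) \<le> 1 * (M 1 * (r * t) powr p)"
      using c_le_1 M1 by (intro mult_right_mono) auto
    then show ?thesis
      using 3 assms by (simp add: power_tail_def powr_mult mult.assoc)
  qed
qed

text \<open>A wave of frequency 2^j resolves differences of size about 2^-j, so it is weighted by
  the value of \<open>Mt\<close> there.\<close>

definition wgt :: "int \<Rightarrow> real" where
  "wgt j = Mt (2 powr - real_of_int j)"

lemma wgt_pos: "0 < wgt j"
  unfolding wgt_def by (intro Mt_pos) simp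

text \<open>The terms decay geometrically on both sides of the scale where 2^j d is about 1. With u
  = 2^j d, for u at most 1 the power estimate bounds wgt j * u^p by Mt d / c and leaves u^(q-p); for
  u > 1 scaling bounds wgt j by Mt d / u.\<close>

lemma wgt_dyadic_sum:
  assumes q: "p < q"
  obtains C where "0 < C"
    "\<And>d. 0 \<le> d \<Longrightarrow> (\<Sum>\<^sup>+ j. ennreal (wgt j * (min 1 (2 powr real_of_int j * d)) powr q)) \<le> ennreal (C * Mt d)"
proof -
  \<comment> \<open>One decay rate for both sides: low frequencies decay like u^(q-p), high ones
    like 1/u, which caps the rate at 1.\<close>
  define \<sigma> where "\<sigma> = min (q - p) 1"
  define b where "b = 2 powr - \<sigma>"
  have \<sigma>: "0 < \<sigma>" "\<sigma> \<le> 1" "\<sigma> \<le> q - p"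
    using q by (auto simp: \<sigma>_def)
  have b: "0 < b" "b < 1"
    using \<sigma> powr_less_mono[of "- \<sigma>" 0 "2::real"] by (auto simp: b_def)
  \<comment> \<open>The last factor bounds the two-sided geometric series. In 2/c, the 2 pays for
    replacing d by a power of 2 and 1/c comes from the power estimate.\<close>
  define C where "C = 2 / c * (2 / (1 - b))"
  have "(\<Sum>\<^sup>+ j. ennreal (wgt j * (min 1 (2 powr real_of_int j * d)) powr q)) \<le> ennreal (C * Mt d)"
    if d0: "0 \<le> d" for d
  proof (cases "d = 0")
    case True
    then show ?thesis by (simp add: nsum_def Mt_0)
  next
    case False
    with d0 have d: "0 < d" by simp
    obtain k :: int where k: "2 powr k \<le> d" "d < 2 * 2 powr k"
      using dyadic_bracket[OF d] by blast
    have term_le: "wgt j * (min 1 (2 powr real_of_int j * d)) powr q \<le> 2 / c * Mt d * b ^ nat \<bar>j + k\<bar>" for j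
    proof -
      define u where "u = 2 powr real_of_int j * d"
      have u: "0 < u" using d by (simp add: u_def)
      have r: "2 powr - real_of_int j = d / u"
        using d by (simp add: u_def powr_minus field_simps)
      have ui: "2 powr (j + k) \<le> u" "u < 2 * 2 powr (j + k)"
        using k by (auto simp: u_def powr_add)
      have bpow: "2 powr (- \<sigma> * real n) = b ^ n" for n
        by (simp only: b_def powr_powr[symmetric] powr_realpow powr_gt_zero)
      have Md: "0 < Mt d" using Mt_pos[OF d] .
      have b0: "0 \<le> b ^ nat \<bar>j + k\<bar>" using b by simp
      have c1: "1 \<le> 1 / c" using c c_le_1 by simp
      show ?thesis
      proof (cases "u \<le> 1")
        case True
        have "c * (Mt (d / u) * u powr p) \<le> Mt (d / u * u)"
          using u d True by (intro Mt_lower) auto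
        then have W: "wgt j * u powr p \<le> Mt d / c"
          using u c by (simp add: wgt_def r field_simps)
        have "2 powr (j + k) \<le> 2 powr real_of_int 0"
          using ui True by simp
        then have jk: "j + k \<le> 0"
          by (subst (asm) powr_le_cancel_iff) auto
        have "u powr (q - p) \<le> u powr \<sigma>"
          using u True \<sigma> by (intro powr_mono') auto
        also have "\<dots> \<le> (2 * 2 powr (j + k)) powr \<sigma>"
          using u ui \<sigma> by (intro powr_mono2) auto
        also have "\<dots> = 2 powr \<sigma> * 2 powr (- \<sigma> * real (nat \<bar>j + k\<bar>))"
          using jk by (simp add: powr_mult powr_powr algebra_simps)
        also have "\<dots> \<le> 2 powr 1 * b ^ nat \<bar>j + k\<bar>"
          using \<sigma> unfolding bpow by (intro mult_right_mono powr_mono b0) auto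
        finally have U: "u powr (q - p) \<le> 2 * b ^ nat \<bar>j + k\<bar>"
          by simp
        have "wgt j * u powr q = (wgt j * u powr p) * u powr (q - p)"
          by (simp add: mult.assoc powr_add[symmetric])
        also have "\<dots> \<le> (Mt d / c) * (2 * b ^ nat \<bar>j + k\<bar>)"
          using W U Md c by (intro mult_mono) auto
        finally have "wgt j * u powr q \<le> (Mt d / c) * (2 * b ^ nat \<bar>j + k\<bar>)" .
        moreover have "min 1 (2 powr real_of_int j * d) = u"
          using True by (simp add: u_def)
        ultimately show ?thesis
          by (simp only:) (simp add: mult_ac)
      next
        case False
        have "Mt (1 / u * d) \<le> 1 / u * Mt d"
          using u d False by (intro Mt_scale) auto
        then have W: "wgt j \<le> Mt d * (1 / u)"
          by (simp add: wgt_def r)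
        have "2 powr real_of_int 0 < 2 powr (j + k + 1)"
          using ui False by (simp add: powr_add)
        then have jk: "0 \<le> j + k"
          by (subst (asm) powr_less_cancel_iff) auto
        have "1 / u = u powr - 1"
          using u by (simp add: powr_minus_divide)
        also have "\<dots> \<le> u powr - \<sigma>"
          using u False \<sigma> by (intro powr_mono) auto
        also have "\<dots> \<le> (2 powr (j + k)) powr - \<sigma>"
          using u ui \<sigma> by (intro powr_mono2') auto
        also have "\<dots> = 2 powr (- \<sigma> * real (nat \<bar>j + k\<bar>))"
          using jk by (simp add: powr_powr mult.commute)
        also have "\<dots> \<le> 2 * b ^ nat \<bar>j + k\<bar>"
          unfolding bpow using b0 by simp
        finally have U: "1 / u \<le> 2 * b ^ nat \<bar>j + k\<bar>" .
        have "wgt j \<le> Mt d * (1 / u)" by (rule W)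
        also have "\<dots> \<le> (Mt d * (1 / c)) * (2 * b ^ nat \<bar>j + k\<bar>)"
        proof (intro mult_mono U)
          show "Mt d \<le> Mt d * (1 / c)"
            using mult_left_mono[OF c1, of "Mt d"] Md by simp
        qed (use Md c u in auto)
        finally have "wgt j \<le> (Mt d * (1 / c)) * (2 * b ^ nat \<bar>j + k\<bar>)" .
        moreover have "min 1 (2 powr real_of_int j * d) = 1"
          using False by (simp add: u_def)
        ultimately show ?thesis
          by (simp only:) (simp add: mult_ac)
      qed
    qed
    have "(\<Sum>\<^sup>+ j. ennreal (wgt j * (min 1 (2 powr real_of_int j * d)) powr q))
        \<le> (\<Sum>\<^sup>+ j. ennreal (2 / c * Mt d) * ennreal (b ^ nat \<bar>j + k\<bar>))"
      using term_le Mt_nonneg[OF d0] c b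
      by (intro nsum_mono) (simp add: ennreal_mult[symmetric] ennreal_leI)
    also have "\<dots> = ennreal (2 / c * Mt d) * (\<Sum>\<^sup>+ i. ennreal (b ^ nat \<bar>i\<bar>))"
      unfolding nsum_cmult
    proof (subst (2) nsum_reindex[of "\<lambda>j. j + k"])
      fix y :: int assume "y \<notin> range (\<lambda>j. j + k)"
      moreover have "y = (\<lambda>j. j + k) (y - k)" by simp
      ultimately show "ennreal (b ^ nat \<bar>y\<bar>) = 0" by blast
    qed (auto simp: inj_def)
    also have "\<dots> \<le> ennreal (2 / c * Mt d) * ennreal (2 / (1 - b))"
      by (intro mult_left_mono nsum_geometric_int b) auto
    also have "\<dots> = ennreal (C * Mt d)"
      using Mt_nonneg[OF d0] c b by (simp add: C_def ennreal_mult[symmetric] mult_ac)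
    finally show ?thesis .
  qed
  moreover have "0 < C"
    using c b by (simp add: C_def)
  ultimately show thesis
    using that by blast
qed

text \<open>Some dyadic multiple of d lands in the window where \<open>wave_separates\<close>
  applies. There 2^-j is at least d / pi, and the power estimate pays for the factor 1 / pi.\<close>

lemma wgt_dyadic_ge:
  assumes d: "0 < d"
  obtains j where "pi / 2 \<le> 2 powr real_of_int j * d" "2 powr real_of_int j * d \<le> pi"
    "c * pi powr - p * Mt d \<le> wgt j"
proof -
  have "0 < pi / d" using d by simp
  then obtain j :: int where j: "2 powr j \<le> pi / d" "pi / d < 2 * 2 powr j"
    using dyadic_bracket by blast
  have 1: "2 powr j * d \<le> pi" "pi / 2 \<le> 2 powr j * d"
    using j d by (auto simp: field_simps)
  have pi1: "1 / pi \<le> 1"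
    using pi_gt3 by simp
  have "c * (Mt d * (1 / pi) powr p) \<le> Mt (d * (1 / pi))"
    using d pi1 by (intro Mt_lower) auto
  also have "\<dots> \<le> wgt j"
    unfolding wgt_def
  proof (intro Mt_mono)
    have "d = d * 2 powr j * 2 powr - real_of_int j"
      by (simp add: powr_minus)
    also have "\<dots> \<le> pi * 2 powr - real_of_int j"
      using 1 by (intro mult_right_mono) (auto simp: mult.commute)
    finally show "d * (1 / pi) \<le> 2 powr - real_of_int j"
      by (simp add: field_simps)
  qed (use d in auto)
  finally have "c * (Mt d * (1 / pi) powr p) \<le> wgt j" .
  moreover have "(1 / pi) powr p = pi powr - p"
    by (simp add: powr_divide powr_minus_divide)
  ultimately have "c * pi powr - p * Mt d \<le> wgt j"
    by (simp add: mult_ac)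
  with 1 show thesis
    using that by blast
qed

section \<open>Comparison of the source norm with the modular gauge\<close>

lemma modular_coordinate_bound:
  obtains T where "1 \<le> T"
    "\<And>z r n. 0 < r \<Longrightarrow> orlicz_modular M z r \<le> 1 \<Longrightarrow> \<bar>z n\<bar> \<le> T * r"
proof -
  have "eventually (\<lambda>t. M t > 1) at_top"
    using M(1) by (auto simp: orlicz_function_def filterlim_at_top_dense)
  then obtain T0 where T0: "\<And>t. t \<ge> T0 \<Longrightarrow> M t > 1"
    by (auto simp: eventually_at_top_linorder)
  have "\<bar>z n\<bar> \<le> max T0 1 * r" if "0 < r" "orlicz_modular M z r \<le> 1" for z r n
  proof (rule ccontr)
    assume "\<not> ?thesis"
    then have "max T0 1 * r \<le> \<bar>z n\<bar>"
      by simp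
    then have "max T0 1 \<le> \<bar>z n\<bar> / r"
      using that by (simp only: pos_le_divide_eq)
    then have "1 < ennreal (M (\<bar>z n\<bar> / r))"
      using T0[of "\<bar>z n\<bar> / r"] by (subst ennreal_1[symmetric], subst ennreal_less_iff) auto
    also have "\<dots> \<le> orlicz_modular M z r"
      unfolding orlicz_modular_nsum by (rule nsum_ge_point)
    finally show False
      using that(2) by simp
  qed
  then show thesis
    using that[of "max T0 1"] by simp
qed

text \<open>The modular of the difference at scale 1, with \<open>Mt\<close> in place of
  \<open>M\<close> so that the power estimates hold for differences of any size.\<close>

definition gauge :: "(nat \<Rightarrow> real) \<times> (nat \<Rightarrow> real) \<Rightarrow> ennreal" where
  "gauge = (\<lambda>(x, y). \<Sum>\<^sup>+ n. ennreal (Mt \<bar>x n - y n\<bar>))"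

abbreviation "hpairs \<equiv> mspace (orlicz_h_metric M) \<times> mspace (orlicz_h_metric M)"

lemma mem_hpairsE:
  assumes "P \<in> hpairs"
  obtains x y where "P = (x, y)" "x \<in> orlicz_h M" "y \<in> orlicz_h M" "(\<lambda>n. x n - y n) \<in> orlicz_h M"
    "mdist (orlicz_h_metric M) x y = orlicz_norm M (\<lambda>n. x n - y n)"
  using assms orlicz_h_diff[OF M(1)] mdist_orlicz_h_metric[OF M(1)]
  by (auto simp: mspace_orlicz_h_metric[OF M(1)])

lemma dist_controls_gauge:
  "controls hpairs (\<lambda>(x, y). ennreal (mdist (orlicz_h_metric M) x y)) gauge"
proof -
  obtain T where T: "1 \<le> T"
    "\<And>z r n. 0 < r \<Longrightarrow> orlicz_modular M z r \<le> 1 \<Longrightarrow> \<bar>z n\<bar> \<le> T * r"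
    using modular_coordinate_bound by blast
  show ?thesis
  \<comment> \<open>With r = 2 R, the summand r serves r at most 1, by scaling, and r^p / c serves r
    > 1, by the power estimate. The factor T^p compensates for replacing \<open>M\<close> by
    \<open>Mt\<close> on [0,T], where the rescaled coordinates lie.\<close>
  proof (rule controlsI_le[of "\<lambda>R. T powr p * (2 * R + (2 * R) powr p / c)"])
    fix R :: real assume "0 < R"
    then show "0 \<le> T powr p * (2 * R + (2 * R) powr p / c)"
      using c by simp
  next
    have "((\<lambda>R. T powr p * (2 * R + (2 * R) powr p / c)) \<longlongrightarrow> T powr p * (2 * 0 + 0 / c)) (at_right 0)"
    proof (intro tendsto_intros)
      show "((\<lambda>R. (2 * R) powr p) \<longlongrightarrow> 0) (at_right 0)"
      proof (rule tendsto_zero_powrI)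
        show "((\<lambda>R. 2 * R) \<longlongrightarrow> 0) (at_right (0::real))"
          by (auto intro!: tendsto_eq_intros)
        show "eventually (\<lambda>R. 0 \<le> 2 * R) (at_right (0::real))"
          by (auto simp: eventually_at_right_field intro!: exI[of _ 1])
      qed (use p in auto)
    qed (use c in auto)
    then show "((\<lambda>R. T powr p * (2 * R + (2 * R) powr p / c)) \<longlongrightarrow> 0) (at_right 0)"
      by simp
  next
    fix P and R :: real
    assume P: "P \<in> hpairs" and R: "0 < R" "(\<lambda>(x, y). ennreal (mdist (orlicz_h_metric M) x y)) P \<le> ennreal R"
    obtain x y where xy: "P = (x, y)" "(\<lambda>n. x n - y n) \<in> orlicz_h M"
      "mdist (orlicz_h_metric M) x y = orlicz_norm M (\<lambda>n. x n - y n)"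
      using P by (rule mem_hpairsE)
    define z where "z = (\<lambda>n. x n - y n)"
    define r where "r = 2 * R"
    have r: "0 < r" using R by (simp add: r_def)
    have "orlicz_norm M z \<le> R"
      using R xy by (simp add: z_def)
    then have mod: "orlicz_modular M z r \<le> 1"
      using xy R by (intro orlicz_modular_le_1[OF M(1)]) (auto simp: z_def r_def)
    have K0: "0 \<le> T powr p * (r + r powr p / c)"
      using r c by simp
    have le: "Mt \<bar>z n\<bar> \<le> T powr p * (r + r powr p / c) * M (\<bar>z n\<bar> / r)" for n
    proof -
      define w where "w = \<bar>z n\<bar> / r"
      have w: "0 \<le> w" "w \<le> T"
        using T(2)[OF r mod, of n] r by (auto simp: w_def field_simps)
      have zw: "\<bar>z n\<bar> = r * w"
        using r by (simp add: w_def)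
      have Tp: "1 \<le> T powr p"
        using T(1) p by (intro ge_one_powr_ge_zero) auto
      have Mw: "0 \<le> M w" "0 \<le> Mt w"
        using w by (auto intro: orlicz_nonneg[OF M(1)] Mt_nonneg)
      have 1: "Mt w \<le> T powr p * M w"
      proof (cases "w \<le> 1")
        case True
        then show ?thesis
          using mult_right_mono[OF Tp Mw(1)] by (simp add: power_tail_def)
      next
        case False
        have "M 1 * w powr p \<le> M w * T powr p"
          using False w p M1 Mw(1) by (intro mult_mono orlicz_mono[OF M(1)] powr_mono2) auto
        then show ?thesis
          using False by (simp add: power_tail_def mult.commute)
      qed
      have "Mt (r * w) \<le> (r + r powr p / c) * Mt w"
      proof (cases "r \<le> 1")
        case True
        have "Mt (r * w) \<le> r * Mt w"
          using w r True by (intro Mt_scale) auto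
        also have "\<dots> \<le> (r + r powr p / c) * Mt w"
          using Mw c by (intro mult_right_mono) auto
        finally show ?thesis .
      next
        case False
        show ?thesis
        proof (cases "w = 0")
          case True
          then show ?thesis by (simp add: Mt_0)
        next
          case False
          have "c * (Mt (r * w) * (1 / r) powr p) \<le> Mt (r * w * (1 / r))"
            using w r False \<open>\<not> r \<le> 1\<close> by (intro Mt_lower) auto
          then have "Mt (r * w) \<le> (r powr p / c) * Mt w"
            using r c by (simp add: powr_divide field_simps)
          also have "\<dots> \<le> (r + r powr p / c) * Mt w"
            using Mw r by (intro mult_right_mono) auto
          finally show ?thesis .
        qed
      qed
      also have "\<dots> \<le> (r + r powr p / c) * (T powr p * M w)"
        using 1 r c by (intro mult_left_mono) auto
      finally show ?thesis
        unfolding zw using r by (simp add: mult_ac w_def)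
    qed
    have "gauge P = (\<Sum>\<^sup>+ n. ennreal (Mt \<bar>z n\<bar>))"
      by (simp add: gauge_def xy z_def)
    also have "\<dots> \<le> ennreal (T powr p * (r + r powr p / c)) * orlicz_modular M z r"
      unfolding orlicz_modular_nsum nsum_cmult[symmetric]
      using le K0 r by (intro nsum_mono) (auto simp: ennreal_mult'[symmetric] intro!: ennreal_leI)
    also have "\<dots> \<le> ennreal (T powr p * (r + r powr p / c)) * 1"
      by (intro mult_left_mono mod) auto
    finally show "gauge P \<le> ennreal (T powr p * (2 * R + (2 * R) powr p / c))"
      by (simp add: r_def)
  qed
qed

lemma gauge_controls_dist:
  "controls hpairs gauge (\<lambda>(x, y). ennreal (mdist (orlicz_h_metric M) x y))"
proof -
  \<comment> \<open>A bound on the gauge bounds every coordinate of the difference by r, and after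
    division by r the functions \<open>Mt\<close> and \<open>M\<close> agree; K R at most 1 then
    makes the modular at most 1.\<close>
  have main: "(\<lambda>(x, y). ennreal (mdist (orlicz_h_metric M) x y)) P \<le> ennreal r"
    if P: "P \<in> hpairs" "gauge P \<le> ennreal R" and r: "0 < r" "0 < K" "K * R \<le> 1" "0 < R"
      and K: "\<And>t. 0 \<le> t \<Longrightarrow> Mt t \<le> R \<Longrightarrow> t \<le> r \<and> Mt (t / r) \<le> K * Mt t" for P r K R
  proof -
    obtain x y where xy: "P = (x, y)" "mdist (orlicz_h_metric M) x y = orlicz_norm M (\<lambda>n. x n - y n)"
      using P(1) by (rule mem_hpairsE)
    define z where "z = (\<lambda>n. x n - y n)"
    have g: "gauge P = (\<Sum>\<^sup>+ n. ennreal (Mt \<bar>z n\<bar>))"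
      by (simp add: gauge_def xy z_def)
    have le: "M (\<bar>z n\<bar> / r) \<le> K * Mt \<bar>z n\<bar>" for n
    proof -
      have "ennreal (Mt \<bar>z n\<bar>) \<le> ennreal R"
        using P(2) nsum_ge_point[of "\<lambda>n. ennreal (Mt \<bar>z n\<bar>)" n] unfolding g by (rule order.trans[rotated])
      then have "Mt \<bar>z n\<bar> \<le> R"
        using r(4) by simp
      then have "\<bar>z n\<bar> \<le> r" "Mt (\<bar>z n\<bar> / r) \<le> K * Mt \<bar>z n\<bar>"
        using K[of "\<bar>z n\<bar>"] by auto
      then show ?thesis
        using r(1) by (simp add: power_tail_def)
    qed
    have "orlicz_modular M z r \<le> ennreal K * gauge P"
      unfolding orlicz_modular_nsum g nsum_cmult[symmetric]
      using le r(2) by (intro nsum_mono) (auto simp: ennreal_mult'[symmetric] intro!: ennreal_leI)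
    also have "\<dots> \<le> ennreal K * ennreal R"
      by (intro mult_left_mono P) auto
    also have "\<dots> \<le> 1"
      using r by (simp add: ennreal_mult'[symmetric])
    finally have "orlicz_norm M z \<le> r"
      by (rule orlicz_norm_le[OF M(1) r(1)])
    then show ?thesis
      by (simp add: xy z_def ennreal_leI)
  qed
  show ?thesis
    unfolding controls_def
  proof (intro conjI allI impI)
    fix R :: real assume R: "0 < R"
    \<comment> \<open>At least R / M 1, because \<open>Mt\<close> dominates M 1 * t beyond 1, so
      that values up to R force t to be at most r; at least R, so that the scaling factor 1/r brings
      the modular down to 1.\<close>
    define r where "r = max (max 1 R) (R / M 1)"
    have r: "1 \<le> r" "R \<le> r" "R \<le> M 1 * r"
      using M1 by (auto simp: r_def max_def field_simps)
    show "\<exists>C>0. \<forall>p\<in>hpairs. gauge p \<le> ennreal R \<longrightarrow> (\<lambda>(x, y). ennreal (mdist (orlicz_h_metric M) x y)) p \<le> ennreal C"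
    proof (intro exI[of _ r] conjI ballI impI)
      fix P assume P: "P \<in> hpairs" "gauge P \<le> ennreal R"
      show "(\<lambda>(x, y). ennreal (mdist (orlicz_h_metric M) x y)) P \<le> ennreal r"
      proof (rule main[OF P, of r "1 / r"])
        fix t :: real assume t: "0 \<le> t" "Mt t \<le> R"
        have "Mt (1 / r * t) \<le> 1 / r * Mt t"
          using r t by (intro Mt_scale) auto
        moreover have "t \<le> r"
        proof (rule ccontr)
          assume "\<not> t \<le> r"
          then have t1: "r < t" "1 < t" using r by auto
          have "M 1 * r < M 1 * t"
            using t1 M1 by simp
          also have "\<dots> \<le> M 1 * t powr p"
            using M1 t1 powr_mono[OF p, of t] by simp
          finally show False
            using t r t1 by (simp add: power_tail_def)
        qed
        ultimately show "t \<le> r \<and> Mt (t / r) \<le> 1 / r * Mt t"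
          by simp
      qed (use r R in auto)
    qed (use r in auto)
  next
    fix \<epsilon> :: real assume e: "0 < \<epsilon>"
    define r where "r = min \<epsilon> 1"
    have r: "0 < r" "r \<le> 1" "r \<le> \<epsilon>" using e by (auto simp: r_def)
    \<comment> \<open>Being below Mt r forces the coordinates to be at most r, and the second bound
      cancels the factor 1 / (c r^p) from the power estimate.\<close>
    define \<delta> where "\<delta> = min (Mt r / 2) (c * r powr p)"
    have Mr: "0 < Mt r" using Mt_pos r by simp
    have \<delta>: "0 < \<delta>" "\<delta> < Mt r" "\<delta> \<le> c * r powr p"
      using Mr c r by (auto simp: \<delta>_def)
    show "\<exists>\<delta>>0. \<forall>p\<in>hpairs. gauge p \<le> ennreal \<delta> \<longrightarrow> (\<lambda>(x, y). ennreal (mdist (orlicz_h_metric M) x y)) p \<le> ennreal \<epsilon>"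
    proof (intro exI[of _ \<delta>] conjI ballI impI \<delta>(1))
      fix P assume P: "P \<in> hpairs" "gauge P \<le> ennreal \<delta>"
      have "(\<lambda>(x, y). ennreal (mdist (orlicz_h_metric M) x y)) P \<le> ennreal r"
      proof (rule main[OF P, of r "1 / (c * r powr p)"])
        show "1 / (c * r powr p) * \<delta> \<le> 1"
          using \<delta> c r by simp
        fix t :: real assume t: "0 \<le> t" "Mt t \<le> \<delta>"
        have "t \<le> r"
          using Mt_mono[of r t] t r \<delta> by (meson less_imp_le not_le order.strict_trans1)
        moreover have "Mt (t / r) \<le> 1 / (c * r powr p) * Mt t"
        proof (cases "t = 0")
          case True
          then show ?thesis by (simp add: Mt_0)
        next
          case False
          have "c * (Mt (t / r) * r powr p) \<le> Mt (t / r * r)"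
            using False t r by (intro Mt_lower) auto
          then show ?thesis
            using c r by (simp add: field_simps)
        qed
        ultimately show "t \<le> r \<and> Mt (t / r) \<le> 1 / (c * r powr p) * Mt t" ..
      qed (use c r \<delta>(1) in auto)
      also have "\<dots> \<le> ennreal \<epsilon>"
        using r by (intro ennreal_leI)
      finally show "(\<lambda>(x, y). ennreal (mdist (orlicz_h_metric M) x y)) P \<le> ennreal \<epsilon>" .
    qed
  qed
qed

lemma gauge_finite: "P \<in> hpairs \<Longrightarrow> gauge P < \<infinity>"
proof -
  assume P: "P \<in> hpairs"
  obtain x y where xy: "P = (x, y)" by (cases P)
  define R where "R = mdist (orlicz_h_metric M) x y + 1"
  have "0 < R"
    unfolding R_def by (intro add_nonneg_pos mdist_nonneg) simp
  then obtain C where C: "\<forall>P\<in>hpairs. (\<lambda>(x, y). ennreal (mdist (orlicz_h_metric M) x y)) P \<le> ennreal R \<longrightarrow> gauge P \<le> ennreal C"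
    using dist_controls_gauge unfolding controls_def by blast
  have "(\<lambda>(x, y). ennreal (mdist (orlicz_h_metric M) x y)) P \<le> ennreal R"
    by (simp add: xy R_def ennreal_leI)
  then have "gauge P \<le> ennreal C"
    using C P by blast
  then show "gauge P < \<infinity>"
    using le_less_trans ennreal_less_top by (metis infinity_ennreal_def)
qed

text \<open>In each coordinate where x and y differ, one frequency and one wave already account for
  the gauge. The summand G is left abstract because it is an \<open>N\<close>-modular in one
  application and a squared distance in the other.\<close>

lemma gauge_le_wave_sum:
  fixes G :: "nat \<Rightarrow> int \<Rightarrow> bool option \<Rightarrow> ennreal"
  assumes \<theta>: "0 \<le> \<theta>"
    and G: "\<And>n j s. 1 / 2 \<le> \<bar>wave s (2 powr real_of_int j * x n) - wave s (2 powr real_of_int j * y n)\<bar> \<Longrightarrow>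
      ennreal (\<theta> * wgt j) \<le> G n j s"
  shows "ennreal (\<theta> * c * pi powr - p) * gauge (x, y) \<le> (\<Sum>\<^sup>+ n. \<Sum>\<^sup>+ j. \<Sum>\<^sup>+ s. G n j s)"
  unfolding gauge_def case_prod_conv nsum_cmult[symmetric]
proof (rule nsum_mono)
  fix n
  show "ennreal (\<theta> * c * pi powr - p) * ennreal (Mt \<bar>x n - y n\<bar>) \<le> (\<Sum>\<^sup>+ j. \<Sum>\<^sup>+ s. G n j s)"
  proof (cases "x n = y n")
    case True
    then show ?thesis by (simp add: Mt_0)
  next
    case False
    define d where "d = \<bar>x n - y n\<bar>"
    have d: "0 < d" using False by (simp add: d_def)
    obtain j where j: "pi / 2 \<le> 2 powr real_of_int j * d" "2 powr real_of_int j * d \<le> pi"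
      "c * pi powr - p * Mt d \<le> wgt j"
      using wgt_dyadic_ge[OF d] .
    have "\<bar>2 powr j * x n - 2 powr j * y n\<bar> = 2 powr j * d"
      by (simp add: d_def right_diff_distrib[symmetric] abs_mult)
    then obtain s where s: "1 / 2 \<le> \<bar>wave s (2 powr real_of_int j * x n) - wave s (2 powr real_of_int j * y n)\<bar>"
      using wave_separates[of "2 powr j * x n" "2 powr j * y n"] j by auto
    have "\<theta> * c * pi powr - p * Mt d \<le> \<theta> * wgt j"
      using mult_left_mono[OF j(3) \<theta>] by (simp add: mult_ac)
    then have "ennreal (\<theta> * c * pi powr - p) * ennreal (Mt d) \<le> ennreal (\<theta> * wgt j)"
      using \<theta> c by (simp add: ennreal_mult'[symmetric] ennreal_leI)
    also have "\<dots> \<le> G n j s"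
      by (rule G[OF s])
    also have "\<dots> \<le> (\<Sum>\<^sup>+ j. \<Sum>\<^sup>+ s. G n j s)"
      by (intro order.trans[OF _ nsum_ge_point[of _ j]] nsum_ge_point[of _ s])
    finally show ?thesis by (simp add: d_def)
  qed
qed

text \<open>Uniform in n: the linear errors of the blocks involve single coordinates and are to be
  charged to the norm.\<close>

lemma coordinate_le_norm:
  obtains T where "1 \<le> T" "\<And>z n. z \<in> orlicz_h M \<Longrightarrow> \<bar>z n\<bar> \<le> T * orlicz_norm M z"
proof -
  obtain T where T: "1 \<le> T" "\<And>z r n. 0 < r \<Longrightarrow> orlicz_modular M z r \<le> 1 \<Longrightarrow> \<bar>z n\<bar> \<le> T * r"
    using modular_coordinate_bound by blast
  have "\<bar>z n\<bar> \<le> T * orlicz_norm M z" if z: "z \<in> orlicz_h M" for z n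
  proof (rule field_le_epsilon)
    fix e :: real assume e: "0 < e"
    have "0 < e / T" using e T(1) by simp
    then obtain r where r: "0 < r" "orlicz_modular M z r \<le> 1" "r < orlicz_norm M z + e / T"
      using orlicz_norm_less[OF M(1) z] by blast
    have "\<bar>z n\<bar> \<le> T * r"
      by (rule T(2)[OF r(1,2)])
    also have "\<dots> \<le> T * (orlicz_norm M z + e / T)"
      using r(3) T(1) by (intro mult_left_mono) auto
    also have "\<dots> = T * orlicz_norm M z + e"
      using T(1) by (simp add: distrib_left)
    finally show "\<bar>z n\<bar> \<le> T * orlicz_norm M z + e" .
  qed
  then show thesis
    using that T(1) by blast
qed

end


subsection \<open>Sources of smaller index\<close>

context power_dominating
begin

text \<open>In each coordinate \<open>n\<close> and at each scale \<open>2 powr - j\<close>, the three waves are repeated as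
  often as is necessary for their \<open>N\<close>-modular to be comparable with \<open>M (2 powr - j)\<close>. The
  amplitudes are taken so that the linear error terms of \<open>not_dominates_power_block\<close>
  are summable over \<open>n\<close> and \<open>j\<close>.\<close>

lemma embeds_of_larger_power:
  assumes N: "orlicz_function N" "nondegenerate N" "dominates_power N Q" "\<not> dominates_power N q"
    and q: "p < q"
  shows "strongly_uniformly_embeds (orlicz_h_metric M) (orlicz_h_metric N)"
proof -
  \<comment> \<open>Normalised so that wgt j * e * (2^j |x n - y n|) equals 2^-n 2^-|j| |x n - y n|,
    which is summable over n and j.\<close>
  define e where "e = (\<lambda>(n::nat, j::int). (1/2::real) ^ n * (1/2) ^ nat \<bar>j\<bar> / (wgt j * 2 powr j))"
  have N1: "0 < N 1"
    using N(2) by (simp add: nondegenerate_def)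
  have e0: "0 < e a" for a
    using wgt_pos by (auto simp: e_def split: prod.splits)
  have q1: "1 \<le> q" using p q by simp
  \<comment> \<open>The bound wgt / N 1 on the amplitude makes N b at most wgt, so that rounding
    leaves at least one repetition.\<close>
  have "\<exists>b. 0 < b \<and> b \<le> wgt (snd a) / N 1 \<and> b \<le> 1 \<and>
     (\<forall>\<tau>. 0 \<le> \<tau> \<longrightarrow> \<tau> \<le> 1 \<longrightarrow> N (b * \<tau>) \<le> N b * (\<tau> powr q + e a * \<tau>))" for a
  proof -
    have "0 < wgt (snd a) / N 1"
      using wgt_pos N1 by simp
    from not_dominates_power_block[OF N(1,2,4) q1 e0 this] show ?thesis
      by metis
  qed
  then obtain b where b: "\<And>a. 0 < b a" "\<And>a. b a \<le> wgt (snd a) / N 1" "\<And>a. b a \<le> 1"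
    "\<And>a \<tau>. 0 \<le> \<tau> \<Longrightarrow> \<tau> \<le> 1 \<Longrightarrow> N (b a * \<tau>) \<le> N (b a) * (\<tau> powr q + e a * \<tau>)"
    by metis
  have Nb: "0 < N (b a)" "N (b a) \<le> wgt (snd a)" for a
  proof -
    show "0 < N (b a)"
      using N(2) b(1) by (simp add: nondegenerate_def)
    have "N (b a * 1) \<le> b a * N 1"
      using b(1)[of a] b(3)[of a] by (intro orlicz_scale[OF N(1)]) auto
    also have "\<dots> \<le> wgt (snd a)"
      using b(2)[of a] N1 by (simp add: field_simps)
    finally show "N (b a) \<le> wgt (snd a)" by simp
  qed
  define m where "m = (\<lambda>a. nat \<lfloor>wgt (snd a) / N (b a)\<rfloor>)"
  have m: "real (m a) * N (b a) \<le> wgt (snd a)" "wgt (snd a) / 2 \<le> real (m a) * N (b a)" for a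
    using floor_multiple_bounds[of "N (b a)" "wgt (snd a)"] Nb[of a] by (auto simp: m_def)
  define u where "u = (\<lambda>x. \<lambda>(a :: nat \<times> int, s). b a * wave s (2 powr real_of_int (snd a) * x (fst a)))"
  define F where "F = (\<lambda>x. repeated (\<lambda>(a, s). m a) (u x))"
  define S where "S = (\<lambda>(x, y). \<Sum>\<^sup>+ i. ennreal (N \<bar>F x i - F y i\<bar>))"
  define w where "w = (\<lambda>x y (a :: nat \<times> int) s. \<bar>wave s (2 powr real_of_int (snd a) * x (fst a)) - wave s (2 powr real_of_int (snd a) * y (fst a))\<bar>)"
  have u_diff: "\<bar>u x (a, s) - u y (a, s)\<bar> = b a * w x y a s" for x y a s
    using b(1)[of a] by (simp add: u_def w_def right_diff_distrib[symmetric] abs_mult)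
  have S_eq: "S (x, y) = (\<Sum>\<^sup>+ n. \<Sum>\<^sup>+ j. \<Sum>\<^sup>+ s. ennreal (real (m (n, j)) * N (b (n, j) * w x y (n, j) s)))" for x y
  proof -
    have "S (x, y) = (\<Sum>\<^sup>+ i. ennreal (N (\<bar>repeated (\<lambda>(a, s). m a) (\<lambda>i. u x i - u y i) i\<bar> / 1)))"
      by (simp add: S_def F_def repeated_diff)
    also have "\<dots> = (\<Sum>\<^sup>+ i. ennreal (real (m (fst i)) * N (b (fst i) * w x y (fst i) (snd i))))"
      unfolding nsum_repeated[OF N(1)]
      by (intro arg_cong[of _ _ nsum] ext) (auto simp: u_diff)
    also have "\<dots> = (\<Sum>\<^sup>+ n. \<Sum>\<^sup>+ j. \<Sum>\<^sup>+ s. ennreal (real (m (n, j)) * N (b (n, j) * w x y (n, j) s)))"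
      by (simp add: nsum_pair)
    finally show ?thesis .
  qed
  have w_le: "w x y (n, j) s \<le> min 1 (2 powr j * \<bar>x n - y n\<bar>)" for x y n j s
    using wave_diff_le[of s "2 powr j * x n" "2 powr j * y n"]
    by (simp add: w_def right_diff_distrib[symmetric] abs_mult)
  have w0: "0 \<le> w x y a s" for x y a s
    by (simp add: w_def)
  obtain C where C: "0 < C"
    "\<And>d. 0 \<le> d \<Longrightarrow> (\<Sum>\<^sup>+ j. ennreal (wgt j * (min 1 (2 powr real_of_int j * d)) powr q)) \<le> ennreal (C * Mt d)"
    using wgt_dyadic_sum[OF q] by blast
  obtain T where T: "1 \<le> T" "\<And>z n. z \<in> orlicz_h M \<Longrightarrow> \<bar>z n\<bar> \<le> T * orlicz_norm M z"
    using coordinate_le_norm by blast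
  \<comment> \<open>The power terms sum to the gauge and the linear errors to the distance. The
    factor 3 counts the waves, and 24 is 3 times the bounds 4 and 2 for the series over j and
    n.\<close>
  have upper: "S P \<le> ennreal (3 * C) * gauge P + ennreal (24 * T) * (\<lambda>(x, y). ennreal (mdist (orlicz_h_metric M) x y)) P"
    if P: "P \<in> hpairs" for P
  proof -
    obtain x y where xy: "P = (x, y)" "(\<lambda>n. x n - y n) \<in> orlicz_h M"
      "mdist (orlicz_h_metric M) x y = orlicz_norm M (\<lambda>n. x n - y n)"
      using P by (rule mem_hpairsE)
    define D where "D = mdist (orlicz_h_metric M) x y"
    have D0: "0 \<le> D" by (simp add: D_def)
    have dD: "\<bar>x n - y n\<bar> \<le> T * D" for n
      using T(2)[OF xy(2), of n] xy(3) by (simp add: D_def)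
    have term_le: "real (m (n, j)) * N (b (n, j) * w x y (n, j) s)
        \<le> wgt j * (min 1 (2 powr j * \<bar>x n - y n\<bar>)) powr q + (1/2) ^ n * (T * D) * (1/2) ^ nat \<bar>j\<bar>" for n j s
    proof -
      define \<tau> where "\<tau> = min 1 (2 powr j * \<bar>x n - y n\<bar>)"
      have \<tau>: "0 \<le> \<tau>" "\<tau> \<le> 1" "\<tau> \<le> 2 powr j * \<bar>x n - y n\<bar>"
        by (auto simp: \<tau>_def)
      have "N (b (n, j) * w x y (n, j) s) \<le> N (b (n, j) * \<tau>)"
        using w_le[of x y n j s] w0[of x y "(n, j)" s] b(1)[of "(n, j)"] unfolding \<tau>_def[symmetric]
        by (intro orlicz_mono[OF N(1)] mult_left_mono) auto
      also have "\<dots> \<le> N (b (n, j)) * (\<tau> powr q + e (n, j) * \<tau>)"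
        using \<tau> by (intro b(4))
      finally have "real (m (n, j)) * N (b (n, j) * w x y (n, j) s)
          \<le> (real (m (n, j)) * N (b (n, j))) * (\<tau> powr q + e (n, j) * \<tau>)"
        by (simp add: mult.assoc mult_left_mono)
      also have "\<dots> \<le> wgt j * (\<tau> powr q + e (n, j) * \<tau>)"
        using m(1)[of "(n, j)"] \<tau> e0[of "(n, j)"] by (intro mult_right_mono) auto
      also have "\<dots> \<le> wgt j * (\<tau> powr q + e (n, j) * (2 powr j * (T * D)))"
        using \<tau> e0[of "(n, j)"] wgt_pos[of j] dD[of n]
        by (intro mult_left_mono add_left_mono) (auto intro: order.trans[OF \<tau>(3)])
      also have "\<dots> = wgt j * \<tau> powr q + (1/2) ^ n * (T * D) * (1/2) ^ nat \<bar>j\<bar>"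
        using wgt_pos[of j] by (simp add: e_def distrib_left)
      finally show ?thesis by (simp add: \<tau>_def)
    qed
    have TD: "0 \<le> T * D" using T D0 by simp
    have sum_j: "(\<Sum>\<^sup>+ j. \<Sum>\<^sup>+ s. ennreal (real (m (n, j)) * N (b (n, j) * w x y (n, j) s)))
        \<le> 3 * (ennreal C * ennreal (Mt \<bar>x n - y n\<bar>) + ennreal (4 * (T * D) * (1/2) ^ n))" for n
    proof -
      let ?f = "\<lambda>j. ennreal (wgt j * (min 1 (2 powr real_of_int j * \<bar>x n - y n\<bar>)) powr q)"
      let ?g = "\<lambda>j::int. ennreal ((1/2) ^ n * (T * D)) * ennreal ((1/2) ^ nat \<bar>j\<bar>)"
      have "(\<Sum>\<^sup>+ j. \<Sum>\<^sup>+ s. ennreal (real (m (n, j)) * N (b (n, j) * w x y (n, j) s)))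
          \<le> (\<Sum>\<^sup>+ j. \<Sum>\<^sup>+ s::bool option. ?f j + ?g j)"
      proof (intro nsum_mono)
        fix j s
        show "ennreal (real (m (n, j)) * N (b (n, j) * w x y (n, j) s)) \<le> ?f j + ?g j"
          using ennreal_leI[OF term_le[of n j s]] wgt_pos[of j] TD
          by (simp add: ennreal_plus ennreal_mult[symmetric] del: ennreal_plus_if)
      qed
      also have "\<dots> = 3 * (nsum ?f + ennreal ((1/2) ^ n * (T * D)) * (\<Sum>\<^sup>+ j::int. ennreal ((1/2) ^ nat \<bar>j\<bar>)))"
        by (simp only: nsum_bool_option_const nsum_cmult nsum_add)
      also have "\<dots> \<le> 3 * (ennreal (C * Mt \<bar>x n - y n\<bar>) + ennreal ((1/2) ^ n * (T * D)) * ennreal 4)"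
        using C(2)[of "\<bar>x n - y n\<bar>"] nsum_geometric_int[of "1/2"]
        by (intro mult_left_mono add_mono) auto
      also have "\<dots> = 3 * (ennreal C * ennreal (Mt \<bar>x n - y n\<bar>) + ennreal (4 * (T * D) * (1/2) ^ n))"
      proof -
        have "ennreal ((1/2) ^ n * (T * D)) * ennreal 4 = ennreal (4 * (T * D) * (1/2) ^ n)"
          using TD T(1) D0 by (subst ennreal_mult[symmetric]) (simp_all add: mult_ac)
        moreover have "ennreal (C * Mt \<bar>x n - y n\<bar>) = ennreal C * ennreal (Mt \<bar>x n - y n\<bar>)"
          using C(1) Mt_nonneg[of "\<bar>x n - y n\<bar>"] by (intro ennreal_mult) auto
        ultimately show ?thesis
          by (simp only:)
      qed
      finally show ?thesis .
    qed
    have "S P \<le> (\<Sum>\<^sup>+ n. 3 * (ennreal C * ennreal (Mt \<bar>x n - y n\<bar>) + ennreal (4 * (T * D) * (1/2) ^ n)))"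
      unfolding xy(1) S_eq by (intro nsum_mono sum_j)
    also have "\<dots> = 3 * (ennreal C * gauge P + ennreal (8 * (T * D)))"
      unfolding nsum_cmult nsum_add using nsum_geometric[of "1/2" "4 * (T * D)"] TD
      by (simp add: gauge_def xy)
    also have "\<dots> = ennreal 3 * ennreal C * gauge P + ennreal 3 * ennreal (8 * (T * D))"
      by (simp add: distrib_left mult.assoc)
    also have "\<dots> = ennreal (3 * C) * gauge P + ennreal (24 * T) * ennreal D"
      using C(1) T(1) D0 by (simp add: ennreal_mult[symmetric] mult.assoc del: ennreal_numeral)
    finally show ?thesis by (simp add: xy(1) D_def)
  qed
  obtain K where K: "1 \<le> K" "\<And>s. 0 \<le> s \<Longrightarrow> s \<le> 1 \<Longrightarrow> N (2 * s) \<le> K * N s"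
    using dominates_power_delta2[OF N(1-3), of 2 1] by auto
  \<comment> \<open>The doubling constant K covers waves that differ by only 1/2, and the 2 is lost
    in rounding the number of repetitions.\<close>
  define \<kappa> where "\<kappa> = 1 / (2 * K) * c * pi powr - p"
  have \<kappa>: "0 < \<kappa>"
    using c K by (simp add: \<kappa>_def)
  have lower: "ennreal \<kappa> * gauge P \<le> S P" for P
  proof -
    obtain x y where xy: "P = (x, y)"
      by (cases P)
    show ?thesis
      unfolding xy S_eq \<kappa>_def
    proof (rule gauge_le_wave_sum)
      fix n j s
      assume "1 / 2 \<le> \<bar>wave s (2 powr real_of_int j * x n) - wave s (2 powr real_of_int j * y n)\<bar>"
      then have s: "1 / 2 \<le> w x y (n, j) s"
        by (simp add: w_def)
      let ?a = "(n, j)"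
      have "N (2 * (b ?a / 2)) \<le> K * N (b ?a / 2)"
        using b(1)[of ?a] b(3)[of ?a] by (intro K(2)) auto
      also have "\<dots> \<le> K * N (b ?a * w x y ?a s)"
        using K(1) b(1)[of ?a] s mult_left_mono[OF s, of "b ?a"]
        by (intro mult_left_mono orlicz_mono[OF N(1)]) auto
      finally have "real (m ?a) * N (b ?a) \<le> real (m ?a) * (K * N (b ?a * w x y ?a s))"
        by (intro mult_left_mono) auto
      with m(2)[of ?a] have "wgt j / 2 \<le> K * (real (m ?a) * N (b ?a * w x y ?a s))"
        by (simp add: mult_ac)
      then have "1 / (2 * K) * wgt j \<le> real (m ?a) * N (b ?a * w x y ?a s)"
        using K(1) by (simp add: field_simps)
      then show "ennreal (1 / (2 * K) * wgt j) \<le> ennreal (real (m ?a) * N (b ?a * w x y ?a s))"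
        by (rule ennreal_leI)
    qed (use K(1) in simp)
  qed
  show ?thesis
  proof (rule strongly_uniformly_embeds_orlicz_hI[OF N(1-3), of 1 "orlicz_h_metric M" F "\<lambda>n. 0"])
    fix x y and i :: "((nat \<times> int) \<times> bool option) \<times> nat"
    obtain a s k where i: "i = ((a, s), k)"
      by (metis prod.exhaust)
    have "b a * w x y a s \<le> 1 * 1"
      using b(1)[of a] b(3)[of a] w0[of x y a s] w_le[of x y "fst a" "snd a" s] by (intro mult_mono) auto
    then show "\<bar>F x i - F y i\<bar> \<le> 1"
      by (simp add: F_def i repeated_diff) (simp add: repeated_def u_diff)
  next
    show "(\<lambda>n. 0) \<in> mspace (orlicz_h_metric M)"
      by (simp add: mspace_orlicz_h_metric[OF M(1)] zero_in_orlicz_h[OF M(1)])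
    show "F (\<lambda>n. 0) i = 0" for i
      by (auto simp: F_def repeated_def u_def split: prod.splits)
  next
    have "controls hpairs (\<lambda>(x, y). ennreal (mdist (orlicz_h_metric M) x y))
       (\<lambda>P. ennreal (3 * C) * gauge P + ennreal (24 * T) * (\<lambda>(x, y). ennreal (mdist (orlicz_h_metric M) x y)) P)"
      using C(1) T(1)
      by (intro controls_add controls_trans[OF dist_controls_gauge controlsI_linear[of "3 * C"]]
            controlsI_linear[of "24 * T"]) auto
    then show "controls hpairs (\<lambda>(x, y). ennreal (mdist (orlicz_h_metric M) x y))
        (\<lambda>(x, y). \<Sum>\<^sup>+ i. ennreal (N \<bar>F x i - F y i\<bar>))"
      unfolding S_def[symmetric] by (rule controls_mono) (rule upper)
    have "controls hpairs S gauge"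
      using \<kappa> lower by (intro controlsI_linear_ge[of \<kappa>])
    from controls_trans[OF this gauge_controls_dist]
    show "controls hpairs (\<lambda>(x, y). \<Sum>\<^sup>+ i. ennreal (N \<bar>F x i - F y i\<bar>))
        (\<lambda>(x, y). ennreal (mdist (orlicz_h_metric M) x y))"
      unfolding S_def .
  qed simp
qed

end

lemma power_dominatingI:
  assumes "orlicz_function M" "nondegenerate M" "dominates_power M p"
  obtains c where "power_dominating M p c"
proof -
  obtain c where "c > 0" "\<forall>l\<in>{0<..1}. \<forall>t\<in>{0<..1}. c * (M l * t powr p) \<le> M (l * t)"
    using assms(3) by (auto simp: dominates_power_def)
  then have "power_dominating M p c"
    using assms dominates_power_ge_1[OF assms] by unfold_locales auto
  then show thesis
    by (rule that)
qed

lemma embeds_of_larger_index: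
  assumes M: "orlicz_function M" "nondegenerate M" and N: "orlicz_function N" "nondegenerate N"
    and less: "upper_MO_index M < upper_MO_index N" "upper_MO_index N < \<infinity>"
  shows "strongly_uniformly_embeds (orlicz_h_metric M) (orlicz_h_metric N)"
proof -
  obtain p where p: "ereal p < upper_MO_index N" "dominates_power M p"
    using upper_MO_index_less[OF M less(1)] .
  obtain q where q: "ereal p < ereal q" "ereal q < upper_MO_index N"
    using ereal_dense2[OF p(1)] by blast
  obtain Q where Q: "dominates_power N Q"
    using upper_MO_index_less[OF N less(2)] by blast
  obtain c where c: "power_dominating M p c"
    using power_dominatingI[OF M p(2)] .
  show ?thesis
    using power_dominating.embeds_of_larger_power[OF c N Q less_upper_MO_index[OF N q(2)]] q(1) by simp
qed


subsection \<open>Poisson laws on finite words\<close>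

text \<open>Distributivity: expanding the k-th power of the sum gives one product for each word of
  length k.\<close>

lemma nsum_lists_length:
  fixes h :: "'i \<Rightarrow> ennreal"
  shows "(\<Sum>\<^sup>+ l. if length l = k then prod_list (map h l) else 0) = nsum h ^ k"
proof (induction k)
  case 0
  show ?case
    by (subst nsum_finite_support[of "{[]}"]) auto
next
  case (Suc k)
  have "(\<Sum>\<^sup>+ l. if length l = Suc k then prod_list (map h l) else 0)
      = (\<Sum>\<^sup>+ a. if length (snd a) = k then h (fst a) * prod_list (map h (snd a)) else 0)"
  proof (subst nsum_reindex[of "\<lambda>a. fst a # snd a"])
    show "inj (\<lambda>a :: 'i \<times> 'i list. fst a # snd a)"
      by (auto simp: inj_def)
    fix y :: "'i list" assume y: "y \<notin> range (\<lambda>a. fst a # snd a)"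
    have "y = []"
    proof (rule ccontr)
      assume "y \<noteq> []"
      then have "y = (\<lambda>a. fst a # snd a) (hd y, tl y)" by simp
      with y show False by blast
    qed
    then show "(if length y = Suc k then prod_list (map h y) else 0) = 0" by simp
  qed (simp cong: if_cong)
  also have "\<dots> = (\<Sum>\<^sup>+ i. \<Sum>\<^sup>+ l. h i * (if length l = k then prod_list (map h l) else 0))"
    by (subst nsum_pair) (intro arg_cong[of _ _ nsum] ext, simp)
  also have "\<dots> = (\<Sum>\<^sup>+ i. nsum h ^ k * h i)"
    by (simp add: nsum_cmult Suc.IH mult.commute)
  also have "\<dots> = nsum h ^ Suc k"
    unfolding nsum_cmult by (simp add: mult.commute)
  finally show ?case .
qed

lemma nsum_lists:
  fixes h :: "'i \<Rightarrow> ennreal"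
  shows "(\<Sum>\<^sup>+ l. f (length l) * prod_list (map h l)) = (\<Sum>\<^sup>+ k. f k * nsum h ^ k)"
proof -
  have "(\<Sum>\<^sup>+ l. f (length l) * prod_list (map h l))
      = (\<Sum>\<^sup>+ l. \<Sum>\<^sup>+ k. f k * (if length l = k then prod_list (map h l) else 0))"
  proof (intro arg_cong[of _ _ nsum] ext)
    fix l
    show "f (length l) * prod_list (map h l) = (\<Sum>\<^sup>+ k. f k * (if length l = k then prod_list (map h l) else 0))"
      by (subst nsum_finite_support[of "{length l}"]) auto
  qed
  also have "\<dots> = (\<Sum>\<^sup>+ k. f k * nsum h ^ k)"
    by (subst nsum_swap) (simp only: nsum_cmult nsum_lists_length)
  finally show ?thesis .
qed

lemma nsum_exp:
  assumes "0 \<le> s"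
  shows "(\<Sum>\<^sup>+ k. ennreal (1 / fact k) * ennreal s ^ k) = ennreal (exp s)"
proof -
  have "(\<lambda>k. s ^ k / fact k) sums exp s"
    using exp_converges[of s] by (simp add: scaleR_conv_of_real field_simps)
  then have "(\<Sum>k. ennreal (s ^ k / fact k)) = ennreal (exp s)"
    using assms by (intro suminf_ennreal_eq) auto
  then show ?thesis
    using assms by (simp add: nsum_nat ennreal_mult[symmetric] ennreal_power)
qed

text \<open>With lambda the sum of the squares of \<open>\<phi>\<close>, finite and nonzero, the
  square of this amplitude is the probability of the word l when its length is Poisson with mean
  lambda and its letters are independent with law \<open>\<phi>\<close>^2 / lambda. For an infinite
  sum \<open>enn2real\<close> returns 0.\<close>

definition poisson_amp :: "('i \<Rightarrow> real) \<Rightarrow> 'i list \<Rightarrow> real" where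
  "poisson_amp \<phi> l =
     exp (- enn2real (\<Sum>\<^sup>+ i. ennreal ((\<phi> i)\<^sup>2)) / 2) * prod_list (map \<phi> l) / sqrt (fact (length l))"

lemma prod_list_map_mult: "prod_list (map f l) * prod_list (map g l) = prod_list (map (\<lambda>i. f i * g i :: 'a::comm_monoid_mult) l)"
  by (induction l) (auto simp: mult_ac)

lemma ennreal_prod_list: "(\<And>i. 0 \<le> f i) \<Longrightarrow> ennreal (prod_list (map f l)) = prod_list (map (\<lambda>i. ennreal (f i)) l)"
  by (induction l) (auto simp: ennreal_mult')

lemma poisson_amp_nonneg:
  assumes "\<And>i. 0 \<le> \<phi> i"
  shows "0 \<le> poisson_amp \<phi> l"
  using assms by (auto simp: poisson_amp_def intro!: prod_list_nonneg mult_nonneg_nonneg divide_nonneg_nonneg)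

text \<open>Summing over words turns the products into the exponential of the inner product of
  \<open>\<phi>\<close> and \<open>\<psi>\<close>. This inner product is (a + b - h) / 2, and the
  normalising factors cancel everything but exp (- h / 2).\<close>

lemma poisson_amp_affinity:
  fixes \<phi> \<psi> :: "'i \<Rightarrow> real"
  assumes nn: "\<And>i. 0 \<le> \<phi> i" "\<And>i. 0 \<le> \<psi> i"
    and fin: "(\<Sum>\<^sup>+ i. ennreal ((\<phi> i)\<^sup>2)) < \<infinity>" "(\<Sum>\<^sup>+ i. ennreal ((\<psi> i)\<^sup>2)) < \<infinity>"
    and h: "0 \<le> h" "(\<Sum>\<^sup>+ i. ennreal ((\<phi> i - \<psi> i)\<^sup>2)) = ennreal h"
  shows "(\<Sum>\<^sup>+ l. ennreal (poisson_amp \<phi> l * poisson_amp \<psi> l)) = ennreal (exp (- h / 2))"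
proof -
  obtain a where a: "0 \<le> a" "(\<Sum>\<^sup>+ i. ennreal ((\<phi> i)\<^sup>2)) = ennreal a"
    using fin(1) by (cases "\<Sum>\<^sup>+ i. ennreal ((\<phi> i)\<^sup>2)") auto
  obtain b where b: "0 \<le> b" "(\<Sum>\<^sup>+ i. ennreal ((\<psi> i)\<^sup>2)) = ennreal b"
    using fin(2) by (cases "\<Sum>\<^sup>+ i. ennreal ((\<psi> i)\<^sup>2)") auto
  let ?R = "\<Sum>\<^sup>+ i. ennreal (\<phi> i * \<psi> i)"
  \<comment> \<open>The expanded square with every term on the side where it is nonnegative, since
    subtraction in \<open>ennreal\<close> truncates. It also shows that the inner product is
    finite.\<close>
  have "ennreal h + 2 * ?R = ennreal a + ennreal b"
    unfolding h(2)[symmetric] a(2)[symmetric] b(2)[symmetric] nsum_add[symmetric] nsum_cmult[symmetric]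
  proof (intro arg_cong[of _ _ nsum] ext)
    fix i
    have "ennreal ((\<phi> i - \<psi> i)\<^sup>2) + ennreal (2 * (\<phi> i * \<psi> i)) = ennreal ((\<phi> i)\<^sup>2) + ennreal ((\<psi> i)\<^sup>2)"
      using nn sum_squares_bound[of "\<phi> i" "\<psi> i"] by (subst (1 2) ennreal_plus[symmetric]) (auto simp: power2_diff)
    then show "ennreal ((\<phi> i - \<psi> i)\<^sup>2) + 2 * ennreal (\<phi> i * \<psi> i) = ennreal ((\<phi> i)\<^sup>2) + ennreal ((\<psi> i)\<^sup>2)"
      using nn by (simp add: ennreal_mult)
  qed
  moreover have "?R \<noteq> top"
  proof
    assume "?R = top"
    with calculation have "ennreal a + ennreal b = top"
      by (simp add: ennreal_mult_top)
    then show False by simp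
  qed
  then obtain r where r: "0 \<le> r" "?R = ennreal r"
    by (cases ?R) auto
  ultimately have "ennreal (h + 2 * r) = ennreal (a + b)"
    using h(1) a(1) b(1) by (simp add: ennreal_mult)
  then have hr: "h + 2 * r = a + b"
    using h(1) a(1) b(1) r(1) by (subst (asm) ennreal_inj) auto
  have amp: "poisson_amp \<phi> l * poisson_amp \<psi> l
      = exp (- (a + b) / 2) * (1 / fact (length l) * prod_list (map (\<lambda>i. \<phi> i * \<psi> i) l))" for l
  proof -
    have "exp (- (a + b) / 2) = exp (- a / 2) * exp (- b / 2)"
      by (simp add: exp_add[symmetric] add_divide_distrib[symmetric])
    then show ?thesis
      using a b by (simp add: poisson_amp_def prod_list_map_mult[symmetric] field_simps)
  qed
  have "(\<Sum>\<^sup>+ l. ennreal (poisson_amp \<phi> l * poisson_amp \<psi> l))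
      = (\<Sum>\<^sup>+ l. ennreal (exp (- (a + b) / 2)) *
          (ennreal (1 / fact (length l)) * prod_list (map (\<lambda>i. ennreal (\<phi> i * \<psi> i)) l)))"
  proof (intro arg_cong[of _ _ nsum] ext)
    fix l :: "'i list"
    have f: "0 \<le> (1 / fact (length l) :: real)" by simp
    have g: "0 \<le> \<phi> i * \<psi> i" for i using nn by simp
    show "ennreal (poisson_amp \<phi> l * poisson_amp \<psi> l) = ennreal (exp (- (a + b) / 2)) *
          (ennreal (1 / fact (length l)) * prod_list (map (\<lambda>i. ennreal (\<phi> i * \<psi> i)) l))"
      unfolding amp ennreal_mult'[OF exp_ge_zero] ennreal_mult'[OF f] ennreal_prod_list[OF g] ..
  qed
  also have "\<dots> = ennreal (exp (- (a + b) / 2)) * ennreal (exp r)"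
    unfolding nsum_cmult using nsum_lists[of "\<lambda>k. ennreal (1 / fact k)" "\<lambda>i. ennreal (\<phi> i * \<psi> i)"]
    by (simp only: r(2) nsum_exp[OF r(1)])
  also have "\<dots> = ennreal (exp (- h / 2))"
  proof -
    have "- (a + b) / 2 + r = - h / 2"
      using hr by (simp add: field_simps)
    then show ?thesis
      by (simp only: ennreal_mult[symmetric] exp_ge_zero exp_add[symmetric])
  qed
  finally show ?thesis .
qed

lemma poisson_law_total:
  assumes "\<And>i. 0 \<le> \<phi> i" "(\<Sum>\<^sup>+ i. ennreal ((\<phi> i)\<^sup>2)) < \<infinity>"
  shows "(\<Sum>\<^sup>+ l. ennreal ((poisson_amp \<phi> l)\<^sup>2)) = 1"
  using poisson_amp_affinity[of \<phi> \<phi> 0] assms by (simp add: power2_eq_square nsum_def)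

text \<open>Write |v^2 - w^2| as |v - w| (v + w). From below it is at least (v - w)^2, whose sum the
  affinity gives. From above, a weighted arithmetic-geometric mean inequality stands in for
  Cauchy-Schwarz; its weight \<open>\<kappa>\<close> is left free and later taken of order sqrt
  h.\<close>

lemma poisson_law_distance:
  assumes nn: "\<And>i. 0 \<le> \<phi> i" "\<And>i. 0 \<le> \<psi> i"
    and fin: "(\<Sum>\<^sup>+ i. ennreal ((\<phi> i)\<^sup>2)) < \<infinity>" "(\<Sum>\<^sup>+ i. ennreal ((\<psi> i)\<^sup>2)) < \<infinity>"
    and h: "0 \<le> h" "(\<Sum>\<^sup>+ i. ennreal ((\<phi> i - \<psi> i)\<^sup>2)) = ennreal h"
  defines "tv \<equiv> \<Sum>\<^sup>+ l. ennreal \<bar>(poisson_amp \<phi> l)\<^sup>2 - (poisson_amp \<psi> l)\<^sup>2\<bar>"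
  shows "ennreal (2 - 2 * exp (- h / 2)) \<le> tv"
    and "0 < \<kappa> \<Longrightarrow> tv \<le> ennreal (h / (2 * \<kappa>) + 2 * \<kappa>)"
proof -
  define v where "v = poisson_amp \<phi>"
  define w where "w = poisson_amp \<psi>"
  have v0: "0 \<le> v l" and w0: "0 \<le> w l" for l
    using nn by (auto simp: v_def w_def intro: poisson_amp_nonneg)
  have vs: "(\<Sum>\<^sup>+ l. ennreal ((v l)\<^sup>2)) = 1" and ws: "(\<Sum>\<^sup>+ l. ennreal ((w l)\<^sup>2)) = 1"
    using poisson_law_total[of \<phi>] poisson_law_total[of \<psi>] nn fin by (auto simp: v_def w_def)
  have vw: "(\<Sum>\<^sup>+ l. ennreal (v l * w l)) = ennreal (exp (- h / 2))"
    unfolding v_def w_def by (rule poisson_amp_affinity[OF nn fin h])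
  have e1: "exp (- h / 2) \<le> 1" using h(1) by simp
  have "(\<Sum>\<^sup>+ l. ennreal ((v l - w l)\<^sup>2)) + 2 * (\<Sum>\<^sup>+ l. ennreal (v l * w l))
      = (\<Sum>\<^sup>+ l. ennreal ((v l)\<^sup>2)) + (\<Sum>\<^sup>+ l. ennreal ((w l)\<^sup>2))"
    unfolding nsum_add[symmetric] nsum_cmult[symmetric]
  proof (intro arg_cong[of _ _ nsum] ext)
    fix l
    have "ennreal ((v l - w l)\<^sup>2) + ennreal (2 * (v l * w l)) = ennreal ((v l)\<^sup>2) + ennreal ((w l)\<^sup>2)"
      using v0 w0 sum_squares_bound[of "v l" "w l"] by (subst (1 2) ennreal_plus[symmetric]) (auto simp: power2_diff)
    then show "ennreal ((v l - w l)\<^sup>2) + 2 * ennreal (v l * w l) = ennreal ((v l)\<^sup>2) + ennreal ((w l)\<^sup>2)"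
      using v0 w0 by (simp add: ennreal_mult)
  qed
  then have "(\<Sum>\<^sup>+ l. ennreal ((v l - w l)\<^sup>2)) + ennreal (2 * exp (- h / 2)) = ennreal 2"
    by (simp add: vs ws vw ennreal_mult)
  also have "ennreal 2 = ennreal (2 - 2 * exp (- h / 2)) + ennreal (2 * exp (- h / 2))"
    using e1 by (subst ennreal_plus[symmetric]) auto
  finally have X: "(\<Sum>\<^sup>+ l. ennreal ((v l - w l)\<^sup>2)) = ennreal (2 - 2 * exp (- h / 2))"
    by (simp add: ennreal_add_left_cancel add.commute[of _ "ennreal (2 * exp (- h / 2))"])
  have dist: "\<bar>(v l)\<^sup>2 - (w l)\<^sup>2\<bar> = \<bar>v l - w l\<bar> * (v l + w l)" for l
    using v0[of l] w0[of l] by (simp add: power2_eq_square square_diff_square_factored abs_mult)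
  have tv: "tv = (\<Sum>\<^sup>+ l. ennreal \<bar>(v l)\<^sup>2 - (w l)\<^sup>2\<bar>)"
    by (simp add: tv_def v_def w_def)
  show "ennreal (2 - 2 * exp (- h / 2)) \<le> tv"
    unfolding X[symmetric] tv
  proof (intro nsum_mono ennreal_leI)
    fix l
    have "\<bar>v l - w l\<bar> * \<bar>v l - w l\<bar> \<le> \<bar>v l - w l\<bar> * (v l + w l)"
      using v0[of l] w0[of l] by (intro mult_left_mono) auto
    then show "(v l - w l)\<^sup>2 \<le> \<bar>(v l)\<^sup>2 - (w l)\<^sup>2\<bar>"
      unfolding dist by (simp add: power2_eq_square abs_mult[symmetric])
  qed
  assume \<kappa>: "0 < \<kappa>"
  have le: "\<bar>(v l)\<^sup>2 - (w l)\<^sup>2\<bar> \<le> 1 / (2 * \<kappa>) * (v l - w l)\<^sup>2 + \<kappa> * ((v l)\<^sup>2 + (w l)\<^sup>2)" for l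
  proof -
    define x where "x = \<bar>v l - w l\<bar>"
    define y where "y = v l + w l"
    have "0 \<le> (x - \<kappa> * y)\<^sup>2" by simp
    then have 1: "2 * \<kappa> * (x * y) \<le> x\<^sup>2 + \<kappa>\<^sup>2 * y\<^sup>2"
      by (simp add: power2_eq_square algebra_simps)
    have "x * y \<le> (x\<^sup>2 + \<kappa>\<^sup>2 * y\<^sup>2) / (2 * \<kappa>)"
      using 1 \<kappa> by (simp add: pos_le_divide_eq mult.commute)
    also have "\<dots> = 1 / (2 * \<kappa>) * x\<^sup>2 + \<kappa> / 2 * y\<^sup>2"
      using \<kappa> by (simp add: field_simps power2_eq_square)
    finally have xy: "x * y \<le> 1 / (2 * \<kappa>) * x\<^sup>2 + \<kappa> / 2 * y\<^sup>2" .
    have "\<kappa> / 2 * y\<^sup>2 \<le> \<kappa> / 2 * (2 * ((v l)\<^sup>2 + (w l)\<^sup>2))"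
      using sum_squares_bound[of "v l" "w l"] \<kappa> by (intro mult_left_mono) (auto simp: y_def power2_sum)
    then have "1 / (2 * \<kappa>) * x\<^sup>2 + \<kappa> / 2 * y\<^sup>2 \<le> 1 / (2 * \<kappa>) * x\<^sup>2 + \<kappa> * ((v l)\<^sup>2 + (w l)\<^sup>2)"
      by (simp add: algebra_simps)
    with xy show ?thesis
      unfolding dist by (simp add: x_def y_def)
  qed
  have "tv \<le> (\<Sum>\<^sup>+ l. ennreal (1 / (2 * \<kappa>)) * ennreal ((v l - w l)\<^sup>2)
      + ennreal \<kappa> * (ennreal ((v l)\<^sup>2) + ennreal ((w l)\<^sup>2)))"
    unfolding tv
  proof (intro nsum_mono)
    fix l
    show "ennreal \<bar>(v l)\<^sup>2 - (w l)\<^sup>2\<bar> \<le> ennreal (1 / (2 * \<kappa>)) * ennreal ((v l - w l)\<^sup>2)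
        + ennreal \<kappa> * (ennreal ((v l)\<^sup>2) + ennreal ((w l)\<^sup>2))"
    proof -
      have \<kappa>': "0 \<le> 1 / (2 * \<kappa>)" "0 \<le> \<kappa>" using \<kappa> by auto
      show ?thesis
        using ennreal_leI[OF le[of l]]
        by (simp only: ennreal_plus ennreal_mult zero_le_power2 add_nonneg_nonneg mult_nonneg_nonneg \<kappa>')
    qed
  qed
  also have "\<dots> = ennreal (1 / (2 * \<kappa>)) * ennreal (2 - 2 * exp (- h / 2)) + ennreal \<kappa> * (1 + 1)"
    by (simp only: nsum_add nsum_cmult X vs ws)
  also have "\<dots> \<le> ennreal (1 / (2 * \<kappa>)) * ennreal h + ennreal \<kappa> * ennreal 2"
    using exp_ge_add_one_self[of "- h / 2"]
    by (intro add_mono mult_left_mono) (auto intro!: ennreal_leI simp: one_add_one)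
  also have "\<dots> = ennreal (h / (2 * \<kappa>) + 2 * \<kappa>)"
    using \<kappa> h(1) by (simp add: ennreal_mult[symmetric] ennreal_plus[symmetric] mult.commute del: ennreal_plus ennreal_numeral)
  finally show "tv \<le> ennreal (h / (2 * \<kappa>) + 2 * \<kappa>)" .
qed


subsection \<open>From summable to Orlicz sequences\<close>

text \<open>By convexity and N 0 = 0, s and t each carry at most their proportional share of N (s +
  t).\<close>

lemma orlicz_superadditive:
  assumes "orlicz_function N" "0 \<le> s" "0 \<le> t"
  shows "N s + N t \<le> N (s + t)"
proof (cases "s + t = 0")
  case True
  then have "s = 0" "t = 0"
    using assms(2,3) by linarith+
  then show ?thesis
    using orlicz_zero[OF assms(1)] by simp
next
  case False
  then have st: "0 < s + t" using assms by simp
  have "N ((s / (s + t)) * (s + t)) \<le> s / (s + t) * N (s + t)"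
    using assms st by (intro orlicz_scale) auto
  moreover have "N ((t / (s + t)) * (s + t)) \<le> t / (s + t) * N (s + t)"
    using assms st by (intro orlicz_scale) auto
  moreover have "s / (s + t) * N (s + t) + t / (s + t) * N (s + t) = N (s + t)"
    using st by (simp add: add_divide_distrib[symmetric] distrib_right[symmetric])
  ultimately show ?thesis
    using st by simp
qed

text \<open>G inverts \<open>N\<close>, as a Mazur map does for powers. Superadditivity gives the
  upper estimate. For the lower one, coordinates whose increment is small relative to the smaller
  value of G account for little total variation on probability vectors; on the others doubling
  bounds a - b by a multiple of the \<open>N\<close>-modular.\<close>

lemma orlicz_inverse_map:
  assumes N: "orlicz_function N" "nondegenerate N" "dominates_power N q"
  obtains G :: "real \<Rightarrow> real" and B :: real where "0 < B"
    "\<And>a. 0 \<le> a \<Longrightarrow> a \<le> 1 \<Longrightarrow> 0 \<le> G a \<and> G a \<le> B"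
    "\<And>a b. 0 \<le> a \<Longrightarrow> a \<le> 1 \<Longrightarrow> 0 \<le> b \<Longrightarrow> b \<le> 1 \<Longrightarrow> N \<bar>G a - G b\<bar> \<le> \<bar>a - b\<bar>"
    "\<And>\<eta>. 0 < \<eta> \<Longrightarrow> \<exists>\<omega>>0. \<forall>a b :: 'l \<Rightarrow> real. (\<forall>l. 0 \<le> a l) \<longrightarrow> (\<forall>l. 0 \<le> b l) \<longrightarrow>
        (\<Sum>\<^sup>+ l. ennreal (a l)) = 1 \<longrightarrow> (\<Sum>\<^sup>+ l. ennreal (b l)) = 1 \<longrightarrow>
        ennreal \<eta> \<le> (\<Sum>\<^sup>+ l. ennreal \<bar>a l - b l\<bar>) \<longrightarrow>
        ennreal \<omega> \<le> (\<Sum>\<^sup>+ l. ennreal (N \<bar>G (a l) - G (b l)\<bar>))"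
proof -
  have "eventually (\<lambda>t. N t \<ge> 1) at_top"
    using N(1) by (auto simp: orlicz_function_def filterlim_at_top)
  then obtain B0 where B0: "\<And>t. t \<ge> B0 \<Longrightarrow> N t \<ge> 1"
    by (auto simp: eventually_at_top_linorder)
  define B where "B = max B0 1"
  have B: "0 < B" "1 \<le> N B"
    using B0[of B] by (auto simp: B_def)
  have "\<exists>s. 0 \<le> s \<and> s \<le> B \<and> N s = a" if "0 \<le> a" "a \<le> 1" for a
    using IVT'[of N 0 a B] that B orlicz_zero[OF N(1)] orlicz_continuous_on[OF N(1), of "{0..B}"]
    by auto
  then obtain G where G: "\<And>a. 0 \<le> a \<Longrightarrow> a \<le> 1 \<Longrightarrow> 0 \<le> G a \<and> G a \<le> B \<and> N (G a) = a"
    by metis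
  have G_mono: "G b \<le> G a" if "0 \<le> b" "b \<le> a" "a \<le> 1" for a b
  proof (cases "a = b")
    case False
    show ?thesis
    proof (rule ccontr)
      assume "\<not> G b \<le> G a"
      then have "N (G a) \<le> N (G b)"
        using G[of a] that by (intro orlicz_mono[OF N(1)]) auto
      then show False
        using G[of a] G[of b] that False by auto
    qed
  qed simp
  have upper: "N \<bar>G a - G b\<bar> \<le> \<bar>a - b\<bar>" if "0 \<le> a" "a \<le> 1" "0 \<le> b" "b \<le> 1" for a b
  proof -
    have *: "N \<bar>G a - G b\<bar> \<le> \<bar>a - b\<bar>" if ab: "0 \<le> b" "b \<le> a" "a \<le> 1" for a b
      using orlicz_superadditive[OF N(1), of "G b" "G a - G b"] G_mono[OF ab] G[of a] G[of b] ab
      by simp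
    show ?thesis
      using *[of a b] *[of b a] that by (cases "b \<le> a") (auto simp: abs_minus_commute)
  qed
  obtain K where K: "1 \<le> K" "\<And>s. 0 \<le> s \<Longrightarrow> s \<le> B \<Longrightarrow> N (2 * s) \<le> K * N s"
    using dominates_power_delta2[OF N, of 2 B] B by auto
  have lower: "\<exists>\<omega>>0. \<forall>a b :: 'l \<Rightarrow> real. (\<forall>l. 0 \<le> a l) \<longrightarrow> (\<forall>l. 0 \<le> b l) \<longrightarrow>
        (\<Sum>\<^sup>+ l. ennreal (a l)) = 1 \<longrightarrow> (\<Sum>\<^sup>+ l. ennreal (b l)) = 1 \<longrightarrow>
        ennreal \<eta> \<le> (\<Sum>\<^sup>+ l. ennreal \<bar>a l - b l\<bar>) \<longrightarrow>
        ennreal \<omega> \<le> (\<Sum>\<^sup>+ l. ennreal (N \<bar>G (a l) - G (b l)\<bar>))" if \<eta>: "0 < \<eta>" for \<eta>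
  proof -
    \<comment> \<open>Chosen so that the small relative increments, worth at most e K (a l + b l)
      each, sum to at most half of \<open>\<eta>\<close>.\<close>
    define e where "e = min 1 (\<eta> / (4 * K))"
    have e: "0 < e" "e \<le> 1" "2 * (e * K) \<le> \<eta> / 2"
      using \<eta> K by (auto simp: e_def min_def field_simps)
    \<comment> \<open>When the increment d exceeds e s, the sum s + d is at most (1 + 1/e) d, and
      doubling with this factor bounds N (s + d) by a multiple of N d.\<close>
    have "1 \<le> 1 + 1 / e" using e by simp
    from dominates_power_delta2[OF N this B(1)] obtain L
      where L: "1 \<le> L" "\<And>s. 0 \<le> s \<Longrightarrow> s \<le> B \<Longrightarrow> N ((1 + 1 / e) * s) \<le> L * N s" by blast
    have *: "a - b \<le> e * K * (a + b) + L * N (G a - G b)" if ab: "0 \<le> b" "b \<le> a" "a \<le> 1" for a b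
    proof -
      define s where "s = G b"
      define d where "d = G a - G b"
      have sd: "0 \<le> s" "s \<le> B" "0 \<le> d" "d \<le> B" "N s = b" "N (s + d) = a"
        using G[of a] G[of b] G_mono[OF ab] ab by (auto simp: s_def d_def)
      have Nd: "0 \<le> N d" using sd orlicz_nonneg[OF N(1)] by simp
      show ?thesis
      proof (cases "d \<le> e * s")
        case True
        have "N (s + d) \<le> N ((1 - e) * s + e * (2 * s))"
          using True sd e by (intro orlicz_mono[OF N(1)]) (auto simp: algebra_simps)
        also have "\<dots> \<le> (1 - e) * N s + e * N (2 * s)"
          using sd e by (intro orlicz_convex[OF N(1)]) auto
        also have "\<dots> \<le> 1 * N s + e * (K * N s)"
          using sd e ab K(2)[of s] by (intro add_mono mult_right_mono mult_left_mono) auto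
        finally have "a - b \<le> e * K * b"
          using sd by simp
        also have "\<dots> \<le> e * K * (a + b)"
          using e K ab by (intro mult_left_mono) auto
        finally show ?thesis
          using L(1) Nd by (simp add: d_def[symmetric] add_increasing2)
      next
        case False
        then have "s \<le> d * (1 / e)"
          using e by (simp add: field_simps)
        then have "N (s + d) \<le> N ((1 + 1 / e) * d)"
          using sd by (intro orlicz_mono[OF N(1)]) (auto simp: distrib_right)
        also have "\<dots> \<le> L * N d"
          using sd by (intro L(2))
        finally have "a - b \<le> L * N d"
          using sd ab by simp
        moreover have "0 \<le> e * K * (a + b)"
          using e K ab by simp
        ultimately show ?thesis
          by (simp add: d_def)
      qed
    qed
    have sym: "\<bar>a - b\<bar> \<le> e * K * (a + b) + L * N \<bar>G a - G b\<bar>"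
      if "0 \<le> a" "a \<le> 1" "0 \<le> b" "b \<le> 1" for a b
      using *[of b a] *[of a b] that G_mono[of a b] G_mono[of b a]
      by (cases "b \<le> a") (auto simp: add.commute abs_minus_commute)
    define \<omega> where "\<omega> = \<eta> / (2 * L)"
    have \<omega>: "0 < \<omega>" using \<eta> L by (simp add: \<omega>_def)
    show ?thesis
    proof (intro exI[of _ \<omega>] conjI allI impI \<omega>)
      fix a b :: "'l \<Rightarrow> real"
      assume a: "\<forall>l. 0 \<le> a l" and b: "\<forall>l. 0 \<le> b l" and sums: "(\<Sum>\<^sup>+ l. ennreal (a l)) = 1" "(\<Sum>\<^sup>+ l. ennreal (b l)) = 1"
        and tv: "ennreal \<eta> \<le> (\<Sum>\<^sup>+ l. ennreal \<bar>a l - b l\<bar>)"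
      let ?S = "\<Sum>\<^sup>+ l. ennreal (N \<bar>G (a l) - G (b l)\<bar>)"
      have le1: "a l \<le> 1" "b l \<le> 1" for l
        using nsum_ge_point[of "\<lambda>l. ennreal (a l)" l] nsum_ge_point[of "\<lambda>l. ennreal (b l)" l] by (auto simp: sums)
      have "ennreal \<eta> \<le> (\<Sum>\<^sup>+ l. ennreal (e * K) * (ennreal (a l) + ennreal (b l)) + ennreal L * ennreal (N \<bar>G (a l) - G (b l)\<bar>))"
        using tv
      proof (rule order.trans, intro nsum_mono)
        fix l
        have "ennreal \<bar>a l - b l\<bar> \<le> ennreal (e * K * (a l + b l) + L * N \<bar>G (a l) - G (b l)\<bar>)"
          using a b le1 by (intro ennreal_leI sym) auto
        then show "ennreal \<bar>a l - b l\<bar> \<le> ennreal (e * K) * (ennreal (a l) + ennreal (b l)) + ennreal L * ennreal (N \<bar>G (a l) - G (b l)\<bar>)"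
          using a b e K L orlicz_nonneg[OF N(1)]
          by (simp add: ennreal_plus[symmetric] ennreal_mult[symmetric] del: ennreal_plus)
      qed
      also have "\<dots> = ennreal (e * K) * (1 + 1) + ennreal L * ?S"
        by (simp only: nsum_add nsum_cmult sums)
      also have "ennreal (e * K) * (1 + 1) = ennreal (2 * (e * K))"
        using e K by (simp add: one_add_one ennreal_mult mult.commute)
      also have "\<dots> \<le> ennreal (\<eta> / 2)"
        by (intro ennreal_leI e)
      finally have main: "ennreal \<eta> \<le> ennreal (\<eta> / 2) + ennreal L * ?S"
        by simp
      show "ennreal \<omega> \<le> ?S"
      proof (cases ?S)
        case (real s)
        have "\<eta> \<le> \<eta> / 2 + L * s"
          using main \<eta> L real by (simp add: ennreal_mult[symmetric] ennreal_plus[symmetric] del: ennreal_plus)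
        then have "\<omega> \<le> s"
          using L by (simp add: \<omega>_def field_simps)
        then show ?thesis
          using real by (simp add: ennreal_leI)
      qed simp
    qed
  qed
  show thesis
    using that[OF B(1) _ upper lower] G by blast
qed


subsection \<open>Sources of index less than two\<close>

context power_dominating
begin

text \<open>Since p < 2, the dyadic sums with exponent 2 make the squared wave distance H comparable
  with the gauge. It remains to compare H with the \<open>N\<close>-modular of the transformed
  Poisson weights.\<close>

lemma embeds_of_power_less_2:
  assumes N: "orlicz_function N" "nondegenerate N" "dominates_power N Q" and p2: "p < 2"
  shows "strongly_uniformly_embeds (orlicz_h_metric M) (orlicz_h_metric N)"
proof -
  define wd where "wd = (\<lambda>x y n (j::int) s. wave s (2 powr real_of_int j * x (n::nat)) - wave s (2 powr real_of_int j * y n))"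
  define H where "H = (\<lambda>(x, y). \<Sum>\<^sup>+ n. \<Sum>\<^sup>+ j. \<Sum>\<^sup>+ s. ennreal (wgt j * (wd x y n j s)\<^sup>2))"
  \<comment> \<open>The factor 2^-k on amplitudes is the factor 4^-k on intensities, the parameter t
    of the Poisson laws.\<close>
  define \<phi> where "\<phi> = (\<lambda>(k::nat) x (n::nat, j, s). (1/2) ^ k * sqrt (wgt j) * wave s (2 powr real_of_int j * x n))"
  define w where "w = (\<lambda>k x l. (poisson_amp (\<phi> k x) l)\<^sup>2)"
  have energy: "(\<Sum>\<^sup>+ i. ennreal ((\<phi> k x i - \<phi> k y i)\<^sup>2)) = ennreal ((1/4) ^ k) * H (x, y)" for k x y
  proof -
    have pow4: "((1/2::real) ^ k)\<^sup>2 = (1/4) ^ k"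
      unfolding power2_eq_square power_mult_distrib[symmetric] by simp
    have "(\<phi> k x (n, j, s) - \<phi> k y (n, j, s))\<^sup>2 = (1/4) ^ k * (wgt j * (wd x y n j s)\<^sup>2)" for n j s
    proof -
      have "(\<phi> k x (n, j, s) - \<phi> k y (n, j, s)) = (1/2) ^ k * (sqrt (wgt j) * wd x y n j s)"
        by (simp add: \<phi>_def wd_def algebra_simps)
      then show ?thesis
        using wgt_pos[of j] by (simp only: power_mult_distrib pow4) simp
    qed
    then have "(\<Sum>\<^sup>+ i. ennreal ((\<phi> k x i - \<phi> k y i)\<^sup>2))
        = (\<Sum>\<^sup>+ n. \<Sum>\<^sup>+ j. \<Sum>\<^sup>+ s. ennreal ((1/4) ^ k) * ennreal (wgt j * (wd x y n j s)\<^sup>2))"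
      by (simp add: nsum_pair ennreal_mult'[symmetric] del: power_divide)
    then show ?thesis
      by (simp only: nsum_cmult H_def case_prod_conv)
  qed
  obtain C where C: "0 < C"
    "\<And>d. 0 \<le> d \<Longrightarrow> (\<Sum>\<^sup>+ j. ennreal (wgt j * (min 1 (2 powr real_of_int j * d)) powr 2)) \<le> ennreal (C * Mt d)"
    using wgt_dyadic_sum[OF p2] by blast
  have H_le: "H P \<le> ennreal (3 * C) * gauge P" for P
  proof -
    obtain x y where xy: "P = (x, y)" by (cases P)
    have "(\<Sum>\<^sup>+ j. \<Sum>\<^sup>+ s. ennreal (wgt j * (wd x y n j s)\<^sup>2)) \<le> ennreal (3 * C) * ennreal (Mt \<bar>x n - y n\<bar>)" for n
    proof -
      have le: "(wd x y n j s)\<^sup>2 \<le> (min 1 (2 powr real_of_int j * \<bar>x n - y n\<bar>)) powr 2" for j s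
      proof -
        have "\<bar>wd x y n j s\<bar> \<le> min 1 (2 powr real_of_int j * \<bar>x n - y n\<bar>)"
          using wave_diff_le[of s "2 powr j * x n" "2 powr j * y n"]
          by (simp add: wd_def right_diff_distrib[symmetric] abs_mult)
        then have "\<bar>wd x y n j s\<bar>\<^sup>2 \<le> (min 1 (2 powr real_of_int j * \<bar>x n - y n\<bar>))\<^sup>2"
          by (intro power_mono) auto
        then show ?thesis
          by simp
      qed
      have "(\<Sum>\<^sup>+ j. \<Sum>\<^sup>+ s. ennreal (wgt j * (wd x y n j s)\<^sup>2))
          \<le> (\<Sum>\<^sup>+ j. \<Sum>\<^sup>+ s::bool option. ennreal (wgt j * (min 1 (2 powr real_of_int j * \<bar>x n - y n\<bar>)) powr 2))"
        using le less_imp_le[OF wgt_pos] by (intro nsum_mono ennreal_leI mult_left_mono) auto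
      also have "\<dots> \<le> 3 * ennreal (C * Mt \<bar>x n - y n\<bar>)"
        unfolding nsum_bool_option_const nsum_cmult by (intro mult_left_mono C(2)) auto
      also have "\<dots> = ennreal (3 * C) * ennreal (Mt \<bar>x n - y n\<bar>)"
        using C(1) Mt_nonneg[of "\<bar>x n - y n\<bar>"] by (simp add: ennreal_mult mult.assoc)
      finally show ?thesis .
    qed
    then show ?thesis
      unfolding xy H_def gauge_def case_prod_conv nsum_cmult[symmetric] by (rule nsum_mono)
  qed
  define \<theta> where "\<theta> = 1 / 4 * c * pi powr - p"
  have \<theta>: "0 < \<theta>" using c by (simp add: \<theta>_def)
  have H_ge: "ennreal \<theta> * gauge P \<le> H P" for P
  proof -
    obtain x y where xy: "P = (x, y)" by (cases P)
    show ?thesis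
      unfolding xy H_def case_prod_conv \<theta>_def
    proof (rule gauge_le_wave_sum)
      fix n j s
      assume "1 / 2 \<le> \<bar>wave s (2 powr real_of_int j * x n) - wave s (2 powr real_of_int j * y n)\<bar>"
      then have "(1 / 2)\<^sup>2 \<le> \<bar>wd x y n j s\<bar>\<^sup>2"
        by (intro power_mono) (auto simp: wd_def)
      then have "1 / 4 * wgt j \<le> wgt j * (wd x y n j s)\<^sup>2"
        using wgt_pos[of j] by (simp add: power2_eq_square)
      then show "ennreal (1 / 4 * wgt j) \<le> ennreal (wgt j * (wd x y n j s)\<^sup>2)"
        by (rule ennreal_leI)
    qed simp
  qed
  have H_fin: "H P < \<infinity>" if "P \<in> hpairs" for P
    using H_le[of P] gauge_finite[OF that] by (auto simp: ennreal_mult_less_top intro: le_less_trans)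
  have zero: "(\<lambda>n. 0) \<in> mspace (orlicz_h_metric M)"
    by (simp add: mspace_orlicz_h_metric[OF M(1)] zero_in_orlicz_h[OF M(1)])
  have \<phi>0: "\<phi> k (\<lambda>n. 0) = (\<lambda>i. 0)" for k
    by (auto simp: \<phi>_def)
  have \<phi>_nonneg: "0 \<le> \<phi> k x i" for k x i
    using less_imp_le[OF wgt_pos] wave_bounds by (auto simp: \<phi>_def split: prod.splits)
  have \<phi>_fin: "(\<Sum>\<^sup>+ i. ennreal ((\<phi> k x i)\<^sup>2)) < \<infinity>" if "x \<in> mspace (orlicz_h_metric M)" for k x
    using energy[of k x "\<lambda>n. 0"] H_fin[of "(x, \<lambda>n. 0)"] that zero
    by (simp add: \<phi>0 ennreal_mult_less_top)
  have w_nonneg: "0 \<le> w k x l" for k x l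
    by (simp add: w_def)
  have w_total: "(\<Sum>\<^sup>+ l. ennreal (w k x l)) = 1" if "x \<in> mspace (orlicz_h_metric M)" for k x
    unfolding w_def by (rule poisson_law_total[OF \<phi>_nonneg \<phi>_fin[OF that]])
  have w_le_1: "w k x l \<le> 1" if "x \<in> mspace (orlicz_h_metric M)" for k x l
    using nsum_ge_point[of "\<lambda>l. ennreal (w k x l)" l] by (simp add: w_total[OF that])
  have tv: "ennreal (2 - 2 * exp (- ((1/4) ^ k * h) / 2)) \<le> (\<Sum>\<^sup>+ l. ennreal \<bar>w k x l - w k y l\<bar>)"
    "0 < \<kappa> \<Longrightarrow> (\<Sum>\<^sup>+ l. ennreal \<bar>w k x l - w k y l\<bar>) \<le> ennreal ((1/4) ^ k * h / (2 * \<kappa>) + 2 * \<kappa>)"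
    if "x \<in> mspace (orlicz_h_metric M)" "y \<in> mspace (orlicz_h_metric M)" "0 \<le> h" "H (x, y) = ennreal h" for k x y h \<kappa>
  proof -
    have "(\<Sum>\<^sup>+ i. ennreal ((\<phi> k x i - \<phi> k y i)\<^sup>2)) = ennreal ((1/4) ^ k * h)"
      unfolding energy that(4) using that(3) by (simp add: ennreal_mult')
    note * = poisson_law_distance[OF \<phi>_nonneg \<phi>_nonneg \<phi>_fin[OF that(1)] \<phi>_fin[OF that(2)] _ this]
    have h: "0 \<le> (1/4) ^ k * h" using that(3) by simp
    show "ennreal (2 - 2 * exp (- ((1/4) ^ k * h) / 2)) \<le> (\<Sum>\<^sup>+ l. ennreal \<bar>w k x l - w k y l\<bar>)"
      unfolding w_def by (rule *(1)[OF h])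
    show "0 < \<kappa> \<Longrightarrow> (\<Sum>\<^sup>+ l. ennreal \<bar>w k x l - w k y l\<bar>) \<le> ennreal ((1/4) ^ k * h / (2 * \<kappa>) + 2 * \<kappa>)"
      unfolding w_def by (rule *(2)[OF h])
  qed
  obtain G :: "real \<Rightarrow> real" and B :: real where B: "0 < B"
    and G: "\<And>a. 0 \<le> a \<Longrightarrow> a \<le> 1 \<Longrightarrow> 0 \<le> G a \<and> G a \<le> B"
    and G_upper: "\<And>a b. 0 \<le> a \<Longrightarrow> a \<le> 1 \<Longrightarrow> 0 \<le> b \<Longrightarrow> b \<le> 1 \<Longrightarrow> N \<bar>G a - G b\<bar> \<le> \<bar>a - b\<bar>"
    and G_lower: "\<And>\<eta>. 0 < \<eta> \<Longrightarrow> \<exists>\<omega>>0. \<forall>a b :: (nat \<times> int \<times> bool option) list \<Rightarrow> real.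
        (\<forall>l. 0 \<le> a l) \<longrightarrow> (\<forall>l. 0 \<le> b l) \<longrightarrow>
        (\<Sum>\<^sup>+ l. ennreal (a l)) = 1 \<longrightarrow> (\<Sum>\<^sup>+ l. ennreal (b l)) = 1 \<longrightarrow>
        ennreal \<eta> \<le> (\<Sum>\<^sup>+ l. ennreal \<bar>a l - b l\<bar>) \<longrightarrow>
        ennreal \<omega> \<le> (\<Sum>\<^sup>+ l. ennreal (N \<bar>G (a l) - G (b l)\<bar>))"
    by (rule orlicz_inverse_map[OF N, where 'l = "(nat \<times> int \<times> bool option) list"]) (rule that)
  \<comment> \<open>For the zero sequence every law sits on the empty word, with weight 1 for all k.
    Subtracting its image removes this nonsummable constant and leaves differences
    unchanged.\<close>
  define F where "F = (\<lambda>x (k, l). G (w k x l) - G (w k (\<lambda>n. 0) l))"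
  define Sk where "Sk = (\<lambda>x y k. \<Sum>\<^sup>+ l. ennreal (N \<bar>G (w k x l) - G (w k y l)\<bar>))"
  define S where "S = (\<lambda>(x, y). \<Sum>\<^sup>+ i. ennreal (N \<bar>F x i - F y i\<bar>))"
  have S_eq: "S (x, y) = (\<Sum>\<^sup>+ k. Sk x y k)" for x y
    by (simp add: S_def Sk_def nsum_pair F_def)
  have HS: "controls hpairs H S"
  proof (rule controlsI_le[of "\<lambda>R. 5 * sqrt R"])
    show "((\<lambda>R. 5 * sqrt R) \<longlongrightarrow> 0) (at_right 0)"
      by (auto intro!: tendsto_eq_intros)
    fix P and R :: real
    assume P: "P \<in> hpairs" "0 < R" "H P \<le> ennreal R"
    obtain x y where xy: "P = (x, y)" "x \<in> mspace (orlicz_h_metric M)" "y \<in> mspace (orlicz_h_metric M)"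
      using P(1) by auto
    obtain h where h: "0 \<le> h" "H P = ennreal h"
      using H_fin[OF P(1)] by (cases "H P") auto
    have hR: "h \<le> R"
      using P h by simp
    have sR: "0 < sqrt R" "R = sqrt R * sqrt R" using P(2) by auto
    have Sk_le: "Sk x y k \<le> ennreal (5/2 * sqrt R * (1/2) ^ k)" for k
    proof -
      define r where "r = sqrt R"
      define t where "t = (1/2::real) ^ k"
      have rt: "0 < r" "R = r * r" "0 < t" using sR by (auto simp: r_def t_def)
      have t4: "(1/4::real) ^ k = t * t"
        by (simp add: t_def power_mult_distrib[symmetric])
      have "Sk x y k \<le> (\<Sum>\<^sup>+ l. ennreal \<bar>w k x l - w k y l\<bar>)"
        unfolding Sk_def
        by (intro nsum_mono ennreal_leI G_upper w_nonneg w_le_1 xy)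
      \<comment> \<open>The free weight is 2^-k sqrt R, which makes both terms multiples of 2^-k
        sqrt R and the sum over k geometric.\<close>
      also have "\<dots> \<le> ennreal ((1/4) ^ k * h / (2 * (t * r)) + 2 * (t * r))"
        using rt by (intro tv(2) xy h h(2)[unfolded xy(1)]) auto
      also have "\<dots> \<le> ennreal (5/2 * r * t)"
      proof (intro ennreal_leI)
        have "(1/4) ^ k * h / (2 * (t * r)) \<le> (1/4) ^ k * R / (2 * (t * r))"
          using hR rt by (intro divide_right_mono mult_left_mono) auto
        also have "\<dots> = t * r / 2"
          unfolding t4 using rt by (simp add: field_simps)
        finally show "(1/4) ^ k * h / (2 * (t * r)) + 2 * (t * r) \<le> 5/2 * r * t"
          by (simp add: mult_ac)
      qed
      finally show ?thesis by (simp add: r_def t_def)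
    qed
    have "S P \<le> (\<Sum>\<^sup>+ k. ennreal (5/2 * sqrt R * (1/2) ^ k))"
      unfolding xy(1) S_eq by (intro nsum_mono Sk_le)
    also have "\<dots> = ennreal (5 * sqrt R)"
      using nsum_geometric[of "1/2" "5/2 * sqrt R"] sR by simp
    finally show "S P \<le> ennreal (5 * sqrt R)" .
  qed simp
  have Sk_ge: "\<exists>\<omega>>0. \<forall>x\<in>mspace (orlicz_h_metric M). \<forall>y\<in>mspace (orlicz_h_metric M). \<forall>k h.
      0 \<le> h \<longrightarrow> H (x, y) = ennreal h \<longrightarrow> \<epsilon> \<le> (1/4) ^ k * h \<longrightarrow> ennreal \<omega> \<le> Sk x y k" if "0 < \<epsilon>" for \<epsilon> :: real
  proof -
    define \<eta> where "\<eta> = 2 - 2 * exp (- \<epsilon> / 2)"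
    have "0 < \<eta>" using that by (simp add: \<eta>_def)
    from G_lower[OF this] obtain \<omega> where \<omega>: "\<omega> > 0" "\<And>a b :: (nat \<times> int \<times> bool option) list \<Rightarrow> real.
        (\<And>l. 0 \<le> a l) \<Longrightarrow> (\<And>l. 0 \<le> b l) \<Longrightarrow> (\<Sum>\<^sup>+ l. ennreal (a l)) = 1 \<Longrightarrow> (\<Sum>\<^sup>+ l. ennreal (b l)) = 1 \<Longrightarrow>
        ennreal \<eta> \<le> (\<Sum>\<^sup>+ l. ennreal \<bar>a l - b l\<bar>) \<Longrightarrow>
        ennreal \<omega> \<le> (\<Sum>\<^sup>+ l. ennreal (N \<bar>G (a l) - G (b l)\<bar>))"
      by blast
    show ?thesis
    proof (intro exI[of _ \<omega>] conjI ballI allI impI \<omega>(1))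
      fix x y k and h :: real
      assume xy: "x \<in> mspace (orlicz_h_metric M)" "y \<in> mspace (orlicz_h_metric M)"
        and h: "0 \<le> h" "H (x, y) = ennreal h" "\<epsilon> \<le> (1/4) ^ k * h"
      show "ennreal \<omega> \<le> Sk x y k"
        unfolding Sk_def
      proof (rule \<omega>(2)[OF w_nonneg w_nonneg w_total[OF xy(1)] w_total[OF xy(2)]])
        have "\<eta> \<le> 2 - 2 * exp (- ((1/4) ^ k * h) / 2)"
          using h(3) by (simp add: \<eta>_def)
        then show "ennreal \<eta> \<le> (\<Sum>\<^sup>+ l. ennreal \<bar>w k x l - w k y l\<bar>)"
          by (rule order.trans[OF ennreal_leI tv(1)[OF xy h(1,2)]])
      qed
    qed
  qed
  have SH: "controls hpairs S H"
    unfolding controls_def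
  proof (intro conjI allI impI)
    fix R :: real assume R: "0 < R"
    obtain \<omega> where \<omega>: "\<omega> > 0" "\<forall>x\<in>mspace (orlicz_h_metric M). \<forall>y\<in>mspace (orlicz_h_metric M). \<forall>k h.
      0 \<le> h \<longrightarrow> H (x, y) = ennreal h \<longrightarrow> 1 \<le> (1/4) ^ k * h \<longrightarrow> ennreal \<omega> \<le> Sk x y k"
      using Sk_ge[of 1] by auto
    \<comment> \<open>If H exceeded 4^n, the first n values of k would each contribute at least
      \<open>\<omega>\<close>, for a total above R.\<close>
    obtain n :: nat where n: "R / \<omega> < real n"
      using reals_Archimedean2 by blast
    have "H P \<le> ennreal (4 ^ n)" if P: "P \<in> hpairs" "S P \<le> ennreal R" for P
    proof (rule ccontr)
      assume neg: "\<not> ?thesis"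
      obtain x y where xy: "P = (x, y)" "x \<in> mspace (orlicz_h_metric M)" "y \<in> mspace (orlicz_h_metric M)"
        using P(1) by auto
      obtain h where h: "0 \<le> h" "H P = ennreal h"
        using H_fin[OF P(1)] by (cases "H P") auto
      have h4: "4 ^ n < h"
        using neg h by (simp add: not_le ennreal_less_iff)
      have Sk: "ennreal \<omega> \<le> Sk x y k" if "k < n" for k
      proof -
        have "(4::real) ^ k \<le> 4 ^ n"
          using that by (intro power_increasing) auto
        with h4 have "4 ^ k \<le> h"
          by linarith
        then have "1 \<le> (1/4) ^ k * h"
          by (simp add: power_divide)
        then show ?thesis
          using \<omega>(2) xy h by blast
      qed
      have "ennreal (real n * \<omega>) = (\<Sum>k<n. ennreal \<omega>)"
        using \<omega>(1) by (simp add: ennreal_mult ennreal_of_nat_eq_real_of_nat)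
      also have "\<dots> \<le> (\<Sum>k<n. Sk x y k)"
        by (intro sum_mono Sk) auto
      also have "\<dots> \<le> S P"
        unfolding xy(1) S_eq by (rule sum_le_nsum) simp
      also have "\<dots> \<le> ennreal R"
        by (rule P(2))
      finally have "real n * \<omega> \<le> R"
        using R by simp
      with n \<omega>(1) show False
        by (simp add: field_simps)
    qed
    then show "\<exists>C>0. \<forall>P\<in>hpairs. S P \<le> ennreal R \<longrightarrow> H P \<le> ennreal C"
      by (intro exI[of _ "4 ^ n"]) auto
  next
    fix \<epsilon> :: real assume \<epsilon>: "0 < \<epsilon>"
    obtain \<omega> where \<omega>: "\<omega> > 0" "\<forall>x\<in>mspace (orlicz_h_metric M). \<forall>y\<in>mspace (orlicz_h_metric M). \<forall>k h.
      0 \<le> h \<longrightarrow> H (x, y) = ennreal h \<longrightarrow> \<epsilon> \<le> (1/4) ^ k * h \<longrightarrow> ennreal \<omega> \<le> Sk x y k"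
      using Sk_ge[OF \<epsilon>] by auto
    have "H P \<le> ennreal \<epsilon>" if P: "P \<in> hpairs" "S P \<le> ennreal (\<omega> / 2)" for P
    proof (rule ccontr)
      assume neg: "\<not> ?thesis"
      obtain x y where xy: "P = (x, y)" "x \<in> mspace (orlicz_h_metric M)" "y \<in> mspace (orlicz_h_metric M)"
        using P(1) by auto
      obtain h where h: "0 \<le> h" "H P = ennreal h"
        using H_fin[OF P(1)] by (cases "H P") auto
      have h4: "\<epsilon> \<le> (1/4) ^ 0 * h"
        using neg h \<epsilon> by (simp add: not_le ennreal_less_iff)
      have "ennreal \<omega> \<le> Sk x y 0"
        using \<omega>(2) xy h h4 by blast
      also have "\<dots> \<le> S P"
        unfolding xy(1) S_eq by (rule nsum_ge_point)
      also have "\<dots> \<le> ennreal (\<omega> / 2)"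
        by (rule P(2))
      finally show False
        using \<omega>(1) by simp
    qed
    then show "\<exists>\<delta>>0. \<forall>P\<in>hpairs. S P \<le> ennreal \<delta> \<longrightarrow> H P \<le> ennreal \<epsilon>"
      using \<omega>(1) by (intro exI[of _ "\<omega> / 2"]) auto
  qed
  have gH: "controls hpairs gauge H"
    using C(1) H_le by (intro controlsI_linear[of "3 * C"]) auto
  have Hg: "controls hpairs H gauge"
    using \<theta> H_ge by (intro controlsI_linear_ge[of \<theta>])
  show ?thesis
  proof (rule strongly_uniformly_embeds_orlicz_hI[OF N B, of "orlicz_h_metric M" F "\<lambda>n. 0"])
    fix x y and i :: "nat \<times> (nat \<times> int \<times> bool option) list"
    assume xy: "x \<in> mspace (orlicz_h_metric M)" "y \<in> mspace (orlicz_h_metric M)"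
    obtain k l where i: "i = (k, l)" by (cases i)
    show "\<bar>F x i - F y i\<bar> \<le> B"
      using G[OF w_nonneg w_le_1[OF xy(1)], of k l] G[OF w_nonneg w_le_1[OF xy(2)], of k l]
      by (auto simp: F_def i)
  next
    show "F (\<lambda>n. 0) i = 0" for i
      by (auto simp: F_def split: prod.splits)
    show "controls hpairs (\<lambda>(x, y). ennreal (mdist (orlicz_h_metric M) x y))
        (\<lambda>(x, y). \<Sum>\<^sup>+ i. ennreal (N \<bar>F x i - F y i\<bar>))"
      using controls_trans[OF controls_trans[OF dist_controls_gauge gH] HS] unfolding S_def .
    show "controls hpairs (\<lambda>(x, y). \<Sum>\<^sup>+ i. ennreal (N \<bar>F x i - F y i\<bar>))
        (\<lambda>(x, y). ennreal (mdist (orlicz_h_metric M) x y))"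
      using controls_trans[OF controls_trans[OF SH Hg] gauge_controls_dist] unfolding S_def .
  qed (rule zero)
qed

end

lemma embeds_of_index_less_2:
  assumes M: "orlicz_function M" "nondegenerate M" and N: "orlicz_function N" "nondegenerate N"
    and less: "upper_MO_index M < 2" "upper_MO_index N < \<infinity>"
  shows "strongly_uniformly_embeds (orlicz_h_metric M) (orlicz_h_metric N)"
proof -
  obtain p where p: "ereal p < 2" "dominates_power M p"
    using upper_MO_index_less[OF M less(1)] .
  obtain Q where Q: "dominates_power N Q"
    using upper_MO_index_less[OF N less(2)] by blast
  obtain c where c: "power_dominating M p c"
    using power_dominatingI[OF M p(2)] .
  show ?thesis
    using power_dominating.embeds_of_power_less_2[OF c N Q] p(1) by simp
qed

theorem theorem4p2:
  fixes M N :: "real \<Rightarrow> real"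
  assumes "orlicz_function M" and "nondegenerate M"
    and "orlicz_function N" and "nondegenerate N"
    and "upper_MO_index M < upper_MO_index N
       \<or> (upper_MO_index N \<le> upper_MO_index M \<and> upper_MO_index M < 2)
       \<or> (upper_MO_index M = \<infinity> \<and> upper_MO_index N = \<infinity>)"
  shows "strongly_uniformly_embeds (orlicz_h_metric M) (orlicz_h_metric N)"
proof (cases "upper_MO_index N = \<infinity>")
  case True
  then show ?thesis
    using embeds_of_infinite_index assms by blast
next
  case False
  then have fin: "upper_MO_index N < \<infinity>"
    by simp
  show ?thesis
  proof (cases "upper_MO_index M < upper_MO_index N")
    case True
    then show ?thesis
      using embeds_of_larger_index fin assms by blast
  next
    case False
    \<comment> \<open>With a finite target index the third alternative is impossible and the first
      is excluded by the case, so the second one holds.\<close>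
    then have "upper_MO_index M < 2"
      using assms(5) \<open>upper_MO_index N \<noteq> \<infinity>\<close> by auto
    then show ?thesis
      using embeds_of_index_less_2 fin assms by blast
  qed
qed

end
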